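(* For any time $t$, almost surely there are infinitely many values of $x>0$ and infinitely many values of $x<0$ such that $F(x,1)>t$.
   Context: $\mathbb N=\{1,2,\dots\}$ and $\mathbb H=\{(x,y)\in\mathbb Z\times\mathbb N: x+y\text{ even}\}$, with the partial order $(x,y)\le(x',y')$ iff $x+y\le x'+y'$ and $y-x\le y'-x'$. (So $(x,1)\in\mathbb H$ means $x$ odd.) For $c+n$ odd, $T(c,n)=\{z\in\mathbb H: z\le(c,n-1)\}$. $A\subset\mathbb H$ is downward closed if $z\in A$, $w\le z$ imply $w\in A$. For downward closed $A\subset T(c,n)$ put $B=T(c,n)\setminus A$. The hook of $w=(x,y)\in B$ is $H_w=\{(x+k,y-k)\in B:k\ge0\}\cup\{(x-k,y-k)\in B:k\ge0\}$, $h_w=|H_w|$; the reverse hook of $z$ is $R_z=\{w\in B\setminus\{z\}:z\in H_w\}$; $z\in B$ is a corner if $H_z=\{z\}$. The hook probability of a corner is $\mathbf P(B,z)=\frac1{|B|}\prod_{y\in R_z}\frac{h_y}{h_y-1}$. The tableau process $X(c,n,r)(t)$ is the continuous-time Markov process on downward closed subsets of $T(c,n)$, started at $\emptyset$, that jumps from $A$ to $A\cup\{z\}$ at rate $r\,\mathbf P(T(c,n)\setminus A,z)$ for each corner $z$, with no other jumps. Its inclusion function is $z\mapsto\inf\{t:z\in X(t)\}\in[0,\infty]$, $z\in\mathbb H$. $F:\mathbb H\to[0,\infty)$ denotes the random function that is the limit in distribution (in $[0,\infty]^{\mathbb H}$ with the product topology) of the inclusion functions of $X(c_n,n,n)$ for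 any integers $c_n=o(n)$ with $c_n+n$ odd (the limit exists and does not depend on the choice of $c_n$). *)

theory Defs
  imports "HOL-Probability.Probability" "HOL-Library.Landau_Symbols"
begin

section \<open>The lattice half plane\<close>

type_synonym point = "int \<times> int"

definition half_plane :: "point set" where
  "half_plane = {(x, y). 1 \<le> y \<and> even (x + y)}"

text \<open>The order is defined on all of \<open>\<int> \<times> \<int>\<close>, so that \<open>triangle c n\<close> below makes sense
  (and is empty) also when its apex \<open>(c, n - 1)\<close> is not in the half plane.\<close>

definition point_le :: "point \<Rightarrow> point \<Rightarrow> bool" (infix "\<preceq>" 50) where
  "z \<preceq> w \<longleftrightarrow> fst z + snd z \<le> fst w + snd w \<and> snd z - fst z \<le> snd w - fst w"

definition triangle :: "int \<Rightarrow> nat \<Rightarrow> point set" where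
  "triangle c n = {z \<in> half_plane. z \<preceq> (c, int n - 1)}"

definition downward_closed :: "point set \<Rightarrow> bool" where
  "downward_closed A \<longleftrightarrow>
     A \<subseteq> half_plane \<and> (\<forall>z\<in>A. \<forall>w\<in>half_plane. w \<preceq> z \<longrightarrow> w \<in> A)"

section \<open>Hooks and hook probabilities\<close>

definition hook :: "point set \<Rightarrow> point \<Rightarrow> point set" where
  "hook B w = (let (x, y) = w in
     {z \<in> B. \<exists>k\<ge>0. z = (x + k, y - k)} \<union> {z \<in> B. \<exists>k\<ge>0. z = (x - k, y - k)})"

definition hook_length :: "point set \<Rightarrow> point \<Rightarrow> real" where
  "hook_length B w = real (card (hook B w))"

definition reverse_hook :: "point set \<Rightarrow> point \<Rightarrow> point set" where
  "reverse_hook B z = {w \<in> B - {z}. z \<in> hook B w}"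

definition corner :: "point set \<Rightarrow> point \<Rightarrow> bool" where
  "corner B z \<longleftrightarrow> z \<in> B \<and> hook B z = {z}"

definition hook_prob :: "point set \<Rightarrow> point \<Rightarrow> real" where
  "hook_prob B z =
     1 / real (card B) * (\<Prod>y\<in>reverse_hook B z. hook_length B y / (hook_length B y - 1))"

section \<open>Markov jump processes on a finite state space\<close>

definition generator :: "'s set \<Rightarrow> ('s \<Rightarrow> 's \<Rightarrow> real) \<Rightarrow> 's \<Rightarrow> 's \<Rightarrow> real" where
  "generator S q a b = (if a = b then - (\<Sum>u\<in>S - {a}. q a u) else q a b)"

primrec generator_power :: "'s set \<Rightarrow> ('s \<Rightarrow> 's \<Rightarrow> real) \<Rightarrow> nat \<Rightarrow> 's \<Rightarrow> 's \<Rightarrow> real" where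
  "generator_power S q 0 a b = (if a = b then 1 else 0)"
| "generator_power S q (Suc k) a b = (\<Sum>u\<in>S. generator S q a u * generator_power S q k u b)"

text \<open>The transition function is the matrix exponential of \<open>t\<close> times the generator.\<close>

definition transition_prob :: "'s set \<Rightarrow> ('s \<Rightarrow> 's \<Rightarrow> real) \<Rightarrow> real \<Rightarrow> 's \<Rightarrow> 's \<Rightarrow> real" where
  "transition_prob S q t a b = (\<Sum>k. t ^ k / fact k * generator_power S q k a b)"

text \<open>A continuous-time Markov process with right-continuous paths in the finite discrete space
  \<open>S\<close>, started at \<open>a0\<close>, jumping from \<open>a\<close> to \<open>b \<noteq> a\<close> at rate \<open>q a b\<close>.  The time parameter is
  nonnegative; the values of \<open>X\<close> at negative reals are irrelevant.\<close>

locale markov_jump_process = prob_space M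
  for M :: "'w measure" +
  fixes S :: "'s set"
    and q :: "'s \<Rightarrow> 's \<Rightarrow> real"
    and a0 :: 's
    and X :: "real \<Rightarrow> 'w \<Rightarrow> 's"
  assumes finite_states: "finite S"
    and measurable_process: "0 \<le> t \<Longrightarrow> X t \<in> measurable M (count_space S)"
    and right_continuous:
      "\<omega> \<in> space M \<Longrightarrow> 0 \<le> t \<Longrightarrow> eventually (\<lambda>u. X u \<omega> = X t \<omega>) (at_right t)"
    and start: "AE \<omega> in M. X 0 \<omega> = a0"
    and markov:
      "0 \<le> s 0 \<Longrightarrow> (\<And>i. i \<le> k \<Longrightarrow> s i < s (Suc i)) \<Longrightarrow> (\<And>i. i \<le> Suc k \<Longrightarrow> a i \<in> S) \<Longrightarrow>
       prob {\<omega> \<in> space M. \<forall>i\<le>Suc k. X (s i) \<omega> = a i} =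
       prob {\<omega> \<in> space M. \<forall>i\<le>k. X (s i) \<omega> = a i} *
         transition_prob S q (s (Suc k) - s k) (a k) (a (Suc k))"

section \<open>The tableau process and its inclusion function\<close>

definition tableau_states :: "int \<Rightarrow> nat \<Rightarrow> point set set" where
  "tableau_states c n = {A. downward_closed A \<and> A \<subseteq> triangle c n}"

text \<open>The sum has at most one summand, because a corner of the complement of \<open>A\<close> is not in \<open>A\<close>;
  it is empty, so that the rate is \<open>0\<close>, unless \<open>A'\<close> arises from \<open>A\<close> by adding a corner.\<close>

definition tableau_rate :: "int \<Rightarrow> nat \<Rightarrow> real \<Rightarrow> point set \<Rightarrow> point set \<Rightarrow> real" where
  "tableau_rate c n r A A' =
     (\<Sum>z | corner (triangle c n - A) z \<and> A' = insert z A. r * hook_prob (triangle c n - A) z)"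

definition tableau_process ::
  "int \<Rightarrow> nat \<Rightarrow> real \<Rightarrow> 'w measure \<Rightarrow> (real \<Rightarrow> 'w \<Rightarrow> point set) \<Rightarrow> bool" where
  "tableau_process c n r M X \<longleftrightarrow>
     markov_jump_process M (tableau_states c n) (tableau_rate c n r) {} X"

text \<open>The value is \<open>\<infinity>\<close> if \<open>z\<close> is never included.\<close>

definition inclusion_function :: "(real \<Rightarrow> point set) \<Rightarrow> point \<Rightarrow> ennreal" where
  "inclusion_function A z = (INF t\<in>{t. 0 \<le> t \<and> z \<in> A t}. ennreal t)"

section \<open>Convergence in distribution\<close>

definition converges_in_distribution ::
  "'s topology \<Rightarrow> (nat \<Rightarrow> 'b measure) \<Rightarrow> (nat \<Rightarrow> 'b \<Rightarrow> 's) \<Rightarrow> 'a measure \<Rightarrow> ('a \<Rightarrow> 's) \<Rightarrow> bool" where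
  "converges_in_distribution S N Y M Z \<longleftrightarrow>
     (\<forall>g. continuous_map S euclideanreal g \<and> bounded (g ` topspace S) \<longrightarrow>
        (\<lambda>n. \<integral>\<omega>. g (Y n \<omega>) \<partial>N n) \<longlonglongrightarrow> (\<integral>\<omega>. g (Z \<omega>) \<partial>M))"

text \<open>The space \<open>[0, \<infinity>]\<close> to the power of the half plane, with the product topology. Its points
  are the functions that are \<open>undefined\<close> outside the half plane, hence the use of \<open>restrict\<close> when
  random functions are considered as elements of this space.\<close>

definition half_plane_functions :: "(point \<Rightarrow> ennreal) topology" where
  "half_plane_functions = product_topology (\<lambda>_. euclidean) half_plane"

end

(* The argument compares the finite tableau processes with each other through their semigroups, using
   only their one-time distributions.

   The hook walk identity makes the total jump rate of X(c,n,n) equal to n as long as the triangle is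
   not full.  The rate of a point increases with the current state, so a process with pointwise
   smaller rates gives smaller expectations to increasing functions.  Since (2v-1)/(2v-2) >=
   sqrt(v/(v-1)), the process in a large triangle near its centre dominates, in a fixed triangle of
   size n, the process of that triangle slowed down by a factor close to 1 (for large n, and as long
   as O(n) points are included).  In disjoint triangles the slowed processes are independent, and
   their one-point probabilities are close to those of the limit.  Hence the events F(x,1) <= t for m
   far apart values of x have joint probability at most about P(F(1,1) <= t)^m.

   It remains to see that P(F(1,1) <= t) < 1.  Given a state that does not contain (x,1), the rate of
   (x,1) is at most 8 exp(S), where S sums the numbers of included points on the diagonals that cross
   the reverse hook of (x,1), weighted by the inverse squared distance.  The sum of S over x is at
   most four times the number of included points, so S is bounded in probability for a suitable x, and
   by attractiveness (x,1) survives until time t with probability bounded below. *)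

theory Submission
  imports Defs "HOL-Real_Asymp.Real_Asymp"
begin


section \<open>Exponentials of matrices over a finite set\<close>

text \<open>Nothing is known about F beyond its being a limit, so all estimates concern finite
  triangles at fixed times and must tolerate a loss of time. Hence the times
  \<open>t0 < t1 < t2\<close> over which the distribution function of F(1,1) hardly increases: they
  replace its continuity and pay both for the passage to the limit and for the slow-down by
  \<theta>.

  The square root has exactly the right order. The normalisation of the rates is about
  \<open>2 / n\<close> in a triangle of size \<open>n\<close> and \<open>2 / N\<close> in one of
  size \<open>N\<close>; the extra hook ratios on the two upward diagonals from a low central point,
  bounded below by square roots, multiply to about \<open>N / n\<close> and restore the balance.

  Domination bounds increasing functions of the large process from below, while the joint event
  needs an upper bound. This works because the one-point probabilities of the large process and of
  the slowed small ones differ only by the chosen error: a dominating process whose marginals almost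
  agree must almost agree jointly. The size \<open>n\<close> of the small triangles is fixed first;
  only then does the large size tend to infinity.\<close>

definition mat_op :: "'s set \<Rightarrow> ('s \<Rightarrow> 's \<Rightarrow> real) \<Rightarrow> ('s \<Rightarrow> real) \<Rightarrow> 's \<Rightarrow> real" where
  "mat_op S G f a = (\<Sum>b\<in>S. G a b * f b)"

text \<open>The matrix exponential \<open>exp (t G)\<close> applied to \<open>f\<close>, written as
  a power series in \<open>t\<close> so that termwise differentiation applies.\<close>

definition mat_flow ::
  "'s set \<Rightarrow> ('s \<Rightarrow> 's \<Rightarrow> real) \<Rightarrow> real \<Rightarrow> ('s \<Rightarrow> real) \<Rightarrow> 's \<Rightarrow> real" where
  "mat_flow S G t f a = (\<Sum>k. (mat_op S G ^^ k) f a / fact k * t ^ k)"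

lemma mat_op_cong: "(\<And>b. b \<in> S \<Longrightarrow> f b = g b) \<Longrightarrow> mat_op S G f = mat_op S G g"
  by (auto simp: mat_op_def fun_eq_iff intro!: sum.cong)

lemma mat_op_pow_cong:
  assumes "\<And>b. b \<in> S \<Longrightarrow> f b = g b" "a \<in> S"
  shows "(mat_op S G ^^ k) f a = (mat_op S G ^^ k) g a"
proof -
  have "\<forall>b\<in>S. (mat_op S G ^^ k) f b = (mat_op S G ^^ k) g b"
    using assms(1) by (induction k) (auto cong: mat_op_cong)
  with assms(2) show ?thesis by blast
qed

lemma mat_op_pow_cong_matrix:
  assumes "\<And>a f. a \<in> S \<Longrightarrow> mat_op S G f a = mat_op S G' f a" "a \<in> S"
  shows "(mat_op S G ^^ k) f a = (mat_op S G' ^^ k) f a"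
proof -
  have "\<forall>b\<in>S. (mat_op S G ^^ k) f b = (mat_op S G' ^^ k) f b"
  proof (induction k)
    case (Suc k)
    then have "mat_op S G ((mat_op S G ^^ k) f) = mat_op S G ((mat_op S G' ^^ k) f)"
      by (intro mat_op_cong) blast
    then show ?case by (simp add: assms(1))
  qed auto
  with assms(2) show ?thesis by blast
qed

lemma mat_flow_cong:
  assumes "\<And>b. b \<in> S \<Longrightarrow> f b = g b" "a \<in> S"
  shows "mat_flow S G t f a = mat_flow S G t g a"
  unfolding mat_flow_def using mat_op_pow_cong[OF assms] by simp

text \<open>Lets the generator between states be exchanged for the matrix of rates per point; the
  two are compared only through their action on functions.\<close>

lemma mat_flow_cong_matrix:
  assumes "\<And>a f. a \<in> S \<Longrightarrow> mat_op S G f a = mat_op S G' f a" "a \<in> S"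
  shows "mat_flow S G t f a = mat_flow S G' t f a"
  unfolding mat_flow_def using mat_op_pow_cong_matrix[OF assms] by simp

lemma mat_op_sum: "mat_op S G (\<lambda>b. \<Sum>i\<in>I. c i * f i b) a = (\<Sum>i\<in>I. c i * mat_op S G (f i) a)"
  unfolding mat_op_def sum_distrib_left
  by (subst sum.swap) (simp add: mult_ac)

lemma mat_op_pow_sum:
  "(mat_op S G ^^ k) (\<lambda>b. \<Sum>i\<in>I. c i * f i b) a = (\<Sum>i\<in>I. c i * (mat_op S G ^^ k) (f i) a)"
proof (induction k arbitrary: a)
  case (Suc k)
  then have "(mat_op S G ^^ k) (\<lambda>b. \<Sum>i\<in>I. c i * f i b)
      = (\<lambda>a. \<Sum>i\<in>I. c i * (mat_op S G ^^ k) (f i) a)"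
    by blast
  then show ?case by (simp add: mat_op_sum)
qed simp

lemma mat_op_pow_bound:
  assumes "finite S" "a \<in> S"
  shows "\<bar>(mat_op S G ^^ k) f a\<bar> \<le> (\<Sum>a\<in>S. \<Sum>b\<in>S. \<bar>G a b\<bar>) ^ k * (\<Sum>b\<in>S. \<bar>f b\<bar>)"
  using assms(2)
proof (induction k arbitrary: a)
  case 0
  then show ?case using assms(1) by (auto intro: member_le_sum)
next
  case (Suc k)
  let ?C = "\<Sum>a\<in>S. \<Sum>b\<in>S. \<bar>G a b\<bar>" and ?B = "\<Sum>b\<in>S. \<bar>f b\<bar>"
  have nn: "0 \<le> ?C ^ k * ?B" by (intro mult_nonneg_nonneg zero_le_power sum_nonneg) auto
  have "\<bar>(mat_op S G ^^ Suc k) f a\<bar> \<le> (\<Sum>b\<in>S. \<bar>G a b * (mat_op S G ^^ k) f b\<bar>)"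
    by (simp add: mat_op_def[of S G "(mat_op S G ^^ k) f"])
  also have "\<dots> \<le> (\<Sum>b\<in>S. \<bar>G a b\<bar> * (?C ^ k * ?B))"
    unfolding abs_mult by (intro sum_mono mult_left_mono Suc.IH) auto
  also have "\<dots> = (\<Sum>b\<in>S. \<bar>G a b\<bar>) * (?C ^ k * ?B)" by (simp add: sum_distrib_right)
  also have "\<dots> \<le> ?C * (?C ^ k * ?B)"
  proof (rule mult_right_mono[OF _ nn])
    show "(\<Sum>b\<in>S. \<bar>G a b\<bar>) \<le> ?C"
      using assms(1) Suc.prems by (intro member_le_sum[of a S "\<lambda>a. \<Sum>b\<in>S. \<bar>G a b\<bar>"])
        (auto intro: sum_nonneg)
  qed
  finally show ?case by (simp add: mult_ac)
qed

lemma mat_flow_summable: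
  assumes "finite S" "a \<in> S"
  shows "summable (\<lambda>k. (mat_op S G ^^ k) f a / fact k * t ^ k)"
proof (rule summable_comparison_test')
  let ?C = "\<Sum>a\<in>S. \<Sum>b\<in>S. \<bar>G a b\<bar>" and ?B = "\<Sum>b\<in>S. \<bar>f b\<bar>"
  show "summable (\<lambda>k. (inverse (fact k) * (?C * \<bar>t\<bar>) ^ k) * ?B)"
    by (intro summable_mult2 summable_exp)
  fix k :: nat assume "0 \<le> k"
  have "norm ((mat_op S G ^^ k) f a / fact k * t ^ k)
      = \<bar>(mat_op S G ^^ k) f a\<bar> * (\<bar>t\<bar> ^ k / fact k)"
    by (simp add: abs_mult power_abs)
  also have "\<dots> \<le> (?C ^ k * ?B) * (\<bar>t\<bar> ^ k / fact k)"
    by (intro mult_right_mono mat_op_pow_bound assms) auto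
  finally show "norm ((mat_op S G ^^ k) f a / fact k * t ^ k)
      \<le> (inverse (fact k) * (?C * \<bar>t\<bar>) ^ k) * ?B"
    by (simp add: field_simps power_mult_distrib)
qed

lemma mat_flow_0 [simp]: "mat_flow S G 0 f a = f a"
  unfolding mat_flow_def by (subst suminf_finite[of "{0}"]) auto

lemma mat_flow_sum:
  assumes "finite S" "a \<in> S"
  shows "mat_flow S G t (\<lambda>b. \<Sum>i\<in>I. c i * f i b) a = (\<Sum>i\<in>I. c i * mat_flow S G t (f i) a)"
proof -
  have "mat_flow S G t (\<lambda>b. \<Sum>i\<in>I. c i * f i b) a
      = (\<Sum>k. \<Sum>i\<in>I. c i * ((mat_op S G ^^ k) (f i) a / fact k * t ^ k))"
    unfolding mat_flow_def mat_op_pow_sum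
    by (simp add: sum_divide_distrib sum_distrib_right mult.assoc)
  also have "\<dots> = (\<Sum>i\<in>I. c i * mat_flow S G t (f i) a)"
    unfolding mat_flow_def
    by (subst suminf_sum, intro summable_mult mat_flow_summable assms)
      (intro sum.cong refl suminf_mult mat_flow_summable assms)
  finally show ?thesis .
qed

text \<open>The flow as a kernel acting on \<open>f\<close>. This separates the two time dependences
  when both the flow and the function vary.\<close>

lemma mat_flow_expand:
  assumes "finite S" "a \<in> S"
  shows "mat_flow S G t f a = (\<Sum>b\<in>S. f b * mat_flow S G t (\<lambda>u. of_bool (u = b)) a)"
proof -
  have "mat_flow S G t f a = mat_flow S G t (\<lambda>u. \<Sum>b\<in>S. f b * of_bool (u = b)) a"
    by (rule mat_flow_cong) (use assms in \<open>auto simp: of_bool_def if_distrib cong: if_cong\<close>)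
  then show ?thesis by (simp add: mat_flow_sum[OF assms])
qed

lemma mat_flow_op_commute:
  assumes "finite S" "a \<in> S"
  shows "mat_flow S G t (mat_op S G f) a = mat_op S G (mat_flow S G t f) a"
proof -
  have "mat_op S G (mat_flow S G t f) a
      = (\<Sum>b\<in>S. \<Sum>k. G a b * ((mat_op S G ^^ k) f b / fact k * t ^ k))"
    unfolding mat_op_def[of S G "mat_flow S G t f"] unfolding mat_flow_def
    by (intro sum.cong refl suminf_mult[symmetric] mat_flow_summable assms)
  also have "\<dots> = (\<Sum>k. \<Sum>b\<in>S. G a b * ((mat_op S G ^^ k) f b / fact k * t ^ k))"
    by (intro suminf_sum[symmetric] summable_mult mat_flow_summable assms)
  also have "\<dots> = (\<Sum>k. (mat_op S G ^^ Suc k) f a / fact k * t ^ k)"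
    by (simp add: mat_op_def[of S G "(mat_op S G ^^ _) f"] sum_distrib_left sum_divide_distrib
      mult_ac)
  also have "\<dots> = mat_flow S G t (mat_op S G f) a"
    unfolding mat_flow_def by (simp add: funpow_swap1)
  finally show ?thesis ..
qed

lemma mat_flow_has_derivative:
  assumes "finite S" "a \<in> S"
  shows "((\<lambda>t. mat_flow S G t f a) has_real_derivative mat_op S G (mat_flow S G t f) a) (at t)"
proof -
  let ?c = "\<lambda>k. (mat_op S G ^^ k) f a / fact k"
  have "((\<lambda>t. \<Sum>k. ?c k * t ^ k) has_real_derivative (\<Sum>k. diffs ?c k * t ^ k)) (at t)"
    by (rule termdiffs_strong_converges_everywhere[OF mat_flow_summable[OF assms]])
  moreover have "(\<Sum>k. diffs ?c k * t ^ k) = mat_flow S G t (mat_op S G f) a"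
    unfolding mat_flow_def diffs_def
    by (intro suminf_cong) (simp add: funpow_swap1 field_simps del: of_nat_Suc)
  ultimately show ?thesis
    using mat_flow_op_commute[OF assms] unfolding mat_flow_def[abs_def] by simp
qed

text \<open>The product rule for kernel and function. Moving \<open>s\<close> from 0 to
  \<open>t\<close> interpolates between the flow of \<open>w 0\<close> and \<open>w t\<close>;
  uniqueness and every comparison below follow from the sign of this derivative.\<close>

lemma mat_flow_duhamel:
  assumes S: "finite S" "a \<in> S"
    and w: "\<And>b. b \<in> S \<Longrightarrow> ((\<lambda>s. w s b) has_real_derivative w' b) (at s)"
  shows "((\<lambda>s. mat_flow S G (t - s) (w s) a) has_real_derivative
           mat_flow S G (t - s) (\<lambda>b. w' b - mat_op S G (w s) b) a) (at s)"
proof -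
  let ?k = "\<lambda>u b. mat_flow S G u (\<lambda>v. of_bool (v = b)) a"
  let ?k' = "\<lambda>u b. mat_flow S G u (mat_op S G (\<lambda>v. of_bool (v = b))) a"
  have k: "((\<lambda>s. ?k (t - s) b) has_real_derivative - ?k' (t - s) b) (at s)" for b
  proof -
    have "((\<lambda>s. ?k (t - s) b) has_real_derivative ?k' (t - s) b * (0 - 1)) (at s)"
      unfolding mat_flow_op_commute[OF S]
      by (rule DERIV_chain2[OF mat_flow_has_derivative[OF S]]) (auto intro!: derivative_eq_intros)
    then show ?thesis by simp
  qed
  have "((\<lambda>s. \<Sum>b\<in>S. w s b * ?k (t - s) b) has_real_derivative
      (\<Sum>b\<in>S. w' b * ?k (t - s) b + (- ?k' (t - s) b) * w s b)) (at s)"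
    by (intro DERIV_sum DERIV_mult w k)
  moreover have "(\<lambda>s. \<Sum>b\<in>S. w s b * ?k (t - s) b) = (\<lambda>s. mat_flow S G (t - s) (w s) a)"
    by (subst (2) mat_flow_expand[OF S]) (rule refl)
  moreover have "(\<Sum>b\<in>S. w' b * ?k (t - s) b + (- ?k' (t - s) b) * w s b)
      = mat_flow S G (t - s) (\<lambda>b. w' b - mat_op S G (w s) b) a"
  proof -
    have "(\<Sum>b\<in>S. w s b * ?k' (t - s) b)
        = mat_flow S G (t - s) (\<lambda>u. \<Sum>b\<in>S. w s b * mat_op S G (\<lambda>v. of_bool (v = b)) u) a"
      by (rule mat_flow_sum[OF S, symmetric])
    also have "(\<lambda>u. \<Sum>b\<in>S. w s b * mat_op S G (\<lambda>v. of_bool (v = b)) u) = mat_op S G (w s)"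
      using S(1) unfolding mat_op_def[abs_def]
      by (auto simp: fun_eq_iff of_bool_def mult_ac if_distrib cong: if_cong)
    finally have "(\<Sum>b\<in>S. w s b * ?k' (t - s) b) = (\<Sum>b\<in>S. mat_op S G (w s) b * ?k (t - s) b)"
      by (subst (asm) mat_flow_expand[OF S])
    then show ?thesis
      by (subst mat_flow_expand[OF S]) (simp add: sum.distrib sum_subtractf left_diff_distrib
        sum_negf mult_ac)
  qed
  ultimately show ?thesis by simp
qed

lemma mat_flow_unique:
  assumes S: "finite S" "a \<in> S" and t: "0 \<le> t"
    and w: "\<And>s b. b \<in> S \<Longrightarrow> 0 \<le> s \<Longrightarrow> s \<le> t \<Longrightarrow>
      ((\<lambda>s. w s b) has_real_derivative mat_op S G (w s) b) (at s)"
  shows "w t a = mat_flow S G t (w 0) a"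
proof -
  let ?g = "\<lambda>s. mat_flow S G (t - s) (w s) a"
  have "(?g has_real_derivative 0) (at s)" if "0 \<le> s" "s \<le> t" for s
  proof -
    have "(?g has_real_derivative
        mat_flow S G (t - s) (\<lambda>b. mat_op S G (w s) b - mat_op S G (w s) b) a) (at s)"
      by (rule mat_flow_duhamel[OF S]) (use w that in auto)
    \<comment> \<open>The empty linear combination shows that the flow of the zero function
      vanishes.\<close>
    then show ?thesis
      using mat_flow_sum[OF S, of G "t - s" "\<lambda>_. 0" "\<lambda>_ _. 0" "{}"] by simp
  qed
  then have "?g 0 = ?g t"
    using t by (intro antisym DERIV_nonneg_imp_nondecreasing[of 0 t ?g]
        DERIV_nonpos_imp_nonincreasing[of 0 t ?g]) blast+
  then show ?thesis by simp
qed

lemma mat_flow_nonneg_matrix: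
  assumes "finite S" "a \<in> S" "0 \<le> t"
    and "\<And>a b. a \<in> S \<Longrightarrow> b \<in> S \<Longrightarrow> 0 \<le> G a b" "\<And>b. b \<in> S \<Longrightarrow> 0 \<le> f b"
  shows "0 \<le> mat_flow S G t f a"
proof -
  have "0 \<le> (mat_op S G ^^ k) f b" if "b \<in> S" for k b
    using that by (induction k arbitrary: b)
      (auto simp: mat_op_def[of S G "(mat_op S G ^^ _) f"] assms intro!: sum_nonneg
        mult_nonneg_nonneg)
  then show ?thesis
    unfolding mat_flow_def using assms by (intro suminf_nonneg mat_flow_summable) auto
qed

text \<open>Uniformization: adding a multiple of the identity to a generator makes it a nonnegative
  operator.\<close>

lemma mat_flow_shift:
  assumes S: "finite S" "a \<in> S" and t: "0 \<le> t"
  shows "mat_flow S G t f a = exp (- (l * t)) * mat_flow S (\<lambda>a b. G a b + l * of_bool (a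
    = b)) t f a"
proof -
  let ?P = "\<lambda>a b. G a b + l * of_bool (a = b)"
  let ?w = "\<lambda>s b. exp (- (l * s)) * mat_flow S ?P s f b"
  have P: "mat_op S ?P g b = mat_op S G g b + l * g b" if "b \<in> S" for g b
    using that S(1)
    by (simp add: mat_op_def distrib_right sum.distrib of_bool_def if_distrib[of "\<lambda>x. l * x"]
        if_distrib[of "\<lambda>x. x * g _"] cong: if_cong)
  have "?w t a = mat_flow S G t (?w 0) a"
  proof (rule mat_flow_unique[OF S t])
    fix s :: real and b assume b: "b \<in> S"
    have "((\<lambda>s. ?w s b) has_real_derivative
        exp (- (l * s)) * (- l) * mat_flow S ?P s f b
          + mat_op S ?P (mat_flow S ?P s f) b * exp (- (l * s))) (at s)"
      by (intro DERIV_mult mat_flow_has_derivative S(1) b) (auto intro!: derivative_eq_intros)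
    also have "exp (- (l * s)) * (- l) * mat_flow S ?P s f b
          + mat_op S ?P (mat_flow S ?P s f) b * exp (- (l * s)) = mat_op S G (?w s) b"
      unfolding P[OF b] by (simp add: mat_op_def sum_distrib_left algebra_simps)
    finally show "((\<lambda>s. ?w s b) has_real_derivative mat_op S G (?w s) b) (at s)" .
  qed
  then show ?thesis by simp
qed


section \<open>Growth processes\<close>

definition growth_gen :: "'p set \<Rightarrow> ('p set \<Rightarrow> 'p \<Rightarrow> real) \<Rightarrow> ('p set \<Rightarrow> real) \<Rightarrow> 'p set \<Rightarrow> real" where
  "growth_gen T \<rho> f a = (\<Sum>z\<in>T. \<rho> a z * (f (insert z a) - f a))"

definition growth_matrix :: "'p set \<Rightarrow> ('p set \<Rightarrow> 'p \<Rightarrow> real) \<Rightarrow> 'p set \<Rightarrow> 'p set \<Rightarrow> real" where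
  "growth_matrix T \<rho> a b = (\<Sum>z\<in>T. \<rho> a z * (of_bool (insert z a = b) - of_bool (a = b)))"

definition growth_flow ::
  "'p set set \<Rightarrow> 'p set \<Rightarrow> ('p set \<Rightarrow> 'p \<Rightarrow> real) \<Rightarrow> real \<Rightarrow> ('p set \<Rightarrow> real) \<Rightarrow> 'p set \<Rightarrow> real" where
  "growth_flow S T \<rho> = mat_flow S (growth_matrix T \<rho>)"

definition increasing_on :: "'p set set \<Rightarrow> ('p set \<Rightarrow> real) \<Rightarrow> bool" where
  "increasing_on S f \<longleftrightarrow> (\<forall>a\<in>S. \<forall>b\<in>S. a \<subseteq> b \<longrightarrow> f a \<le> f b)"

text \<open>Points of \<open>b\<close> are excluded: there the larger state is already ahead, and
  its rate is 0.\<close>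

definition attractive :: "'p set set \<Rightarrow> 'p set \<Rightarrow> ('p set \<Rightarrow> 'p \<Rightarrow> real) \<Rightarrow> bool" where
  "attractive S T \<rho> \<longleftrightarrow> (\<forall>a\<in>S. \<forall>b\<in>S. \<forall>z\<in>T. a \<subseteq> b \<longrightarrow> z \<notin> b \<longrightarrow> \<rho> a z \<le> \<rho> b z)"

locale growth =
  fixes S :: "'p set set" and T :: "'p set" and \<rho> :: "'p set \<Rightarrow> 'p \<Rightarrow> real"
  assumes finite_points: "finite T"
    and states: "S \<subseteq> Pow T"
    and rate_nonneg: "a \<in> S \<Longrightarrow> z \<in> T \<Longrightarrow> 0 \<le> \<rho> a z"
    and rate_closed: "a \<in> S \<Longrightarrow> z \<in> T \<Longrightarrow> \<rho> a z \<noteq> 0 \<Longrightarrow> z \<notin> a \<and> insert z a \<in> S"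
begin

abbreviation "gen \<equiv> growth_gen T \<rho>"
abbreviation "flow \<equiv> growth_flow S T \<rho>"

lemma finite_states: "finite S"
  using finite_subset[OF states] finite_points by simp

lemma mat_op_growth: "a \<in> S \<Longrightarrow> mat_op S (growth_matrix T \<rho>) f a = gen f a"
proof -
  assume a: "a \<in> S"
  have "mat_op S (growth_matrix T \<rho>) f a
      = (\<Sum>z\<in>T. \<Sum>b\<in>S. \<rho> a z * (of_bool (insert z a = b) - of_bool (a = b)) * f b)"
    unfolding mat_op_def growth_matrix_def sum_distrib_right by (rule sum.swap)
  also have "\<dots> = gen f a"
    unfolding growth_gen_def
  proof (rule sum.cong[OF refl])
    fix z assume z: "z \<in> T"
    show "(\<Sum>b\<in>S. \<rho> a z * (of_bool (insert z a = b) - of_bool (a = b)) * f b)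
        = \<rho> a z * (f (insert z a) - f a)"
    proof (cases "\<rho> a z = 0")
      case False
      then have "insert z a \<in> S" using rate_closed[OF a z] by simp
      moreover have "(\<Sum>b\<in>S. of_bool (c = b) * f b) = f c" if "c \<in> S" for c
        using that finite_states by (simp add: of_bool_def if_distrib[of "\<lambda>x. x
          * f _"] cong: if_cong)
      ultimately have "(\<Sum>b\<in>S. (of_bool (insert z a = b) - of_bool (a = b)) * f b) = f (insert z a)
        - f a"
        using a by (simp add: left_diff_distrib sum_subtractf)
      then show ?thesis by (simp add: mult.assoc flip: sum_distrib_left)
    qed simp
  qed
  finally show ?thesis .
qed

lemma flow_0 [simp]: "flow 0 f a = f a"
  by (simp add: growth_flow_def)

lemma flow_cong: "a \<in> S \<Longrightarrow> (\<And>b. b \<in> S \<Longrightarrow> f b = g b) \<Longrightarrow> flow t f a = flow t g a"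
  unfolding growth_flow_def by (rule mat_flow_cong)

lemma flow_has_derivative:
  "a \<in> S \<Longrightarrow> ((\<lambda>t. flow t f a) has_real_derivative gen (flow t f) a) (at t)"
  using mat_flow_has_derivative[OF finite_states, of a "growth_matrix T \<rho>" f t]
  by (simp add: growth_flow_def mat_op_growth)

lemma flow_sum:
  "a \<in> S \<Longrightarrow> flow t (\<lambda>b. \<Sum>i\<in>I. c i * f i b) a = (\<Sum>i\<in>I. c i * flow t (f i) a)"
  unfolding growth_flow_def by (rule mat_flow_sum[OF finite_states])

lemma flow_diff: "a \<in> S \<Longrightarrow> flow t (\<lambda>b. f b - g b) a = flow t f a - flow t g a"
  using flow_sum[of a t "\<lambda>i. if i then 1 else - 1" "\<lambda>i. if i then f else g" UNIV]
  by (simp add: UNIV_bool)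

lemma flow_cmult: "a \<in> S \<Longrightarrow> flow t (\<lambda>b. c * f b) a = c * flow t f a"
  using flow_sum[of a t "\<lambda>_. c" "\<lambda>_. f" "{()}"] by simp

section \<open>Positivity, comparison principle and monotonicity of growth flows\<close>

lemma flow_nonneg:
  assumes a: "a \<in> S" and t: "0 \<le> t" and f: "\<And>b. b \<in> S \<Longrightarrow> 0 \<le> f b"
  shows "0 \<le> flow t f a"
proof -
  \<comment> \<open>The sum of all rates exceeds the exit rate of each single state, so adding
    \<open>l\<close> makes the diagonal of the matrix nonnegative.\<close>
  define l where "l = (\<Sum>a\<in>S. \<Sum>z\<in>T. \<rho> a z)"
  have "0 \<le> mat_flow S (\<lambda>a b. growth_matrix T \<rho> a b + l * of_bool (a = b)) t f a"
  proof (rule mat_flow_nonneg_matrix[OF finite_states a t _ f])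
    fix a b assume ab: "a \<in> S" "b \<in> S"
    have l: "(\<Sum>z\<in>T. \<rho> a z) \<le> l"
      unfolding l_def using ab finite_states rate_nonneg
      by (intro member_le_sum[of a S "\<lambda>a. \<Sum>z\<in>T. \<rho> a z"]) (auto intro!: sum_nonneg)
    have "0 \<le> (\<Sum>z\<in>T. \<rho> a z * of_bool (insert z a = b))"
      using ab rate_nonneg by (intro sum_nonneg) auto
    moreover have "growth_matrix T \<rho> a b
        = (\<Sum>z\<in>T. \<rho> a z * of_bool (insert z a = b)) - (\<Sum>z\<in>T. \<rho> a z) * of_bool (a = b)"
      by (simp add: growth_matrix_def right_diff_distrib sum_subtractf sum_distrib_right)
    ultimately show "0 \<le> growth_matrix T \<rho> a b + l * of_bool (a = b)"
      using l by (cases "a = b") auto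
  qed
  then show ?thesis
    unfolding growth_flow_def by (subst mat_flow_shift[OF finite_states a t, of _ _ l]) simp
qed

lemma flow_mono:
  assumes "a \<in> S" "0 \<le> t" "\<And>b. b \<in> S \<Longrightarrow> f b \<le> g b"
  shows "flow t f a \<le> flow t g a"
  using flow_nonneg[OF assms(1,2), of "\<lambda>b. g b - f b"] assms flow_diff by simp

text \<open>Maximum principle: \<open>flow (t - s) (w s) a\<close> is nonincreasing in
  \<open>s\<close>, because its derivative is the flow of the nonpositive function
  \<open>w' - gen w\<close>. It takes the place of couplings of processes.\<close>

lemma subsolution_le_flow:
  assumes a: "a \<in> S" and t: "0 \<le> t"
    and w: "\<And>s b. b \<in> S \<Longrightarrow> 0 \<le> s \<Longrightarrow> s \<le> t \<Longrightarrow> ((\<lambda>s. w s b) has_real_derivative w' s b) (at s)"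
    and le: "\<And>s b. b \<in> S \<Longrightarrow> 0 \<le> s \<Longrightarrow> s \<le> t \<Longrightarrow> w' s b \<le> gen (w s) b"
    and init: "\<And>b. b \<in> S \<Longrightarrow> w 0 b \<le> f b"
  shows "w t a \<le> flow t f a"
proof -
  let ?g = "\<lambda>s. flow (t - s) (w s) a"
  have "\<exists>y. (?g has_real_derivative y) (at s) \<and> y \<le> 0" if s: "0 \<le> s" "s \<le> t" for s
  proof -
    have "(?g has_real_derivative
        flow (t - s) (\<lambda>b. w' s b - mat_op S (growth_matrix T \<rho>) (w s) b) a) (at s)"
      unfolding growth_flow_def using s by (intro mat_flow_duhamel finite_states a w)
    moreover have "flow (t - s) (\<lambda>b. w' s b - mat_op S (growth_matrix T \<rho>) (w s) b) a
        \<le> flow (t - s) (\<lambda>b. 0 * w' s b) a"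
      using s le by (intro flow_mono a) (auto simp: mat_op_growth)
    ultimately show ?thesis unfolding flow_cmult[OF a] by auto
  qed
  then have "?g t \<le> ?g 0" using t by (intro DERIV_nonpos_imp_nonincreasing[of 0 t ?g]) blast+
  also have "\<dots> \<le> flow t f a" using init t by (simp add: flow_mono a)
  finally show ?thesis by simp
qed

lemma flow_le_supersolution:
  assumes a: "a \<in> S" and t: "0 \<le> t"
    and w: "\<And>s b. b \<in> S \<Longrightarrow> 0 \<le> s \<Longrightarrow> s \<le> t \<Longrightarrow> ((\<lambda>s. w s b) has_real_derivative w' s b) (at s)"
    and le: "\<And>s b. b \<in> S \<Longrightarrow> 0 \<le> s \<Longrightarrow> s \<le> t \<Longrightarrow> gen (w s) b \<le> w' s b"
    and init: "\<And>b. b \<in> S \<Longrightarrow> f b \<le> w 0 b"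
  shows "flow t f a \<le> w t a"
proof -
  have "gen (\<lambda>b. - w s b) b = - gen (w s) b" for s b
    by (simp add: growth_gen_def sum_negf[symmetric] algebra_simps)
  then have "- w t a \<le> flow t (\<lambda>b. - f b) a"
    using w le init by (intro subsolution_le_flow[OF a t, where w' = "\<lambda>s b. - w' s b"])
      (auto intro!: DERIV_minus)
  then show ?thesis using flow_cmult[OF a, of t "-1" f] by simp
qed

lemma flow_const: "a \<in> S \<Longrightarrow> 0 \<le> t \<Longrightarrow> flow t (\<lambda>_. c) a = c"
  by (intro antisym flow_le_supersolution[where w = "\<lambda>_ _. c" and w' = "\<lambda>_ _. 0"]
      subsolution_le_flow[where w = "\<lambda>_ _. c" and w' = "\<lambda>_ _. 0"]) (auto simp: growth_gen_def)

text \<open>Points are only ever added, so \<open>U\<close> is never left; a function vanishing on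
  \<open>U\<close> stays invisible to a process started there.\<close>

lemma flow_supported:
  assumes a: "a \<in> S" "a \<in> U" and U: "\<And>a z. a \<in> U \<Longrightarrow> insert z a \<in> U"
    and f: "\<And>b. b \<in> S \<Longrightarrow> b \<in> U \<Longrightarrow> f b = 0"
  shows "flow t f a = 0"
proof -
  have "\<forall>b\<in>S \<inter> U. (mat_op S (growth_matrix T \<rho>) ^^ k) f b = 0" for k
  proof (induction k)
    case 0
    then show ?case using f by auto
  next
    case (Suc k)
    have "\<rho> b z * ((mat_op S (growth_matrix T \<rho>) ^^ k) f (insert z b)
        - (mat_op S (growth_matrix T \<rho>) ^^ k) f b) = 0" if "b \<in> S" "b \<in> U" "z \<in> T" for b z
    proof (cases "\<rho> b z = 0")
      case False
      then show ?thesis using rate_closed[OF that(1,3)] U[OF that(2)] Suc.IH that by auto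
    qed simp
    then show ?case
      by (auto simp: mat_op_growth growth_gen_def intro!: sum.neutral)
  qed
  then show ?thesis using a unfolding growth_flow_def mat_flow_def by simp
qed

text \<open>By uniformization it is enough that \<open>gen + l\<close> preserves increasing
  functions. For each point the gain in \<open>a\<close> is at most the gain in \<open>b\<close>
  plus the rate times \<open>g b - g a\<close>, and \<open>l\<close> supplies enough copies of that
  difference. The critical case is a point missing from both states, where attractiveness
  enters.\<close>

lemma flow_increasing:
  assumes attr: "attractive S T \<rho>" and f: "increasing_on S f" and t: "0 \<le> t"
  shows "increasing_on S (flow t f)"
proof -
  define l where "l = (\<Sum>a\<in>S. \<Sum>z\<in>T. \<rho> a z)"
  define P where "P = (\<lambda>a b. growth_matrix T \<rho> a b + l * of_bool (a = b))"
  have l: "(\<Sum>z\<in>T. \<rho> a z) \<le> l" if "a \<in> S" for a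
    unfolding l_def using that finite_states rate_nonneg
    by (intro member_le_sum[of a S "\<lambda>a. \<Sum>z\<in>T. \<rho> a z"]) (auto intro!: sum_nonneg)
  have P: "mat_op S P g a = gen g a + l * g a" if "a \<in> S" for g a
  proof -
    have "mat_op S P g a = mat_op S (growth_matrix T \<rho>) g a + (\<Sum>b\<in>S. l * of_bool (a = b) * g b)"
      by (simp add: mat_op_def P_def distrib_right sum.distrib)
    also have "(\<Sum>b\<in>S. l * of_bool (a = b) * g b) = l * g a"
      using that finite_states by (simp add: of_bool_def if_distrib[of "\<lambda>x. l * x"]
        if_distrib[of "\<lambda>x. x * g _"] cong: if_cong)
    finally show ?thesis using that by (simp add: mat_op_growth)
  qed
  have step: "increasing_on S (mat_op S P g)" if g: "increasing_on S g" for g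
    unfolding increasing_on_def
  proof (intro ballI impI)
    fix a b assume ab: "a \<in> S" "b \<in> S" "a \<subseteq> b"
    have gab: "g a \<le> g b" using g ab by (auto simp: increasing_on_def)
    have "\<rho> a z * (g (insert z a) - g a) \<le> \<rho> b z * (g (insert z b) - g b) + \<rho> a z * (g b - g a)"
      if z: "z \<in> T" for z
    proof (cases "\<rho> a z = 0")
      case True
      have "g b \<le> g (insert z b)" if "insert z b \<in> S"
        using that g ab(2) unfolding increasing_on_def by blast
      then have "0 \<le> \<rho> b z * (g (insert z b) - g b)"
        using rate_nonneg[OF ab(2) z] rate_closed[OF ab(2) z]
        by (cases "\<rho> b z = 0") auto
      then show ?thesis using True by simp
    next
      case False
      then have pos: "0 < \<rho> a z" and cl: "z \<notin> a" "insert z a \<in> S"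
        using rate_nonneg[OF ab(1) z] rate_closed[OF ab(1) z] by auto
      show ?thesis
      proof (cases "z \<in> b")
        case True
        then have "g (insert z a) \<le> g b" using g cl ab by (auto simp: increasing_on_def)
        moreover have "\<rho> b z = 0" using rate_closed[OF ab(2) z] True by auto
        ultimately show ?thesis using pos by simp
      next
        case False
        then have r: "\<rho> a z \<le> \<rho> b z" using attr ab z by (auto simp: attractive_def)
        then have cb: "insert z b \<in> S" using rate_closed[OF ab(2) z] pos by auto
        have "b \<subseteq> insert z b" "insert z a \<subseteq> insert z b" using ab by auto
        with cb have g1: "g b \<le> g (insert z b)" "g (insert z a) \<le> g (insert z b)"
          using g cl(2) ab(2) unfolding increasing_on_def by simp_all
        have "\<rho> a z * (g (insert z a) - g a) \<le> \<rho> a z * (g (insert z b) - g b) + \<rho> a z * (g b - g a)"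
          unfolding distrib_left[symmetric] using pos g1 by (intro mult_left_mono) auto
        also have "\<dots> \<le> \<rho> b z * (g (insert z b) - g b) + \<rho> a z * (g b - g a)"
          using r g1 by (simp add: mult_right_mono)
        finally show ?thesis .
      qed
    qed
    then have "gen g a \<le> gen g b + (\<Sum>z\<in>T. \<rho> a z) * (g b - g a)"
      unfolding growth_gen_def sum_distrib_right sum.distrib[symmetric] by (rule sum_mono)
    also have "\<dots> \<le> gen g b + l * (g b - g a)"
      using l[OF ab(1)] gab by (simp add: mult_right_mono)
    finally show "mat_op S P g a \<le> mat_op S P g b"
      using ab by (simp add: P algebra_simps)
  qed
  have pow: "increasing_on S ((mat_op S P ^^ k) f)" for k
    using f step by (induction k) auto
  show ?thesis
    unfolding increasing_on_def
  proof (intro ballI impI)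
    fix a b assume ab: "a \<in> S" "b \<in> S" "a \<subseteq> b"
    have "mat_flow S P t f a \<le> mat_flow S P t f b"
      unfolding mat_flow_def using pow ab t
      by (intro suminf_le mat_flow_summable finite_states)
        (auto simp: increasing_on_def intro!: mult_right_mono divide_right_mono)
    then show "flow t f a \<le> flow t f b"
      unfolding growth_flow_def P_def
      by (subst (1 2) mat_flow_shift[OF finite_states _ t, of _ _ _ l]) (use ab in auto)
  qed
qed

end

text \<open>The flow of the faster process is increasing, so lowering the rates lowers the generator
  applied to it: it is a supersolution for the slower process. Attractiveness is asked of the larger
  rates only, since stopped rates drop to 0 as the state grows.\<close>

lemma growth_domination:
  assumes g: "growth S T \<rho>" and g': "growth S T \<rho>'"
    and le: "\<And>a z. a \<in> S \<Longrightarrow> z \<in> T \<Longrightarrow> \<rho>' a z \<le> \<rho> a z"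
    and attr: "attractive S T \<rho>" and f: "increasing_on S f" and a: "a \<in> S" and t: "0 \<le> t"
  shows "growth_flow S T \<rho>' t f a \<le> growth_flow S T \<rho> t f a"
proof -
  interpret G: growth S T \<rho> by (rule g)
  interpret G': growth S T \<rho>' by (rule g')
  show ?thesis
  proof (rule G'.flow_le_supersolution[OF a t, where w = "\<lambda>s. G.flow s f" and w' = "\<lambda>s b. G.gen
    (G.flow s f) b"])
    fix s :: real and b assume b: "b \<in> S" "0 \<le> s"
    show "((\<lambda>s. G.flow s f b) has_real_derivative G.gen (G.flow s f) b) (at s)"
      using b by (intro G.flow_has_derivative)
    show "G'.gen (G.flow s f) b \<le> G.gen (G.flow s f) b"
      unfolding growth_gen_def
    proof (rule sum_mono)
      fix z assume z: "z \<in> T"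
      show "\<rho>' b z * (G.flow s f (insert z b) - G.flow s f b)
          \<le> \<rho> b z * (G.flow s f (insert z b) - G.flow s f b)"
      proof (cases "\<rho> b z = 0")
        case True
        then have "\<rho>' b z = 0" using le[OF b(1) z] G'.rate_nonneg[OF b(1) z] by simp
        then show ?thesis using True by simp
      next
        case False
        then have "insert z b \<in> S" using G.rate_closed[OF b(1) z] by simp
        then have "G.flow s f b \<le> G.flow s f (insert z b)"
          using G.flow_increasing[OF attr f b(2)] b(1) unfolding increasing_on_def by blast
        then show ?thesis using le[OF b(1) z] by (simp add: mult_right_mono)
      qed
    qed
  qed simp
qed


section \<open>The hook walk\<close>

text \<open>Rows and columns are indexed by arbitrary linear orders, so the diagonal coordinates of
  the half plane can be used without renumbering.\<close>

definition grid_hook :: "('a::linorder \<times> 'b::linorder) set \<Rightarrow> 'a \<times> 'b \<Rightarrow> ('a \<times> 'b) set" where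
  "grid_hook D w = {z \<in> D. fst z = fst w \<and> snd z \<le> snd w \<or> snd z = snd w \<and> fst z \<le> fst w}"

text \<open>Stands in for the shape of a Young diagram: above each point \<open>(r, s)\<close> of
  \<open>D\<close>, the shape is the full product of its row and its column. This is what makes hook
  lengths additive.\<close>

definition rect_closed :: "('a::linorder \<times> 'b::linorder) set \<Rightarrow> bool" where
  "rect_closed D \<longleftrightarrow> (\<forall>r s i j. (r, s) \<in> D \<longrightarrow> r \<le> i \<longrightarrow> s \<le> j \<longrightarrow>
     ((i, j) \<in> D \<longleftrightarrow> (i, s) \<in> D \<and> (r, j) \<in> D))"

lemma sum_prod_telescope:
  fixes x :: "'a::linorder \<Rightarrow> real"
  assumes "finite J"
  shows "1 + (\<Sum>p\<in>J. x p * (\<Prod>q | q \<in> J \<and> q < p. 1 + x q)) = (\<Prod>p\<in>J. 1 + x p)"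
  using assms
proof (induction J rule: finite_linorder_max_induct)
  case (insert b A)
  have b: "b \<notin> A" using insert by auto
  have "(\<Sum>p\<in>A. x p * (\<Prod>q | q \<in> insert b A \<and> q < p. 1 + x q))
      = (\<Sum>p\<in>A. x p * (\<Prod>q | q \<in> A \<and> q < p. 1 + x q))"
  proof (rule sum.cong[OF refl])
    fix p assume p: "p \<in> A"
    have "{q. q \<in> insert b A \<and> q < p} = {q. q \<in> A \<and> q < p}" using insert p by auto
    then show "x p * (\<Prod>q | q \<in> insert b A \<and> q < p. 1 + x q)
        = x p * (\<Prod>q | q \<in> A \<and> q < p. 1 + x q)" by simp
  qed
  moreover have "{q. q \<in> insert b A \<and> q < b} = A" using insert by auto
  ultimately have "1 + (\<Sum>p\<in>insert b A. x p * (\<Prod>q | q \<in> insert b A \<and> q < p. 1 + x q))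
      = (1 + (\<Sum>p\<in>A. x p * (\<Prod>q | q \<in> A \<and> q < p. 1 + x q))) + x b * (\<Prod>q\<in>A. 1 + x q)"
    using insert b by simp
  also have "\<dots> = (\<Prod>p\<in>insert b A. 1 + x p)"
    using insert b by (simp add: insert.IH distrib_right)
  finally show ?case .
qed simp

text \<open>One coordinate factor of the probability that the hook walk ends in a given corner: the
  solution of the recursion in \<open>sum_walk_weight_below\<close> with value 1 at the least index
  \<open>u\<close>.\<close>

definition walk_weight :: "'a::linorder set \<Rightarrow> 'a \<Rightarrow> ('a \<Rightarrow> real) \<Rightarrow> 'a \<Rightarrow> real" where
  "walk_weight U u h i = (if i = u then 1 else 1 / h i * (\<Prod>q | q \<in> U - {u} \<and> q < i. 1 + 1 / h q))"

lemma sum_walk_weight: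
  assumes "finite U" "u \<in> U"
  shows "(\<Sum>p\<in>U. walk_weight U u h p) = (\<Prod>p\<in>U - {u}. 1 + 1 / h p)"
proof -
  have "(\<Sum>p\<in>U. walk_weight U u h p) = walk_weight U u h u + (\<Sum>p\<in>U - {u}. walk_weight U u h p)"
    by (rule sum.remove[OF assms])
  also have "(\<Sum>p\<in>U - {u}. walk_weight U u h p)
      = (\<Sum>p\<in>U - {u}. 1 / h p * (\<Prod>q | q \<in> U - {u} \<and> q < p. 1 + 1 / h q))"
    by (intro sum.cong) (auto simp: walk_weight_def)
  finally show ?thesis
    using sum_prod_telescope[of "U - {u}" "\<lambda>p. 1 / h p"] assms by (simp add: walk_weight_def)
qed

text \<open>Below \<open>i\<close> the weights telescope to the very product that occurs in the
  weight of \<open>i\<close>, which carries the additional factor \<open>1 / h i\<close>.\<close>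

lemma sum_walk_weight_below:
  assumes U: "finite U" "u \<in> U" "\<And>p. p \<in> U \<Longrightarrow> u \<le> p"
    and h: "h u = 0" "\<And>p. p \<in> U - {u} \<Longrightarrow> 0 < h p" and i: "i \<in> U"
  shows "(\<Sum>p | p \<in> U \<and> p < i. walk_weight U u h p) = walk_weight U u h i * h i"
proof (cases "i = u")
  case True
  then have "{p. p \<in> U \<and> p < i} = {}" using U(3) by (auto simp: not_less)
  then show ?thesis using True h by (simp only: sum.empty)
next
  case False
  let ?U = "{p. p \<in> U \<and> p < i}"
  have "u \<in> ?U" using U(2) U(3)[OF i] False by auto
  have "(\<Sum>p\<in>?U. walk_weight U u h p) = (\<Sum>p\<in>?U. walk_weight ?U u h p)"
  proof (rule sum.cong[OF refl])
    fix p assume "p \<in> ?U"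
    then have "{q. q \<in> U - {u} \<and> q < p} = {q. q \<in> ?U - {u} \<and> q < p}" by auto
    then show "walk_weight U u h p = walk_weight ?U u h p" by (simp add: walk_weight_def)
  qed
  also have "\<dots> = (\<Prod>p\<in>?U - {u}. 1 + 1 / h p)"
    using U(1) \<open>u \<in> ?U\<close> by (intro sum_walk_weight) auto
  also have "?U - {u} = {p. p \<in> U - {u} \<and> p < i}" by auto
  finally show ?thesis using False h(2)[of i] i by (simp add: walk_weight_def)
qed

locale hook_shape =
  fixes D :: "('a::linorder \<times> 'b::linorder) set"
  assumes finite_shape: "finite D" and rect: "rect_closed D"
begin

definition "arm i j = {p. p < i \<and> (p, j) \<in> D}"
definition "leg i j = {q. q < j \<and> (i, q) \<in> D}"
definition "hl w = real (card (grid_hook D w))"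

lemma rectD:
  "(r, s) \<in> D \<Longrightarrow> r \<le> i \<Longrightarrow> s \<le> j \<Longrightarrow> (i, j) \<in> D \<longleftrightarrow> (i, s) \<in> D \<and> (r, j) \<in> D"
  using rect unfolding rect_closed_def by blast

lemma finite_arm: "finite (arm i j)"
proof -
  have "arm i j \<subseteq> fst ` D" by (force simp: arm_def)
  then show ?thesis using finite_shape finite_subset by blast
qed

lemma finite_leg: "finite (leg i j)"
proof -
  have "leg i j \<subseteq> snd ` D" by (force simp: leg_def)
  then show ?thesis using finite_shape finite_subset by blast
qed

lemma hook_split:
  assumes "(i, j) \<in> D"
  shows "grid_hook D (i, j) - {(i, j)} = (\<lambda>p. (p, j)) ` arm i j \<union> (\<lambda>q. (i, q)) ` leg i j"
  using assms by (auto simp: grid_hook_def arm_def leg_def)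

lemma sum_hook:
  assumes "(i, j) \<in> D"
  shows "sum f (grid_hook D (i, j) - {(i, j)})
    = (\<Sum>p\<in>arm i j. f (p, j)) + (\<Sum>q\<in>leg i j. f (i, q))"
proof -
  have "sum f (grid_hook D (i, j) - {(i, j)})
      = sum f ((\<lambda>p. (p, j)) ` arm i j) + sum f ((\<lambda>q. (i, q)) ` leg i j)"
    unfolding hook_split[OF assms]
    by (intro sum.union_disjoint finite_imageI finite_arm finite_leg) (auto simp: arm_def)
  then show ?thesis by (simp add: sum.reindex inj_on_def)
qed

lemma finite_hook: "finite (grid_hook D w)"
  using finite_shape by (auto simp: grid_hook_def)

lemma hl_eq:
  assumes "(i, j) \<in> D"
  shows "hl (i, j) - 1 = real (card (arm i j)) + real (card (leg i j))"
proof -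
  have "(i, j) \<in> grid_hook D (i, j)" using assms by (simp add: grid_hook_def)
  then have "hl (i, j) = 1 + real (card (grid_hook D (i, j) - {(i, j)}))"
    unfolding hl_def using finite_hook by (subst card.remove) auto
  then show ?thesis using sum_hook[OF assms, of "\<lambda>_. 1 :: real"] by simp
qed

text \<open>\<open>P w\<close> is the probability that the hook walk of Greene, Nijenhuis and Wilf from \<open>w\<close> ends in the
  corner. It has product form because the hook lengths satisfy
  \<open>hl (i, j) - 1 = (hl (i, s) - 1) + (hl (r, j) - 1)\<close>.\<close>

lemma walk_probability:
  assumes z: "(r, s) \<in> D" and corner: "grid_hook D (r, s) = {(r, s)}"
  obtains P :: "'a \<times> 'b \<Rightarrow> real" where
    "(\<Sum>w\<in>D. P w) = (\<Prod>y | y \<in> D - {(r, s)} \<and> (r, s) \<in> grid_hook D y. hl y / (hl y - 1))"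
    "\<And>w. w \<in> D \<Longrightarrow> (hl w - 1) * P w = (\<Sum>v\<in>grid_hook D w - {w}. P v)"
    "\<And>w. w \<in> D \<Longrightarrow> grid_hook D w = {w} \<Longrightarrow> P w = of_bool (w = (r, s))"
proof -
  define U where "U = {i. r \<le> i \<and> (i, s) \<in> D}"
  define V where "V = {j. s \<le> j \<and> (r, j) \<in> D}"
  have "U \<subseteq> fst ` D" "V \<subseteq> snd ` D" by (force simp: U_def V_def)+
  then have fin: "finite U" "finite V" using finite_shape finite_subset by blast+
  \<comment> \<open>A corner is the least element of its row and of its column, so the arms ending
    there need no lower cut-off.\<close>
  have cU: "p \<ge> r" if "(p, s) \<in> D" for p
  proof (rule ccontr)
    assume "\<not> p \<ge> r"
    then have "(p, s) \<in> grid_hook D (r, s)" using that by (auto simp: grid_hook_def)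
    then show False using corner \<open>\<not> p \<ge> r\<close> by auto
  qed
  have cV: "q \<ge> s" if "(r, q) \<in> D" for q
  proof (rule ccontr)
    assume "\<not> q \<ge> s"
    then have "(r, q) \<in> grid_hook D (r, s)" using that by (auto simp: grid_hook_def)
    then show False using corner \<open>\<not> q \<ge> s\<close> by auto
  qed
  define X where "X = walk_weight U r (\<lambda>i. hl (i, s) - 1)"
  define Y where "Y = walk_weight V s (\<lambda>j. hl (r, j) - 1)"
  \<comment> \<open>The walk only descends, hence the value 0 for starting points that do not
    dominate the corner.\<close>
  define P where "P w = (if r \<le> fst w \<and> s \<le> snd w then X (fst w) * Y (snd w) else 0)" for w
  have hx: "hl (i, s) - 1 > 0" if "i \<in> U - {r}" for i
  proof -
    have "r \<in> arm i s" using that z by (auto simp: U_def arm_def)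
    then have "card (arm i s) > 0" using finite_arm card_gt_0_iff by blast
    then show ?thesis using that hl_eq[of i s] by (simp add: U_def)
  qed
  have hy: "hl (r, j) - 1 > 0" if "j \<in> V - {s}" for j
  proof -
    have "s \<in> leg r j" using that z by (auto simp: V_def leg_def)
    then have "card (leg r j) > 0" using finite_leg card_gt_0_iff by blast
    then show ?thesis using that hl_eq[of r j] by (simp add: V_def)
  qed
  have h1: "hl (r, s) = 1" using corner by (simp add: hl_def)
  have UV0: "r \<in> U" "s \<in> V" using z by (auto simp: U_def V_def)
  have recX: "(\<Sum>p | p \<in> U \<and> p < i. X p) = X i * (hl (i, s) - 1)" if "i \<in> U" for i
    unfolding X_def using that h1 hx UV0
    by (intro sum_walk_weight_below[where h = "\<lambda>i. hl (i, s) - 1"] fin) (auto simp: U_def)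
  have recY: "(\<Sum>p | p \<in> V \<and> p < j. Y p) = Y j * (hl (r, j) - 1)" if "j \<in> V" for j
    unfolding Y_def using that h1 hy UV0
    by (intro sum_walk_weight_below[where h = "\<lambda>j. hl (r, j) - 1"] fin) (auto simp: V_def)
  \<comment> \<open>The starting points above the corner form a full rectangle, so the total of
    \<open>P\<close> factorizes.\<close>
  have UV: "{w \<in> D. r \<le> fst w \<and> s \<le> snd w} = U \<times> V"
  proof (rule set_eqI)
    fix w :: "'a \<times> 'b"
    obtain i j where w: "w = (i, j)" by fastforce
    show "w \<in> {w \<in> D. r \<le> fst w \<and> s \<le> snd w} \<longleftrightarrow> w \<in> U \<times> V"
      unfolding w U_def V_def using rectD[OF z, of i j] by simp blast
  qed
  have "(\<Sum>w\<in>D. P w) = (\<Sum>w\<in>U \<times> V. X (fst w) * Y (snd w))"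
    unfolding UV[symmetric] P_def[abs_def] using finite_shape by (simp add: sum.inter_filter)
  also have "\<dots> = (\<Sum>p\<in>U. X p) * (\<Sum>p\<in>V. Y p)"
    unfolding sum_product sum.cartesian_product by (rule sum.cong) auto
  also have "\<dots> = (\<Prod>p\<in>U - {r}. hl (p, s) / (hl (p, s) - 1)) * (\<Prod>p\<in>V - {s}. hl (r, p) / (hl (r, p)
    - 1))"
    unfolding X_def Y_def sum_walk_weight[OF fin(1) UV0(1)] sum_walk_weight[OF fin(2) UV0(2)]
  proof (intro arg_cong2[where f = "(*)"] prod.cong refl)
    show "1 + 1 / (hl (p, s) - 1) = hl (p, s) / (hl (p, s) - 1)" if "p \<in> U - {r}" for p
      using hx[OF that] by (simp add: field_simps)
    show "1 + 1 / (hl (r, p) - 1) = hl (r, p) / (hl (r, p) - 1)" if "p \<in> V - {s}" for p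
      using hy[OF that] by (simp add: field_simps)
  qed
  also have "\<dots> = (\<Prod>y | y \<in> D - {(r, s)} \<and> (r, s) \<in> grid_hook D y. hl y / (hl y - 1))"
  proof -
    have "{y. y \<in> D - {(r, s)} \<and> (r, s) \<in> grid_hook D y}
        = (\<lambda>p. (p, s)) ` (U - {r}) \<union> (\<lambda>p. (r, p)) ` (V - {s})"
      using z by (auto simp: grid_hook_def U_def V_def)
    moreover have "(\<Prod>y\<in>(\<lambda>p. (p, s)) ` (U - {r}) \<union> (\<lambda>p. (r, p)) ` (V - {s}). hl y / (hl y - 1))
        = (\<Prod>y\<in>(\<lambda>p. (p, s)) ` (U - {r}). hl y / (hl y - 1))
          * (\<Prod>y\<in>(\<lambda>p. (r, p)) ` (V - {s}). hl y / (hl y - 1))"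
      using fin by (intro prod.union_disjoint) auto
    ultimately show ?thesis by (simp add: prod.reindex inj_on_def)
  qed
  finally have 1: "(\<Sum>w\<in>D. P w)
      = (\<Prod>y | y \<in> D - {(r, s)} \<and> (r, s) \<in> grid_hook D y. hl y / (hl y - 1))" .
  have 2: "(hl w - 1) * P w = (\<Sum>v\<in>grid_hook D w - {w}. P v)" if w: "w \<in> D" for w
  proof (cases "r \<le> fst w \<and> s \<le> snd w")
    case False
    have "P v = 0" if "v \<in> grid_hook D w - {w}" for v
    proof -
      have "\<not> (r \<le> fst v \<and> s \<le> snd v)" using that False by (auto simp: grid_hook_def)
      then show ?thesis by (auto simp: P_def)
    qed
    then have "(\<Sum>v\<in>grid_hook D w - {w}. P v) = 0" by (intro sum.neutral) blast
    moreover have "P w = 0" using False by (auto simp: P_def)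
    ultimately show ?thesis by simp
  next
    case True
    obtain i j where ij: "w = (i, j)" by fastforce
    have ge: "r \<le> i" "s \<le> j" using True ij by auto
    have D: "(i, j) \<in> D" "(i, s) \<in> D" "(r, j) \<in> D" using rectD[OF z ge] w ij by auto
    then have iU: "i \<in> U" and jV: "j \<in> V" using ge by (auto simp: U_def V_def)
    have sub1: "{p. p \<in> U \<and> p < i} = arm i s" using cU by (auto simp: U_def arm_def)
    have sub1': "{p. p \<in> U \<and> p < i} = {p \<in> arm i j. r \<le> p}"
    proof -
      have "(p, s) \<in> D \<longleftrightarrow> (p, j) \<in> D" if "r \<le> p" for p
        using rectD[OF z that ge(2)] D by auto
      then show ?thesis by (auto simp: U_def arm_def)
    qed
    have sub2: "{p. p \<in> V \<and> p < j} = leg r j" using cV by (auto simp: V_def leg_def)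
    have sub2': "{p. p \<in> V \<and> p < j} = {p \<in> leg i j. s \<le> p}"
    proof -
      have "(r, p) \<in> D \<longleftrightarrow> (i, p) \<in> D" if "s \<le> p" for p
        using rectD[OF z ge(1) that] D by auto
      then show ?thesis by (auto simp: V_def leg_def)
    qed
    have arm: "card (arm i j) = card (arm r j) + card (arm i s)"
    proof -
      have "arm i j = arm r j \<union> {p \<in> arm i j. r \<le> p}" using ge by (auto simp: arm_def)
      moreover have "arm r j \<inter> {p \<in> arm i j. r \<le> p} = {}" by (auto simp: arm_def)
      ultimately show ?thesis
        using card_Un_disjoint[of "arm r j" "{p \<in> arm i j. r \<le> p}"] finite_arm sub1 sub1' by simp
    qed
    have leg: "card (leg i j) = card (leg i s) + card (leg r j)"
    proof -
      have "leg i j = leg i s \<union> {p \<in> leg i j. s \<le> p}" using ge by (auto simp: leg_def)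
      moreover have "leg i s \<inter> {p \<in> leg i j. s \<le> p} = {}" by (auto simp: leg_def)
      ultimately show ?thesis
        using card_Un_disjoint[of "leg i s" "{p \<in> leg i j. s \<le> p}"] finite_leg sub2 sub2' by simp
    qed
    have add: "hl (i, j) - 1 = (hl (i, s) - 1) + (hl (r, j) - 1)"
      by (simp add: hl_eq[OF D(1)] hl_eq[OF D(2)] hl_eq[OF D(3)] arm leg)
    have "(\<Sum>p\<in>arm i j. P (p, j)) = (\<Sum>p\<in>arm i j. if r \<le> p then X p * Y j else 0)"
      using ge by (intro sum.cong) (auto simp: P_def)
    also have "\<dots> = (\<Sum>p | p \<in> U \<and> p < i. X p * Y j)"
      unfolding sub1' by (rule sum.inter_filter[symmetric, OF finite_arm])
    also have "\<dots> = (X i * (hl (i, s) - 1)) * Y j"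
      by (simp only: sum_distrib_right[symmetric] recX[OF iU])
    finally have s1: "(\<Sum>p\<in>arm i j. P (p, j)) = (X i * (hl (i, s) - 1)) * Y j" .
    have "(\<Sum>q\<in>leg i j. P (i, q)) = (\<Sum>q\<in>leg i j. if s \<le> q then X i * Y q else 0)"
      using ge by (intro sum.cong) (auto simp: P_def)
    also have "\<dots> = (\<Sum>q | q \<in> V \<and> q < j. X i * Y q)"
      unfolding sub2' by (rule sum.inter_filter[symmetric, OF finite_leg])
    also have "\<dots> = X i * (Y j * (hl (r, j) - 1))"
      by (simp only: sum_distrib_left[symmetric] recY[OF jV])
    finally have s2: "(\<Sum>q\<in>leg i j. P (i, q)) = X i * (Y j * (hl (r, j) - 1))" .
    have "P w = X i * Y j" using ge ij by (simp add: P_def)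
    then show ?thesis
      unfolding ij sum_hook[OF D(1)] s1 s2 add by (simp add: algebra_simps)
  qed
  have 3: "P w = of_bool (w = (r, s))" if w: "w \<in> D" "grid_hook D w = {w}" for w
  proof (cases "r \<le> fst w \<and> s \<le> snd w")
    case True
    obtain i j where ij: "w = (i, j)" by fastforce
    have "(i, s) \<in> D" "(r, j) \<in> D" using rectD[OF z, of i j] w True ij by auto
    then have "(i, s) \<in> grid_hook D w" "(r, j) \<in> grid_hook D w"
      using True ij by (auto simp: grid_hook_def)
    then have "w = (r, s)" using w ij by auto
    then show ?thesis by (simp add: P_def X_def Y_def walk_weight_def)
  next
    case False
    then have "w \<noteq> (r, s)" by auto
    then show ?thesis using False by (auto simp: P_def)
  qed
  show ?thesis by (rule that[OF 1 2 3])
qed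

text \<open>Each product is the sum over all starting points of the probability to end in that
  corner. The walk from a fixed start ends in exactly one corner, so exchanging the sums gives 1 for
  every start.\<close>

theorem sum_hook_products:
  "(\<Sum>z | z \<in> D \<and> grid_hook D z = {z}. \<Prod>y | y \<in> D - {z} \<and> z \<in> grid_hook D y. hl y / (hl y - 1))
    = real (card D)"
proof -
  define C where "C = {z \<in> D. grid_hook D z = {z}}"
  have finC: "finite C" using finite_shape by (simp add: C_def)
  let ?good = "\<lambda>z P. (\<Sum>w\<in>D. P w) = (\<Prod>y | y \<in> D - {z} \<and> z \<in> grid_hook D y. hl y / (hl y - 1)) \<and>
    (\<forall>w\<in>D. (hl w - 1) * P w = (\<Sum>v\<in>grid_hook D w - {w}. P v)) \<and>
    (\<forall>w\<in>D. grid_hook D w = {w} \<longrightarrow> P w = of_bool (w = z))"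
  have "\<forall>z\<in>C. \<exists>P. ?good z P"
  proof
    fix z assume "z \<in> C"
    then have z: "(fst z, snd z) \<in> D" "grid_hook D (fst z, snd z) = {(fst z, snd z)}"
      by (auto simp: C_def)
    show "\<exists>P. ?good z P"
      by (rule walk_probability[OF z, unfolded prod.collapse], rule exI, intro conjI ballI impI)
  qed
  from bchoice[OF this] obtain P where Pall: "\<forall>z\<in>C. ?good z (P z)" ..
  have P: "\<And>z. z \<in> C \<Longrightarrow>
        (\<Sum>w\<in>D. P z w) = (\<Prod>y | y \<in> D - {z} \<and> z \<in> grid_hook D y. hl y / (hl y - 1))"
      "\<And>z w. z \<in> C \<Longrightarrow> w \<in> D \<Longrightarrow> (hl w - 1) * P z w = (\<Sum>v\<in>grid_hook D w - {w}. P z v)"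
      "\<And>z w. z \<in> C \<Longrightarrow> w \<in> D \<Longrightarrow> grid_hook D w = {w} \<Longrightarrow> P z w = of_bool (w = z)"
    using Pall by blast+
  have one: "(\<Sum>z\<in>C. P z w) = 1" if "w \<in> D" for w
    using that
  proof (induction "card {v \<in> D. fst v \<le> fst w \<and> snd v \<le> snd w}" arbitrary: w rule: less_induct)
    case less
    show ?case
    proof (cases "grid_hook D w = {w}")
      case True
      then have "(\<Sum>z\<in>C. P z w) = (\<Sum>z\<in>C. of_bool (w = z))"
        using P(3) less.prems by (intro sum.cong) auto
      also have "\<dots> = 1" using True less.prems finC by (simp add: C_def of_bool_def)
      finally show ?thesis .
    next
      case False
      have win: "w \<in> grid_hook D w" using less.prems by (simp add: grid_hook_def)
      have IH: "(\<Sum>z\<in>C. P z v) = 1" if v: "v \<in> grid_hook D w - {w}" for v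
      proof (rule less.hyps)
        show vD: "v \<in> D" using v by (simp add: grid_hook_def)
        have "{u \<in> D. fst u \<le> fst v \<and> snd u \<le> snd v} \<subset> {u \<in> D. fst u \<le> fst w \<and> snd u \<le> snd w}"
        proof
          show "{u \<in> D. fst u \<le> fst v \<and> snd u \<le> snd v} \<subseteq> {u \<in> D. fst u \<le> fst w \<and> snd u \<le> snd w}"
            using v by (auto simp: grid_hook_def)
          have "w \<notin> {u \<in> D. fst u \<le> fst v \<and> snd u \<le> snd v}"
            using v by (auto simp: grid_hook_def prod_eq_iff)
          then show "{u \<in> D. fst u \<le> fst v \<and> snd u \<le> snd v} \<noteq> {u \<in> D. fst u \<le> fst w \<and> snd u
            \<le> snd w}"
            using less.prems by blast
        qed
        then show "card {u \<in> D. fst u \<le> fst v \<and> snd u \<le> snd v} < card {u \<in> D. fst u \<le> fst w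
          \<and> snd u \<le> snd w}"
          using finite_shape by (intro psubset_card_mono) auto
      qed
      have hl: "hl w - 1 = real (card (grid_hook D w - {w}))"
        unfolding hl_def using win finite_hook by (subst card.remove[of _ w]) auto
      have "card (grid_hook D w - {w}) > 0"
      proof -
        have "grid_hook D w - {w} \<noteq> {}" using False win by blast
        then show ?thesis using finite_hook by (simp add: card_gt_0_iff)
      qed
      then have pos: "hl w - 1 > 0" using hl by simp
      have "(hl w - 1) * (\<Sum>z\<in>C. P z w) = (\<Sum>z\<in>C. \<Sum>v\<in>grid_hook D w - {w}. P z v)"
        unfolding sum_distrib_left using P(2) less.prems by (intro sum.cong) auto
      also have "\<dots> = (\<Sum>v\<in>grid_hook D w - {w}. 1)"
        by (subst sum.swap) (intro sum.cong refl IH)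
      also have "\<dots> = hl w - 1" using hl by simp
      finally show ?thesis using pos by simp
    qed
  qed
  have "(\<Sum>z\<in>C. \<Prod>y | y \<in> D - {z} \<and> z \<in> grid_hook D y. hl y / (hl y - 1)) = (\<Sum>z\<in>C. \<Sum>w\<in>D. P z w)"
    using P(1) by (intro sum.cong) auto
  also have "\<dots> = (\<Sum>w\<in>D. 1)" by (subst sum.swap) (intro sum.cong refl one)
  finally show ?thesis by (simp add: C_def)
qed

end


section \<open>Hooks in the half plane\<close>

lemma mem_hook:
  "z \<in> hook B w \<longleftrightarrow> z \<in> B \<and>
     (fst z + snd z = fst w + snd w \<and> snd z - fst z \<le> snd w - fst w \<or>
      snd z - fst z = snd w - fst w \<and> fst z + snd z \<le> fst w + snd w)"
proof -
  obtain x y u v where zw: "z = (x, y)" "w = (u, v)" by fastforce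
  have "(\<exists>k\<ge>0. z = (u + k, v - k)) \<longleftrightarrow> x + y = u + v \<and> y - x \<le> v - u"
    by (auto simp: zw intro!: exI[of _ "x - u"])
  moreover have "(\<exists>k\<ge>0. z = (u - k, v - k)) \<longleftrightarrow> y - x = v - u \<and> x + y \<le> u + v"
    by (auto simp: zw intro!: exI[of _ "u - x"])
  ultimately show ?thesis by (auto simp: hook_def zw)
qed

lemma mem_half_plane: "z \<in> half_plane \<longleftrightarrow> 1 \<le> snd z \<and> even (fst z + snd z)"
  by (cases z) (simp add: half_plane_def)

lemma mem_triangle:
  "z \<in> triangle c n \<longleftrightarrow> 1 \<le> snd z \<and> even (fst z + snd z) \<and>
     fst z + snd z \<le> c + int n - 1 \<and> snd z - fst z \<le> int n - 1 - c"
  by (auto simp: triangle_def mem_half_plane point_le_def)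

lemma triangle_subset: "triangle c n \<subseteq> half_plane"
  by (auto simp: triangle_def)

lemma finite_triangle: "finite (triangle c n)"
proof (rule finite_subset)
  show "triangle c n \<subseteq> {c - int n..c + int n} \<times> {0..int n}"
    by (auto simp: mem_triangle)
qed simp

lemma triangle_down: "z \<in> triangle c n \<Longrightarrow> w \<in> half_plane \<Longrightarrow> w \<preceq> z \<Longrightarrow> w \<in> triangle c n"
  by (auto simp: triangle_def point_le_def)

lemma hook_le: "z \<in> hook B w \<Longrightarrow> z \<preceq> w"
  by (auto simp: mem_hook point_le_def)

lemma card_triangle:
  assumes "odd (c + int n)"
  shows "card (triangle c n) = n * (n - 1) div 2"
proof -
  let ?f = "\<lambda>(j::nat, k::nat). (c - int (n - Suc j) + 1 + 2 * int k, int j + 1)"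
  let ?I = "SIGMA j:{..<n - 1}. {..<n - 1 - j}"
  have "triangle c n = ?f ` ?I"
  proof (intro set_eqI iffI)
    fix z assume z: "z \<in> triangle c n"
    obtain x y where xy: "z = (x, y)" by fastforce
    have b: "1 \<le> y" "even (x + y)" "x + y \<le> c + int n - 1" "y - x \<le> int n - 1 - c"
      using z by (auto simp: mem_triangle xy)
    define j where "j = nat (y - 1)"
    define k where "k = nat ((x - c + int n - 1 - y) div 2)"
    have j: "int j = y - 1" using b by (simp add: j_def)
    have "even (x - c + int n - 1 - y)" using b(2) assms by presburger
    then have k: "2 * int k = x - c + int n - 1 - y" using b by (simp add: k_def)
    have "z = ?f (j, k)" using j k b by (simp add: xy)
    moreover have "(j, k) \<in> ?I" using j k b by auto
    ultimately show "z \<in> ?f ` ?I" by (rule image_eqI)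
  next
    fix z assume "z \<in> ?f ` ?I"
    then obtain j k where jk: "j < n - 1" "k < n - 1 - j"
        "z = (c - int (n - Suc j) + 1 + 2 * int k, int j + 1)" by auto
    have e: "int (n - Suc j) = int n - 1 - int j" using jk by auto
    show "z \<in> triangle c n" using jk assms by (simp add: mem_triangle e)
  qed
  moreover have "inj_on ?f ?I" by (auto simp: inj_on_def)
  ultimately have "card (triangle c n) = card ?I" by (simp add: card_image)
  also have "\<dots> = (\<Sum>j<n - 1. n - 1 - j)" by simp
  also have "\<dots> = (\<Sum>j<n - 1. Suc j)"
    by (subst sum.nat_diff_reindex[symmetric]) (intro sum.cong, auto)
  also have "\<dots> = n * (n - 1) div 2"
  proof -
    have "(\<Sum>j<m. Suc j) = Suc m * m div 2" for m by (induction m) auto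
    then show ?thesis by (cases n) (simp_all add: mult.commute)
  qed
  finally show ?thesis .
qed

lemma card_full_hook:
  assumes "w \<in> half_plane"
  shows "real (card (hook half_plane w)) = 2 * real_of_int (snd w) - 1"
proof -
  obtain x y where w: "w = (x, y)" by fastforce
  have y: "1 \<le> y" "even (x + y)" using assms by (auto simp: mem_half_plane w)
  let ?R = "(\<lambda>k. (x + k, y - k)) ` {0..<y}" and ?L = "(\<lambda>k. (x - k, y - k)) ` {1..<y}"
  have "hook half_plane w = ?R \<union> ?L"
  proof (intro set_eqI iffI)
    fix z assume z: "z \<in> hook half_plane w"
    obtain u v where uv: "z = (u, v)" by fastforce
    show "z \<in> ?R \<union> ?L"
    proof (cases "u \<ge> x")
      case True
      then have "z = (x + (u - x), y - (u - x))" "u - x \<in> {0..<y}"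
        using z by (auto simp: mem_hook mem_half_plane w uv)
      then show ?thesis by blast
    next
      case False
      then have "z = (x - (x - u), y - (x - u))" "x - u \<in> {1..<y}"
        using z by (auto simp: mem_hook mem_half_plane w uv)
      then show ?thesis by blast
    qed
  next
    fix z assume "z \<in> ?R \<union> ?L"
    then show "z \<in> hook half_plane w" using y by (auto simp: mem_hook mem_half_plane w)
  qed
  moreover have "?R \<inter> ?L = {}" by auto
  ultimately have "card (hook half_plane w) = card ?R + card ?L"
    by (simp add: card_Un_disjoint)
  also have "\<dots> = nat y + nat (y - 1)"
    by (simp add: card_image inj_on_def)
  finally show ?thesis using y w by simp
qed

text \<open>An infinite hook would have \<open>card\<close> equal to 0, whereas
  \<open>2 * snd w - 1\<close> is positive.\<close>

lemma finite_full_hook: "w \<in> half_plane \<Longrightarrow> finite (hook half_plane w)"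
  using card_full_hook[of w] mem_half_plane[of w] card.infinite[of "hook half_plane w"] by fastforce

text \<open>The hook is taken in the half plane. Hooks point downwards, so every triangle containing
  \<open>w\<close> contains the whole hook; the ratio does not depend on the triangle, which makes
  triangles of different sizes comparable.\<close>

definition hook_ratio :: "point set \<Rightarrow> point \<Rightarrow> real" where
  "hook_ratio a w = real (card (hook half_plane w - a)) / (real (card (hook half_plane w - a)) - 1)"

text \<open>The reverse hook without reference to the state: above a point that is not included
  nothing is included.\<close>

definition up_hook :: "point set \<Rightarrow> point \<Rightarrow> point set" where
  "up_hook T z = {w \<in> T. w \<noteq> z \<and> z \<in> hook half_plane w}"

lemma tableau_statesD:
  assumes "a \<in> tableau_states c n"
  shows "a \<subseteq> triangle c n" "a \<subseteq> half_plane" "z \<in> a \<Longrightarrow> w \<in> half_plane \<Longrightarrow> w \<preceq> z \<Longrightarrow> w \<in> a"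
  using assms triangle_subset by (auto simp: tableau_states_def downward_closed_def)

lemma hook_triangle_diff:
  assumes "w \<in> triangle c n"
  shows "hook (triangle c n - a) w = hook half_plane w - a"
proof -
  have "z \<in> triangle c n" if "z \<in> hook half_plane w" for z
    using triangle_down[OF assms _ hook_le[OF that]] that by (simp add: mem_hook)
  then show ?thesis using subsetD[OF triangle_subset] unfolding set_eq_iff Diff_iff mem_hook
    by blast
qed

lemma reverse_hook_triangle:
  assumes a: "a \<in> tableau_states c n" and z: "z \<in> triangle c n - a"
  shows "reverse_hook (triangle c n - a) z = up_hook (triangle c n) z"
proof -
  have "w \<notin> a" if "w \<in> triangle c n" "z \<in> hook half_plane w" for w
    using tableau_statesD(3)[OF a, of w z] hook_le[OF that(2)] z triangle_subset by blast
  then show ?thesis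
    using z by (auto simp: reverse_hook_def up_hook_def hook_triangle_diff)
qed

lemma hook_prob_eq:
  assumes a: "a \<in> tableau_states c n" and z: "z \<in> triangle c n - a"
  shows "hook_prob (triangle c n - a) z
    = 1 / real (card (triangle c n - a)) * (\<Prod>w\<in>up_hook (triangle c n) z. hook_ratio a w)"
  unfolding hook_prob_def reverse_hook_triangle[OF a z]
  by (intro arg_cong2[where f = "(*)"] prod.cong refl)
    (auto simp: hook_ratio_def hook_length_def up_hook_def hook_triangle_diff)

lemma hook_diff_ge_2:
  assumes a: "a \<in> tableau_states c n" and z: "z \<in> half_plane" "z \<notin> a"
    and w: "w \<in> half_plane" "w \<noteq> z" "z \<in> hook half_plane w"
  shows "2 \<le> card (hook half_plane w - a)"
proof -
  have "w \<notin> a" using tableau_statesD(3)[OF a, of w z] hook_le[OF w(3)] z by blast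
  then have "{z, w} \<subseteq> hook half_plane w - a" using z w by (auto simp: mem_hook)
  then have "card {z, w} \<le> card (hook half_plane w - a)"
    using finite_full_hook[OF w(1)] by (intro card_mono) auto
  then show ?thesis using w(2) by simp
qed

lemma hook_ratio_ge_1:
  assumes "a \<in> tableau_states c n" "z \<in> half_plane" "z \<notin> a"
    "w \<in> half_plane" "w \<noteq> z" "z \<in> hook half_plane w"
  shows "1 \<le> hook_ratio a w"
  using hook_diff_ge_2[OF assms] by (simp add: hook_ratio_def)

lemma ratio_antimono: "1 < h \<Longrightarrow> h \<le> h' \<Longrightarrow> h' / (h' - 1) \<le> h / (h - (1::real))"
  by (simp add: frac_le_eq divide_simps) (simp add: algebra_simps)

lemma hook_ratio_mono:
  assumes "b \<in> tableau_states c n" "z \<in> half_plane" "z \<notin> b" "a \<subseteq> b"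
    "w \<in> half_plane" "w \<noteq> z" "z \<in> hook half_plane w"
  shows "hook_ratio a w \<le> hook_ratio b w"
proof -
  have "card (hook half_plane w - b) \<le> card (hook half_plane w - a)"
    using finite_full_hook[OF assms(5)] assms(4) by (intro card_mono) auto
  moreover have "2 \<le> card (hook half_plane w - b)" using assms by (intro hook_diff_ge_2) auto
  ultimately show ?thesis unfolding hook_ratio_def by (intro ratio_antimono) auto
qed

section \<open>Corners and the shape of the complement of a state\<close>

lemma corner_triangle:
  "corner (triangle c n - a) z \<longleftrightarrow>
     z \<in> triangle c n \<and> z \<notin> a \<and> hook half_plane z - {z} \<subseteq> a"
proof (cases "z \<in> triangle c n - a")
  case True
  then have "z \<in> hook half_plane z" using triangle_subset by (auto simp: mem_hook)
  then show ?thesis using True by (auto simp: corner_def hook_triangle_diff)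
qed (auto simp: corner_def)

lemma corner_below:
  assumes a: "a \<in> tableau_states c n" and c: "corner (triangle c n - a) z"
    and w: "w \<in> half_plane" "w \<preceq> z" "w \<noteq> z"
  shows "w \<in> a"
proof -
  obtain x y u v where zw: "z = (x, y)" "w = (u, v)" by fastforce
  have z: "z \<in> half_plane" using c triangle_subset by (auto simp: corner_triangle)
  have H: "v' \<in> a" if "v' \<in> hook half_plane z" "v' \<noteq> z" for v'
    using c that by (auto simp: corner_triangle)
  show ?thesis
  proof (cases "v - u = y - x")
    case True
    then show ?thesis using w z by (intro H) (auto simp: mem_hook zw point_le_def)
  next
    case False
    \<comment> \<open>The point \<open>(x + k, y - k)\<close> is on the hook of \<open>z\<close> and
      shares the diagonal \<open>y - x\<close> with \<open>w\<close>. It is not below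
      \<open>w\<close>, hence still in the half plane.\<close>
    define k where "k = ((y - x) - (v - u)) div 2"
    have "even ((y - x) - (v - u))" using w z by (simp add: mem_half_plane zw)
    then have k: "2 * k = (y - x) - (v - u)" by (simp add: k_def)
    let ?v = "(x + k, y - k)"
    have le: "v - u \<le> y - x" "u + v \<le> x + y" using w by (auto simp: point_le_def zw)
    have v1: "1 \<le> v" "1 \<le> y" using w z by (auto simp: mem_half_plane zw)
    have "?v \<in> a"
      using False k le v1 z by (intro H) (auto simp: mem_hook mem_half_plane zw)
    moreover have "w \<preceq> ?v" using k le by (auto simp: point_le_def zw)
    ultimately show ?thesis using tableau_statesD(3)[OF a _ w(1)] by blast
  qed
qed

lemma corner_insert:
  assumes a: "a \<in> tableau_states c n" and c: "corner (triangle c n - a) z"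
  shows "insert z a \<in> tableau_states c n"
proof -
  have "z \<in> triangle c n" using c by (simp add: corner_triangle)
  moreover have "w \<in> insert z a" if "w \<in> half_plane" "w \<preceq> z" for w
    using corner_below[OF a c that] by blast
  ultimately show ?thesis
    using a subsetD[OF triangle_subset, of z] by (auto simp: tableau_states_def downward_closed_def)
qed

text \<open>In the coordinates \<open>(x + y, y - x)\<close> the complement of a state becomes a Young diagram.\<close>

abbreviation diag_coords :: "point \<Rightarrow> point" where
  "diag_coords z \<equiv> (fst z + snd z, snd z - fst z)"

lemma inj_diag_coords: "inj_on diag_coords A"
  by (auto simp: inj_on_def prod_eq_iff)

lemma grid_hook_diag_coords: "grid_hook (diag_coords ` B) (diag_coords w) = diag_coords ` hook B w"
  by (auto simp: grid_hook_def mem_hook)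

text \<open>The triangle bounds each diagonal coordinate separately from above, and the complement
  of a downward closed set is closed upwards; only these two facts are needed above a point of the
  complement.\<close>

lemma rect_closed_complement:
  assumes a: "a \<in> tableau_states c n" and odd: "odd (c + int n)"
  shows "rect_closed (diag_coords ` (triangle c n - a))"
proof -
  let ?D = "diag_coords ` (triangle c n - a)"
  have D: "(p, q) \<in> ?D \<longleftrightarrow> even p \<and> even q \<and> 2 \<le> p + q \<and> p \<le> c + int n - 1 \<and> q \<le> int n - 1 - c \<and>
      ((p - q) div 2, (p + q) div 2) \<notin> a" for p q
  proof
    assume "(p, q) \<in> ?D"
    then obtain x y where xy: "(x, y) \<in> triangle c n" "(x, y) \<notin> a" "p = x + y" "q = y - x" by auto
    then have "(p - q) div 2 = x" "(p + q) div 2 = y" by auto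
    then show "even p \<and> even q \<and> 2 \<le> p + q \<and> p \<le> c + int n - 1 \<and> q \<le> int n - 1 - c \<and>
      ((p - q) div 2, (p + q) div 2) \<notin> a" using xy by (auto simp: mem_triangle)
  next
    assume *: "even p \<and> even q \<and> 2 \<le> p + q \<and> p \<le> c + int n - 1 \<and> q \<le> int n - 1 - c \<and>
      ((p - q) div 2, (p + q) div 2) \<notin> a"
    let ?z = "((p - q) div 2, (p + q) div 2)"
    have dz: "diag_coords ?z = (p, q)" using * by auto
    then have "?z \<in> triangle c n" using * by (auto simp: mem_triangle)
    then have "diag_coords ?z \<in> ?D" using * by (intro imageI) blast
    then show "(p, q) \<in> ?D" unfolding dz .
  qed
  have up: "((i - j) div 2, (i + j) div 2) \<notin> a"
    if "(p, q) \<in> ?D" "p \<le> i" "q \<le> j" "even i" "even j" for p q i j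
  proof
    assume "((i - j) div 2, (i + j) div 2) \<in> a"
    moreover have "((p - q) div 2, (p + q) div 2) \<in> half_plane"
      using that(1) unfolding D by (auto simp: mem_half_plane)
    moreover have "((p - q) div 2, (p + q) div 2) \<preceq> ((i - j) div 2, (i + j) div 2)"
      using that unfolding D by (auto simp: point_le_def)
    ultimately have "((p - q) div 2, (p + q) div 2) \<in> a" using tableau_statesD(3)[OF a] by blast
    then show False using that(1) unfolding D by blast
  qed
  show ?thesis
    unfolding rect_closed_def
  proof (intro allI impI)
    fix p q i j assume z: "(p, q) \<in> ?D" "p \<le> i" "q \<le> j"
    show "(i, j) \<in> ?D \<longleftrightarrow> (i, q) \<in> ?D \<and> (p, j) \<in> ?D"
    proof
      assume "(i, j) \<in> ?D"
      then show "(i, q) \<in> ?D \<and> (p, j) \<in> ?D"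
        using z up[OF z(1,2), of q] up[OF z(1) _ z(3), of p] unfolding D by auto
    next
      assume "(i, q) \<in> ?D \<and> (p, j) \<in> ?D"
      then show "(i, j) \<in> ?D"
        using z up[OF z, simplified] unfolding D by auto
    qed
  qed
qed

theorem sum_hook_prob:
  assumes a: "a \<in> tableau_states c n" and odd: "odd (c + int n)" and ne: "triangle c n - a \<noteq> {}"
  shows "(\<Sum>z | corner (triangle c n - a) z. hook_prob (triangle c n - a) z) = 1"
proof -
  let ?B = "triangle c n - a"
  let ?D = "diag_coords ` ?B"
  interpret hook_shape ?D
    by unfold_locales (use finite_triangle rect_closed_complement[OF a odd] in auto)
  have hl: "hl (diag_coords w) = hook_length ?B w" for w
    unfolding hl_def grid_hook_diag_coords hook_length_def by (simp add: card_image inj_diag_coords)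
  have C: "{z. z \<in> ?D \<and> grid_hook ?D z = {z}} = diag_coords ` {z. corner ?B z}"
  proof -
    have "grid_hook ?D (diag_coords z) = {diag_coords z} \<longleftrightarrow> hook ?B z = {z}" for z
      unfolding grid_hook_diag_coords using inj_image_eq_iff[OF inj_diag_coords, of "hook ?B z"
        "{z}"] by simp
    then show ?thesis unfolding corner_def by blast
  qed
  have R: "{y. y \<in> ?D - {diag_coords z} \<and> diag_coords z \<in> grid_hook ?D y}
      = diag_coords ` reverse_hook ?B z" for z
  proof -
    have "diag_coords z \<in> grid_hook ?D (diag_coords y) \<longleftrightarrow> z \<in> hook ?B y" for y
      unfolding grid_hook_diag_coords using inj_image_mem_iff[OF inj_diag_coords] by blast
    then show ?thesis by (auto simp: reverse_hook_def prod_eq_iff)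
  qed
  have "real (card ?D) = (\<Sum>z | corner ?B z. \<Prod>y\<in>reverse_hook ?B z. hook_length ?B y /
    (hook_length ?B y - 1))"
    unfolding sum_hook_products[symmetric] C
    by (subst sum.reindex[OF inj_diag_coords])
      (simp only: comp_def R prod.reindex[OF inj_diag_coords] hl)
  moreover have "card ?D = card ?B" by (simp add: card_image inj_diag_coords)
  moreover have "card ?B > 0" using ne finite_triangle by (simp add: card_gt_0_iff)
  ultimately show ?thesis
    unfolding hook_prob_def by (simp flip: sum_divide_distrib)
qed


section \<open>Product processes\<close>

text \<open>Independence in semigroup form. Adding a point of \<open>T' i\<close> changes only the
  factor with index \<open>i\<close>, so by the product rule the product of the factor flows solves
  the equation of the combined process.\<close>

lemma growth_product_flow:
  fixes T' :: "'i \<Rightarrow> 'p set"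
  assumes g: "growth S T \<rho>" and gi: "\<And>i. i \<in> I \<Longrightarrow> growth (S' i) (T' i) (\<sigma> i)"
    and I: "finite I" and sub: "\<And>i. i \<in> I \<Longrightarrow> T' i \<subseteq> T"
    and disj: "\<And>i j. i \<in> I \<Longrightarrow> j \<in> I \<Longrightarrow> i \<noteq> j \<Longrightarrow> T' i \<inter> T' j = {}"
    and restr: "\<And>a i. a \<in> S \<Longrightarrow> i \<in> I \<Longrightarrow> a \<inter> T' i \<in> S' i"
    and \<rho>: "\<And>a z. a \<in> S \<Longrightarrow> z \<in> T \<Longrightarrow> \<rho> a z = (\<Sum>i\<in>I. of_bool (z \<in> T' i) * \<sigma> i (a \<inter> T' i) z)"
    and a: "a \<in> S" and t: "0 \<le> t"
  shows "growth_flow S T \<rho> t (\<lambda>a. \<Prod>i\<in>I. f i (a \<inter> T' i)) a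
    = (\<Prod>i\<in>I. growth_flow (S' i) (T' i) (\<sigma> i) t (f i) (a \<inter> T' i))"
proof -
  interpret G: growth S T \<rho> by (rule g)
  define u where "u i s = growth_flow (S' i) (T' i) (\<sigma> i) s (f i)" for i s
  define w where "w s a = (\<Prod>i\<in>I. u i s (a \<inter> T' i))" for s a
  define w' where "w' s a = (\<Sum>i\<in>I. growth_gen (T' i) (\<sigma> i) (u i s) (a \<inter> T' i)
      * (\<Prod>j\<in>I - {i}. u j s (a \<inter> T' j)))" for s a
  have der: "((\<lambda>s. w s b) has_real_derivative w' s b) (at s)" if b: "b \<in> S" for s b
    unfolding w_def w'_def
  proof (rule has_field_derivative_prod)
    fix i assume i: "i \<in> I"
    interpret Gi: growth "S' i" "T' i" "\<sigma> i" by (rule gi[OF i])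
    show "((\<lambda>s. u i s (b \<inter> T' i)) has_real_derivative growth_gen (T' i) (\<sigma> i) (u i s) (b \<inter> T' i))
      (at s)"
      unfolding u_def by (rule Gi.flow_has_derivative[OF restr[OF b i]])
  qed
  have gen: "G.gen (w s) b = w' s b" if b: "b \<in> S" for s b
  proof -
    have "G.gen (w s) b = (\<Sum>z\<in>T. \<Sum>i\<in>I. of_bool (z \<in> T' i) * \<sigma> i (b \<inter> T' i) z * (w s (insert z b)
      - w s b))"
      unfolding growth_gen_def using \<rho>[OF b] by (intro sum.cong) (auto simp: sum_distrib_right)
    also have "\<dots> = (\<Sum>i\<in>I. \<Sum>z\<in>T. of_bool (z \<in> T' i) * \<sigma> i (b \<inter> T' i) z * (w s (insert z b) - w s b))"
      by (rule sum.swap)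
    also have "\<dots> = w' s b"
      unfolding w'_def
    proof (rule sum.cong[OF refl])
      fix i assume i: "i \<in> I"
      let ?P = "\<Prod>j\<in>I - {i}. u j s (b \<inter> T' j)"
      have "(\<Sum>z\<in>T. of_bool (z \<in> T' i) * \<sigma> i (b \<inter> T' i) z * (w s (insert z b) - w s b))
          = (\<Sum>z\<in>T' i. \<sigma> i (b \<inter> T' i) z * (w s (insert z b) - w s b))"
        using sub[OF i] G.finite_points by (intro sum.mono_neutral_cong_right) auto
      also have "\<dots> = (\<Sum>z\<in>T' i. \<sigma> i (b \<inter> T' i) z * (u i s (insert z (b \<inter> T' i)) - u i s (b \<inter> T' i))
        * ?P)"
      proof (rule sum.cong[OF refl])
        fix z assume z: "z \<in> T' i"
        have "(\<Prod>j\<in>I - {i}. u j s (insert z b \<inter> T' j)) = ?P"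
        proof (rule prod.cong[OF refl])
          fix j assume "j \<in> I - {i}"
          then have "z \<notin> T' j" using disj[of i j] i z by auto
          then show "u j s (insert z b \<inter> T' j) = u j s (b \<inter> T' j)" by simp
        qed
        then have "w s (insert z b) = u i s (insert z (b \<inter> T' i)) * ?P" "w s b = u i s (b \<inter> T' i)
          * ?P"
          using z unfolding w_def by (simp_all add: prod.remove[OF I i])
        then show "\<sigma> i (b \<inter> T' i) z * (w s (insert z b) - w s b)
            = \<sigma> i (b \<inter> T' i) z * (u i s (insert z (b \<inter> T' i)) - u i s (b \<inter> T' i)) * ?P"
          by (simp add: algebra_simps)
      qed
      also have "\<dots> = growth_gen (T' i) (\<sigma> i) (u i s) (b \<inter> T' i) * ?P"
        by (simp add: growth_gen_def sum_distrib_right)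
      finally show "(\<Sum>z\<in>T. of_bool (z \<in> T' i) * \<sigma> i (b \<inter> T' i) z * (w s (insert z b) - w s b))
          = growth_gen (T' i) (\<sigma> i) (u i s) (b \<inter> T' i) * ?P" .
    qed
    finally show ?thesis .
  qed
  have u0: "u i 0 b = f i b" if "i \<in> I" for i b
  proof -
    interpret Gi: growth "S' i" "T' i" "\<sigma> i" by (rule gi[OF that])
    show ?thesis by (simp add: u_def)
  qed
  have w0: "w 0 b = (\<Prod>i\<in>I. f i (b \<inter> T' i))" for b
    unfolding w_def by (intro prod.cong) (auto simp: u0)
  have "w t a \<le> G.flow t (\<lambda>a. \<Prod>i\<in>I. f i (a \<inter> T' i)) a"
    by (rule G.subsolution_le_flow[OF a t, of w w']) (simp_all add: der gen w0)
  moreover have "G.flow t (\<lambda>a. \<Prod>i\<in>I. f i (a \<inter> T' i)) a \<le> w t a"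
    by (rule G.flow_le_supersolution[OF a t, of w w']) (simp_all add: der gen w0)
  ultimately show ?thesis by (simp add: w_def u_def)
qed

section \<open>Rates of the tableau process\<close>

definition tab_rate :: "int \<Rightarrow> nat \<Rightarrow> point set \<Rightarrow> point \<Rightarrow> real" where
  "tab_rate c n a z =
     (if corner (triangle c n - a) z then real n * hook_prob (triangle c n - a) z else 0)"

abbreviation "tab_flow c n \<equiv> growth_flow (tableau_states c n) (triangle c n) (tab_rate c n)"

lemma empty_state [simp]: "{} \<in> tableau_states c n"
  by (simp add: tableau_states_def downward_closed_def)

lemma hook_product_nonneg:
  assumes "a \<in> tableau_states c n" "z \<in> half_plane" "z \<notin> a"
  shows "0 \<le> (\<Prod>w\<in>up_hook (triangle c' n') z. hook_ratio a w)"
proof (intro prod_nonneg)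
  fix w assume "w \<in> up_hook (triangle c' n') z"
  then have "1 \<le> hook_ratio a w"
    using assms triangle_subset by (intro hook_ratio_ge_1) (auto simp: up_hook_def)
  then show "0 \<le> hook_ratio a w" by simp
qed

lemma hook_prob_nonneg:
  assumes "a \<in> tableau_states c n" "z \<in> triangle c n - a"
  shows "0 \<le> hook_prob (triangle c n - a) z"
  unfolding hook_prob_eq[OF assms]
  using assms triangle_subset by (intro mult_nonneg_nonneg hook_product_nonneg) auto

lemma growth_tab:
  shows "growth (tableau_states c n) (triangle c n) (tab_rate c n)"
proof
  show "0 \<le> tab_rate c n a z" if "a \<in> tableau_states c n" "z \<in> triangle c n" for a z
    using that hook_prob_nonneg[of a c n z] by (auto simp: tab_rate_def corner_triangle)
  show "z \<notin> a \<and> insert z a \<in> tableau_states c n"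
    if "a \<in> tableau_states c n" "z \<in> triangle c n" "tab_rate c n a z \<noteq> 0" for a z
    using that corner_insert[of a c n z] by (auto simp: tab_rate_def corner_triangle split:
      if_splits)
qed (auto simp: finite_triangle tableau_states_def)

text \<open>A larger state leaves fewer points and shorter hooks, and \<open>h / (h - 1)\<close>
  decreases in \<open>h\<close>; both factors of the hook probability grow. A corner of the smaller
  complement problem persists until its point is included.\<close>

lemma attractive_tab:
  shows "attractive (tableau_states c n) (triangle c n) (tab_rate c n)"
  unfolding attractive_def
proof (intro ballI impI)
  fix a b z assume *: "a \<in> tableau_states c n" "b \<in> tableau_states c n" "z \<in> triangle c n"
    "a \<subseteq> b" "z \<notin> b"
  show "tab_rate c n a z \<le> tab_rate c n b z"
  proof (cases "corner (triangle c n - a) z")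
    case False
    then show ?thesis
      using growth.rate_nonneg[OF growth_tab *(2,3)] by (simp add: tab_rate_def)
  next
    case True
    then have b: "corner (triangle c n - b) z" using * by (auto simp: corner_triangle)
    have z: "z \<in> half_plane" using * triangle_subset by auto
    have ma: "z \<in> triangle c n - a" and mb: "z \<in> triangle c n - b" using * by auto
    have c0: "0 < card (triangle c n - b)"
      using mb finite_triangle by (auto simp: card_gt_0_iff)
    have c1: "card (triangle c n - b) \<le> card (triangle c n - a)"
      using *(4) finite_triangle by (intro card_mono) auto
    have le: "(\<Prod>w\<in>up_hook (triangle c n) z. hook_ratio a w)
        \<le> (\<Prod>w\<in>up_hook (triangle c n) z. hook_ratio b w)"
    proof (intro prod_mono conjI)
      fix w assume w: "w \<in> up_hook (triangle c n) z"
      then have w': "w \<in> half_plane" "w \<noteq> z" "z \<in> hook half_plane w"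
        using triangle_subset by (auto simp: up_hook_def)
      have "z \<notin> a" using *(4,5) by blast
      from hook_ratio_ge_1[OF *(1) z this w'] show "0 \<le> hook_ratio a w" by simp
      show "hook_ratio a w \<le> hook_ratio b w" by (rule hook_ratio_mono[OF *(2) z *(5,4) w'])
    qed
    have nn: "0 \<le> (\<Prod>w\<in>up_hook (triangle c n) z. hook_ratio a w)"
      using ma z by (intro hook_product_nonneg[OF *(1)]) auto
    have "1 / real (card (triangle c n - a)) \<le> 1 / real (card (triangle c n - b))"
      using c0 c1 by (intro divide_left_mono) auto
    then have "hook_prob (triangle c n - a) z \<le> hook_prob (triangle c n - b) z"
      unfolding hook_prob_eq[OF *(1) ma] hook_prob_eq[OF *(2) mb]
      by (rule mult_mono[OF _ le _ nn]) simp
    then show ?thesis using True b by (simp add: tab_rate_def mult_left_mono)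
  qed
qed

lemma tab_total_rate:
  assumes "a \<in> tableau_states c n" "odd (c + int n)"
  shows "(\<Sum>z\<in>triangle c n. tab_rate c n a z) \<le> real n"
proof -
  have "(\<Sum>z\<in>triangle c n. tab_rate c n a z)
      = (\<Sum>z | corner (triangle c n - a) z. real n * hook_prob (triangle c n - a) z)"
    unfolding tab_rate_def using finite_triangle
    by (intro sum.mono_neutral_cong_right) (auto simp: corner_triangle)
  also have "\<dots> = real n * (\<Sum>z | corner (triangle c n - a) z. hook_prob (triangle c n - a) z)"
    by (simp add: sum_distrib_left)
  also have "\<dots> \<le> real n"
  proof (cases "triangle c n - a = {}")
    case True
    have e: "{z. corner (triangle c n - a) z} = {}" unfolding True by (simp add: corner_def)
    show ?thesis unfolding e by simp
  next
    case False
    then show ?thesis by (simp add: sum_hook_prob[OF assms(1,2)])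
  qed
  finally show ?thesis .
qed

lemma state_finite: "a \<in> tableau_states c n \<Longrightarrow> finite a"
  by (rule finite_subset[OF tableau_statesD(1) finite_triangle])

text \<open>As the total rate is at most \<open>n\<close>, the function
  \<open>card a + n * s\<close> is a supersolution.\<close>

lemma tab_flow_card:
  assumes odd: "odd (c + int n)" and t: "0 \<le> t"
  shows "tab_flow c n t (\<lambda>a. real (card a)) {} \<le> real n * t"
proof -
  interpret G: growth "tableau_states c n" "triangle c n" "tab_rate c n" by (rule growth_tab)
  have "G.flow t (\<lambda>a. real (card a)) {} \<le> real (card ({} :: point set)) + real n * t"
  proof (rule G.flow_le_supersolution[where w = "\<lambda>s a. real (card a) + real n
    * s" and w' = "\<lambda>_ _. real n"])
    fix b s assume b: "b \<in> tableau_states c n"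
    have "G.gen (\<lambda>a. real (card a) + real n * s) b \<le> (\<Sum>z\<in>triangle c n. tab_rate c n b z * 1)"
      unfolding growth_gen_def
      using G.rate_nonneg[OF b] state_finite[OF b]
      by (intro sum_mono mult_left_mono) (auto simp: card_insert_if)
    then show "G.gen (\<lambda>a. real (card a) + real n * s) b \<le> real n"
      using tab_total_rate[OF b odd] by simp
  qed (auto intro!: derivative_eq_intros simp: t)
  then show ?thesis by simp
qed

lemma tab_flow_card_gt:
  assumes odd: "odd (c + int n)" and t: "0 \<le> t" and L: "0 < L"
  shows "tab_flow c n t (\<lambda>a. of_bool (L < real (card a))) {} \<le> real n * t / L"
proof -
  interpret G: growth "tableau_states c n" "triangle c n" "tab_rate c n" by (rule growth_tab)
  have "G.flow t (\<lambda>a. of_bool (L < real (card a))) {} \<le> G.flow t (\<lambda>a. 1 / L * real (card a)) {}"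
    using L t by (intro G.flow_mono) auto
  also have "\<dots> = 1 / L * G.flow t (\<lambda>a. real (card a)) {}" by (rule G.flow_cmult) simp
  also have "\<dots> \<le> 1 / L * (real n * t)" using L tab_flow_card[OF odd t] by
    (intro mult_left_mono) auto
  finally show ?thesis by simp
qed

section \<open>Comparison of triangles\<close>

lemma state_restrict:
  assumes "a \<in> tableau_states c N"
  shows "a \<inter> triangle c' n \<in> tableau_states c' n"
  using tableau_statesD[OF assms] triangle_down[of _ c' n]
  unfolding tableau_states_def downward_closed_def by blast

lemma triangle_mono:
  assumes "\<bar>c - c'\<bar> \<le> int N - int n"
  shows "triangle c' n \<subseteq> triangle c N"
  using assms by (auto simp: mem_triangle)

lemma up_hook_eq:
  assumes z: "(x, y) \<in> triangle c n"
  shows "up_hook (triangle c n) (x, y) =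
     (\<lambda>k. (x + int k, y + int k)) ` {1..nat ((c + int n - 1 - x - y) div 2)} \<union>
     (\<lambda>k. (x - int k, y + int k)) ` {1..nat ((int n - 1 - c + x - y) div 2)}" (is "_ = ?R \<union> ?L")
proof (intro set_eqI iffI)
  fix w assume w: "w \<in> up_hook (triangle c n) (x, y)"
  obtain u v where uv: "w = (u, v)" by fastforce
  have T: "1 \<le> v" "even (u + v)" "u + v \<le> c + int n - 1" "v - u \<le> int n - 1 - c"
    and ne: "(u, v) \<noteq> (x, y)"
    and h: "x + y = u + v \<and> y - x \<le> v - u \<or> y - x = v - u \<and> x + y \<le> u + v"
    using w by (auto simp: up_hook_def mem_hook mem_triangle uv)
  show "w \<in> ?R \<union> ?L"
  proof (cases "y - x = v - u")
    case True
    then have "w = (x + int (nat (u - x)), y + int (nat (u - x)))"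
      "nat (u - x) \<in> {1..nat ((c + int n - 1 - x - y) div 2)}"
      using T ne h uv by auto
    then show ?thesis by blast
  next
    case False
    then have "w = (x - int (nat (x - u)), y + int (nat (x - u)))"
      "nat (x - u) \<in> {1..nat ((int n - 1 - c + x - y) div 2)}"
      using T ne h uv by auto
    then show ?thesis by blast
  qed
next
  have b: "1 \<le> y" "even (x + y)" "x + y \<le> c + int n - 1" "y - x \<le> int n - 1 - c"
    using z by (auto simp: mem_triangle)
  fix w assume "w \<in> ?R \<union> ?L"
  then show "w \<in> up_hook (triangle c n) (x, y)"
  proof
    assume "w \<in> ?R"
    then obtain k where k: "1 \<le> k" "k \<le> nat ((c + int n - 1 - x - y) div 2)"
      "w = (x + int k, y + int k)" by auto
    then have "2 * int k \<le> c + int n - 1 - x - y" by linarith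
    then show ?thesis
      using b k by (auto simp: up_hook_def mem_hook mem_triangle mem_half_plane)
  next
    assume "w \<in> ?L"
    then obtain k where k: "1 \<le> k" "k \<le> nat ((int n - 1 - c + x - y) div 2)"
      "w = (x - int k, y + int k)" by auto
    then have "2 * int k \<le> int n - 1 - c + x - y" by linarith
    then show ?thesis
      using b k by (auto simp: up_hook_def mem_hook mem_triangle mem_half_plane)
  qed
qed

lemma prod_up_hook:
  assumes "(x, y) \<in> triangle c n"
  shows "(\<Prod>w\<in>up_hook (triangle c n) (x, y). g w) =
     (\<Prod>k = 1..nat ((c + int n - 1 - x - y) div 2). g (x + int k, y + int k)) *
     (\<Prod>k = 1..nat ((int n - 1 - c + x - y) div 2). g (x - int k, y + int k))"
  unfolding up_hook_eq[OF assms]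
  by (subst prod.union_disjoint) (auto simp: prod.reindex inj_on_def)

text \<open>A hook starting at height \<open>v\<close> has at most \<open>2 * v - 1\<close> points,
  and \<open>(2 * v - 1)\<^sup>2\<close> exceeds \<open>4 * v * (v - 1)\<close> by 1. The square
  root form is chosen because it telescopes along a diagonal.\<close>

lemma hook_ratio_ge_sqrt:
  assumes a: "a \<in> tableau_states c n" and z: "z \<in> half_plane" "z \<notin> a"
    and w: "w \<in> half_plane" "w \<noteq> z" "z \<in> hook half_plane w"
  shows "sqrt (real_of_int (snd w) / (real_of_int (snd w) - 1)) \<le> hook_ratio a w"
proof -
  define h where "h = real (card (hook half_plane w - a))"
  define v where "v = real_of_int (snd w)"
  have h2: "2 \<le> h" using hook_diff_ge_2[OF assms] by (simp add: h_def)
  have "h \<le> real (card (hook half_plane w))"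
    unfolding h_def using finite_full_hook[OF w(1)] by (simp add: card_mono)
  then have hv: "h \<le> 2 * v - 1" using card_full_hook[OF w(1)] by (simp add: v_def)
  then have v: "1 < v" using h2 by simp
  have "v / (v - 1) \<le> ((2 * v - 1) / (2 * v - 1 - 1))\<^sup>2"
  proof -
    have "(2 * v - 1)\<^sup>2 = 4 * v * (v - 1) + 1" by (simp add: power2_eq_square algebra_simps)
    then have "((2 * v - 1) / (2 * v - 1 - 1))\<^sup>2 = (4 * v * (v - 1) + 1) / (4 * (v - 1) * (v - 1))"
      by (simp add: power_divide) (simp add: power2_eq_square algebra_simps)
    also have "\<dots> \<ge> 4 * v * (v - 1) / (4 * (v - 1) * (v - 1))"
      using v by (intro divide_right_mono) auto
    finally have "4 * v * (v - 1) / (4 * (v - 1) * (v - 1)) \<le> ((2 * v - 1) / (2 * v - 1 - 1))\<^sup>2" .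
    moreover have "v / (v - 1) = 4 * v * (v - 1) / (4 * (v - 1) * (v - 1))"
      using v by (subst frac_eq_eq) (simp_all add: mult_ac)
    ultimately show ?thesis by simp
  qed
  then have "sqrt (v / (v - 1)) \<le> (2 * v - 1) / (2 * v - 1 - 1)"
    using v by (intro real_le_lsqrt) auto
  also have "\<dots> \<le> h / (h - 1)" using h2 hv by (intro ratio_antimono) auto
  finally show ?thesis by (simp add: v_def h_def hook_ratio_def)
qed

text \<open>Continuing a diagonal from height \<open>y + m'\<close> to height \<open>y + m\<close>
  multiplies the product at least by the telescoped square roots.\<close>

lemma hook_ratio_prod_extend:
  fixes p :: "nat \<Rightarrow> point"
  assumes a: "a \<in> tableau_states c n" and z: "z \<in> half_plane" "z \<notin> a"
    and p: "\<And>k. 1 \<le> k \<Longrightarrow> p k \<in> half_plane \<and> p k \<noteq> z \<and> z \<in> hook half_plane (p k) \<and> snd (p k) = y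
      + int k"
    and y: "1 \<le> y" and m: "m' \<le> m"
  shows "(\<Prod>k = 1..m'. hook_ratio a (p k)) * sqrt ((real_of_int y + real m) / (real_of_int y
    + real m'))
    \<le> (\<Prod>k = 1..m. hook_ratio a (p k))"
  using m
proof (induction m rule: dec_induct)
  case base
  then show ?case using y by simp
next
  case (step m)
  let ?y = "real_of_int y"
  have p': "p (Suc m) \<in> half_plane" "p (Suc m) \<noteq> z" "z \<in> hook half_plane (p (Suc m))"
    "snd (p (Suc m)) = y + int (Suc m)" using p[of "Suc m"] by auto
  have "sqrt ((?y + real (Suc m)) / (?y + real m)) \<le> hook_ratio a (p (Suc m))"
    using hook_ratio_ge_sqrt[OF a z p'(1,2,3)] p'(4) by (simp add: algebra_simps)
  moreover have "sqrt ((?y + real (Suc m)) / (?y + real m'))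
      = sqrt ((?y + real m) / (?y + real m')) * sqrt ((?y + real (Suc m)) / (?y + real m))"
    using y by (simp flip: real_sqrt_mult)
  moreover have "0 \<le> (\<Prod>k = 1..m'. hook_ratio a (p k))"
  proof (intro prod_nonneg)
    fix k assume "k \<in> {1..m'}"
    then have "1 \<le> hook_ratio a (p k)" using p[of k] by (intro hook_ratio_ge_1[OF a z]) auto
    then show "0 \<le> hook_ratio a (p k)" by simp
  qed
  ultimately have "(\<Prod>k = 1..m'. hook_ratio a (p k)) * sqrt ((?y + real (Suc m)) / (?y + real m'))
      \<le> ((\<Prod>k = 1..m'. hook_ratio a (p k)) * sqrt ((?y + real m) / (?y + real m'))) * hook_ratio a
        (p (Suc m))"
    using y by (simp add: mult_left_mono mult.assoc)
  also have "\<dots> \<le> (\<Prod>k = 1..m. hook_ratio a (p k)) * hook_ratio a (p (Suc m))"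
    using step.IH hook_ratio_ge_1[OF a z p'(1,2,3)] by (intro mult_right_mono) auto
  finally show ?case by (simp add: mult.commute)
qed

text \<open>The two upward diagonals from the point end at heights \<open>V\<close>,
  \<open>W\<close> in the large triangle and \<open>V'\<close>, \<open>W'\<close> in the small one,
  so the product gains \<open>sqrt (V * W / (V' * W'))\<close>. Here
  \<open>V' + W' = n - 1 + y\<close> bounds \<open>V' * W'\<close> by the inequality of means,
  whereas \<open>4 * V * W\<close> equals \<open>(N - 1 + y)\<^sup>2\<close> minus the squared
  distance of the point from the central column; the latter costs the factor
  \<open>1 - \<eta>\<^sup>2\<close>.\<close>

lemma hook_product_compare:
  assumes a: "a \<in> tableau_states c N" and odd: "odd (c + int N)" "odd (c' + int n)"
    and sub: "\<bar>c - c'\<bar> \<le> int N - int n"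
    and z: "(x, y) \<in> triangle c' n" "(x, y) \<notin> a"
    and \<eta>: "0 \<le> \<eta>" "\<eta> \<le> 1" "\<bar>real_of_int (x - c)\<bar> \<le> \<eta> * (real N - 1)"
  shows "(\<Prod>w\<in>up_hook (triangle c' n) (x, y). hook_ratio a w)
      * (sqrt (1 - \<eta>\<^sup>2) * (real N - 1) / (real n - 1 + real_of_int y))
    \<le> (\<Prod>w\<in>up_hook (triangle c N) (x, y). hook_ratio a w)"
proof -
  have zT: "(x, y) \<in> triangle c N" using triangle_mono[OF sub] z by blast
  have z': "(x, y) \<in> half_plane" using z triangle_subset by blast
  have b: "1 \<le> y" "even (x + y)" "x + y \<le> c' + int n - 1" "y - x \<le> int n - 1 - c'"
    using z by (auto simp: mem_triangle)
  define R where "R = nat ((c + int N - 1 - x - y) div 2)"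
  define L where "L = nat ((int N - 1 - c + x - y) div 2)"
  define R' where "R' = nat ((c' + int n - 1 - x - y) div 2)"
  define L' where "L' = nat ((int n - 1 - c' + x - y) div 2)"
  have i: "2 * int R = c + int N - 1 - x - y" "2 * int L = int N - 1 - c + x - y"
    "2 * int R' = c' + int n - 1 - x - y" "2 * int L' = int n - 1 - c' + x - y"
    unfolding R_def L_def R'_def L'_def using b odd sub by (auto; presburger)+
  have le: "R' \<le> R" "L' \<le> L" using i sub by linarith+
  let ?V = "real_of_int y + real R" and ?W = "real_of_int y + real L"
  let ?V' = "real_of_int y + real R'" and ?W' = "real_of_int y + real L'"
  let ?PR = "\<lambda>m. \<Prod>k = 1..m. hook_ratio a (x + int k, y + int k)"
  let ?PL = "\<lambda>m. \<Prod>k = 1..m. hook_ratio a (x - int k, y + int k)"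
  have ext1: "?PR R' * sqrt (?V / ?V') \<le> ?PR R"
    by (rule hook_ratio_prod_extend[OF a z' z(2), where p = "\<lambda>k. (x + int k, y + int k)"])
      (use b le in \<open>auto simp: mem_hook mem_half_plane\<close>)
  have ext2: "?PL L' * sqrt (?W / ?W') \<le> ?PL L"
    by (rule hook_ratio_prod_extend[OF a z' z(2), where p = "\<lambda>k. (x - int k, y + int k)"])
      (use b le in \<open>auto simp: mem_hook mem_half_plane\<close>)
  have nnR: "0 \<le> ?PR m" for m
  proof (intro prod_nonneg)
    fix k assume "k \<in> {1..m}"
    then have "1 \<le> hook_ratio a (x + int k, y + int k)"
      using b by (intro hook_ratio_ge_1[OF a z' z(2)]) (auto simp: mem_hook mem_half_plane)
    then show "0 \<le> hook_ratio a (x + int k, y + int k)" by simp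
  qed
  have nnL: "0 \<le> ?PL m" for m
  proof (intro prod_nonneg)
    fix k assume "k \<in> {1..m}"
    then have "1 \<le> hook_ratio a (x - int k, y + int k)"
      using b by (intro hook_ratio_ge_1[OF a z' z(2)]) (auto simp: mem_hook mem_half_plane)
    then show "0 \<le> hook_ratio a (x - int k, y + int k)" by simp
  qed
  have ri: "2 * ?V = real_of_int (c - x + y) + real N - 1" "2 * ?W = real_of_int (x - c + y)
    + real N - 1"
     "2 * ?V' = real_of_int (c' - x + y) + real n - 1" "2 * ?W' = real_of_int (x - c' + y)
       + real n - 1"
    using arg_cong[OF i(1), of real_of_int] arg_cong[OF i(2), of real_of_int]
      arg_cong[OF i(3), of real_of_int] arg_cong[OF i(4), of real_of_int] by simp_all
  have y1: "1 \<le> real_of_int y" using b by simp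
  have pos: "0 < ?V'" "0 < ?W'" "0 < ?V" "0 < ?W" using y1 by linarith+
  have n1: "1 \<le> real n" using b by linarith
  have N1: "1 \<le> real N" using n1 sub by linarith
  have VW: "(1 - \<eta>\<^sup>2) * (real N - 1)\<^sup>2 \<le> 4 * (?V * ?W)"
  proof -
    have "4 * (?V * ?W) = (real N - 1 + y)\<^sup>2 - (real_of_int (x - c))\<^sup>2"
    proof -
      have "4 * (?V * ?W) = (2 * ?V) * (2 * ?W)" by (simp only: mult_ac)
      also have "\<dots> = (real N - 1 + y)\<^sup>2 - (real_of_int (x - c))\<^sup>2"
        unfolding ri by (simp add: power2_eq_square algebra_simps)
      finally show ?thesis .
    qed
    moreover have "(real_of_int (x - c))\<^sup>2 \<le> (\<eta> * (real N - 1))\<^sup>2"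
      using \<eta>(3) by (rule abs_le_square_iff[THEN iffD1, OF order_trans]) simp
    moreover have "(real N - 1)\<^sup>2 \<le> (real N - 1 + y)\<^sup>2" using y1 N1 by (intro power_mono) auto
    moreover have "(1 - \<eta>\<^sup>2) * (real N - 1)\<^sup>2 = (real N - 1)\<^sup>2 - (\<eta> * (real N - 1))\<^sup>2"
      by (simp add: power_mult_distrib left_diff_distrib)
    ultimately show ?thesis by linarith
  qed
  have VW': "4 * (?V' * ?W') \<le> (real n - 1 + y)\<^sup>2"
  proof -
    have "(real n - 1 + y)\<^sup>2 - 4 * (?V' * ?W') = (?V' - ?W')\<^sup>2"
    proof -
      have "real n - 1 + y = ?V' + ?W'" using ri(3,4) by simp
      then show ?thesis by (simp only:) (simp add: power2_eq_square algebra_simps)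
    qed
    then show ?thesis by (smt (verit) zero_le_power2)
  qed
  have "sqrt (1 - \<eta>\<^sup>2) * (real N - 1) / (real n - 1 + y)
      = sqrt ((1 - \<eta>\<^sup>2) * (real N - 1)\<^sup>2 / (real n - 1 + y)\<^sup>2)"
    using N1 n1 y1 by (simp add: real_sqrt_mult real_sqrt_divide)
  also have "\<dots> \<le> sqrt (4 * (?V * ?W) / (4 * (?V' * ?W')))"
    using VW VW' pos by (intro real_sqrt_le_mono frac_le) auto
  also have "\<dots> = sqrt (?V / ?V') * sqrt (?W / ?W')" by (simp flip: real_sqrt_mult)
  finally have s: "sqrt (1 - \<eta>\<^sup>2) * (real N - 1) / (real n - 1 + y) \<le> sqrt (?V / ?V') * sqrt
    (?W / ?W')" .
  have "(?PR R' * ?PL L') * (sqrt (1 - \<eta>\<^sup>2) * (real N - 1) / (real n - 1 + y))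
      \<le> (?PR R' * ?PL L') * (sqrt (?V / ?V') * sqrt (?W / ?W'))"
    using nnR nnL by (intro mult_left_mono s) auto
  also have "\<dots> = (?PR R' * sqrt (?V / ?V')) * (?PL L' * sqrt (?W / ?W'))" by (simp add: mult_ac)
  also have "\<dots> \<le> ?PR R * ?PL L"
    using nnR nnL pos by (intro mult_mono ext1 ext2) auto
  finally show ?thesis
    unfolding prod_up_hook[OF z(1)] prod_up_hook[OF zT] R_def L_def R'_def L'_def .
qed


text \<open>Below a corner at height \<open>y\<close> lies an entirely included triangle, with
  \<open>y * (y + 1) / 2 - 1\<close> points. Corners therefore stay at height O(sqrt n) as long as
  O(n) points are included.\<close>

lemma corner_height:
  assumes a: "a \<in> tableau_states c n" and c: "corner (triangle c n - a) (x, y)"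
  shows "real_of_int y * real_of_int y \<le> 2 * real (card a) + 2"
proof -
  have z: "(x, y) \<in> triangle c n" using c by (simp add: corner_triangle)
  then have y: "1 \<le> y" "even (x + y)" by (auto simp: mem_triangle)
  have "triangle x (nat y + 1) - {(x, y)} \<subseteq> a"
  proof
    fix w assume w: "w \<in> triangle x (nat y + 1) - {(x, y)}"
    then show "w \<in> a"
      using y by (intro corner_below[OF a c]) (auto simp: mem_triangle mem_half_plane point_le_def)
  qed
  then have "card (triangle x (nat y + 1) - {(x, y)}) \<le> card a"
    using state_finite[OF a] by (intro card_mono)
  moreover have "(x, y) \<in> triangle x (nat y + 1)" using y by (auto simp: mem_triangle)
  ultimately have "card (triangle x (nat y + 1)) \<le> card a + 1"
    using finite_triangle by (simp add: card_Diff_singleton)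
  moreover have "card (triangle x (nat y + 1)) = (nat y + 1) * nat y div 2"
    using y by (subst card_triangle) auto
  moreover have "2 * ((nat y + 1) * nat y div 2) = (nat y + 1) * nat y"
    by (rule dvd_mult_div_cancel) simp
  ultimately have "(nat y + 1) * nat y \<le> 2 * card a + 2" by presburger
  then have "real ((nat y + 1) * nat y) \<le> real (2 * card a + 2)" by (rule of_nat_mono)
  then show ?thesis using y by (simp add: algebra_simps)
qed

lemma real_card_triangle:
  assumes "odd (c + int n)" "1 \<le> n"
  shows "real (card (triangle c n)) = real n * (real n - 1) / 2"
proof -
  have "even (n * (n - 1))" by (cases n) auto
  then have "real (n * (n - 1) div 2) = real (n * (n - 1)) / 2"
    using real_of_nat_div[of 2 "n * (n - 1)"] by (simp only: of_nat_numeral)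
  then show ?thesis using assms by (simp add: card_triangle of_nat_diff)
qed

text \<open>The assumption on \<theta> collects three losses: the horizontal displacement (through
  \<eta>), the height of the corner (through \<open>y\<close>), and the points already missing from
  the small triangle, which speed it up (through \<open>K\<close>).\<close>

lemma rate_comparison:
  assumes odd: "odd (c + int N)" "odd (c' + int n)"
    and sub: "\<bar>c - c'\<bar> \<le> int N - int n"
    and a: "a \<in> tableau_states c N" and z: "z \<in> triangle c' n"
    and card: "real (card (a \<inter> triangle c' n)) \<le> K * real n"
    and \<eta>: "0 \<le> \<eta>" "\<eta> \<le> 1" "\<bar>real_of_int (fst z - c)\<bar> \<le> \<eta> * (real N - 1)"
    and \<theta>: "0 \<le> \<theta>" and K: "2 * K < real n - 1"
    and num: "\<And>y. 0 \<le> y \<Longrightarrow> y * y \<le> 2 * K * real n + 2 \<Longrightarrow>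
      \<theta> * (real n - 1 + y) \<le> sqrt (1 - \<eta>\<^sup>2) * (real n - 1 - 2 * K)"
  shows "\<theta> * tab_rate c' n (a \<inter> triangle c' n) z \<le> tab_rate c N a z"
proof (cases "corner (triangle c' n - a \<inter> triangle c' n) z")
  case False
  then have "tab_rate c' n (a \<inter> triangle c' n) z = 0"
    by (simp add: tab_rate_def)
  then show ?thesis
    using growth.rate_nonneg[OF growth_tab a] subsetD[OF triangle_mono[OF sub] z] by simp
next
  case True
  let ?a' = "a \<inter> triangle c' n"
  note a' = state_restrict[OF a, of c' n]
  obtain x y where xy: "z = (x, y)" by fastforce
  have zT: "z \<in> triangle c N" using subsetD[OF triangle_mono[OF sub] z] .
  have za: "z \<notin> a" using True z by (auto simp: corner_triangle)
  have z': "z \<in> half_plane" using z triangle_subset by blast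
  have y1: "1 \<le> y" using z by (auto simp: mem_triangle xy)
  have c2: "corner (triangle c N - a) z" using True zT za by (auto simp: corner_triangle)
  have ztr: "triangle c' n \<noteq> {}" using z by auto
  have n2: "2 \<le> n" using z by (auto simp: mem_triangle)
  have N2: "2 \<le> N" using n2 sub by linarith
  let ?P = "\<lambda>T b. \<Prod>w\<in>up_hook T z. hook_ratio b w"
  have Pa': "?P (triangle c' n) ?a' = ?P (triangle c' n) a"
  proof (rule prod.cong[OF refl])
    fix w assume w: "w \<in> up_hook (triangle c' n) z"
    then have wT: "w \<in> triangle c' n" by (simp add: up_hook_def)
    have "hook half_plane w \<subseteq> triangle c' n"
    proof
      fix v assume v: "v \<in> hook half_plane w"
      then have "v \<in> half_plane" by (simp add: mem_hook)
      then show "v \<in> triangle c' n" using triangle_down[OF wT _ hook_le[OF v]] by blast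
    qed
    then have "hook half_plane w - ?a' = hook half_plane w - a" by blast
    then show "hook_ratio ?a' w = hook_ratio a w" by (simp add: hook_ratio_def)
  qed
  define A where "A = real (card (triangle c N - a))"
  define A' where "A' = real (card (triangle c' n - ?a'))"
  have "card (triangle c N - a) \<le> card (triangle c N)" using finite_triangle by
    (intro card_mono) auto
  then have A_le: "A \<le> real N * (real N - 1) / 2"
    using real_card_triangle[OF odd(1)] N2 unfolding A_def by linarith
  have A_pos: "0 < A" using zT za finite_triangle by (auto simp: A_def card_gt_0_iff)
  have "A' = real (card (triangle c' n)) - real (card ?a')"
    unfolding A'_def using finite_triangle[of c' n]
    by (subst card_Diff_subset) (auto simp: of_nat_diff card_mono)
  then have A'_ge: "real n * (real n - 1 - 2 * K) / 2 \<le> A'"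
    using real_card_triangle[OF odd(2)] n2 card by (simp add: field_simps)
  have hook1: "hook_prob (triangle c N - a) z = 1 / A * ?P (triangle c N) a"
    unfolding A_def using a zT za by (intro hook_prob_eq) auto
  have hook2: "hook_prob (triangle c' n - ?a') z = 1 / A' * ?P (triangle c' n) a"
    unfolding A'_def Pa'[symmetric] using a' z za by (intro hook_prob_eq) auto
  have nn: "0 \<le> ?P (triangle c' n) a" using a z' za by (rule hook_product_nonneg)
  let ?s = "sqrt (1 - \<eta>\<^sup>2) * (real N - 1) / (real n - 1 + real_of_int y)"
  have cmp: "?P (triangle c' n) a * ?s \<le> ?P (triangle c N) a"
    using hook_product_compare[OF a odd sub, of x y \<eta>] z za \<eta> unfolding xy by simp
  have "real_of_int y * real_of_int y \<le> 2 * K * real n + 2"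
    using corner_height[OF a' True[unfolded xy]] card by linarith
  then have num': "\<theta> * (real n - 1 + real_of_int y) \<le> sqrt (1 - \<eta>\<^sup>2) * (real n - 1 - 2 * K)"
    using y1 by (intro num) auto
  have p1: "0 < real n - 1 - 2 * K" using K by simp
  have p2: "0 < real n - 1 + real_of_int y" using y1 n2 by simp
  have p3: "0 < real N - 1" using N2 by simp
  \<comment> \<open>The normalisation is at most about \<open>2 / n\<close> in the small triangle
    and at least \<open>2 / (N - 1)\<close> in the large one; the factor \<open>N - 1\<close> of
    \<open>?s\<close> makes up for the difference.\<close>
  have nA': "real n / A' \<le> 2 / (real n - 1 - 2 * K)"
  proof -
    have pos: "0 < real n * (real n - 1 - 2 * K) / 2" using p1 n2 by simp
    have "real n / A' \<le> real n / (real n * (real n - 1 - 2 * K) / 2)"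
      using A'_ge pos by (intro divide_left_mono) auto
    also have "\<dots> = 2 / (real n - 1 - 2 * K)" using n2 by simp
    finally show ?thesis .
  qed
  have NA: "2 / (real N - 1) \<le> real N / A"
  proof -
    have "2 / (real N - 1) = real N / (real N * (real N - 1) / 2)" using N2 by simp
    also have "\<dots> \<le> real N / A"
      using A_le A_pos N2 by (intro divide_left_mono) (auto intro: mult_pos_pos)
    finally show ?thesis .
  qed
  have "\<theta> * (real n / A') \<le> \<theta> * (2 / (real n - 1 - 2 * K))"
    using \<theta> nA' by (rule mult_left_mono[rotated])
  also have "\<dots> \<le> 2 * sqrt (1 - \<eta>\<^sup>2) / (real n - 1 + real_of_int y)"
  proof -
    have "\<theta> * (2 / m) \<le> 2 * k / q" if "\<theta> * q \<le> k * m" "0 < m" "0 < q" for m k q :: real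
      using that by (simp add: field_simps)
    from this[OF num' p1 p2] show ?thesis .
  qed
  also have "\<dots> = 2 / (real N - 1) * ?s" using p3 by simp
  finally have key: "\<theta> * (real n / A') \<le> 2 / (real N - 1) * ?s" .
  have s0: "0 \<le> ?s" using \<eta> p2 p3 by (simp add: power_le_one)
  have "\<theta> * (real n * hook_prob (triangle c' n - ?a') z) = \<theta> * (real n / A') * ?P (triangle c' n) a"
    unfolding hook2 by simp
  also have "\<dots> \<le> (2 / (real N - 1) * ?s) * ?P (triangle c' n) a"
    by (rule mult_right_mono[OF key nn])
  also have "\<dots> \<le> (real N / A * ?s) * ?P (triangle c' n) a"
    by (intro mult_right_mono NA nn s0)
  also have "\<dots> = real N / A * (?P (triangle c' n) a * ?s)" by simp
  also have "\<dots> \<le> real N / A * ?P (triangle c N) a"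
    using A_pos by (intro mult_left_mono cmp) auto
  also have "\<dots> = real N * hook_prob (triangle c N - a) z" unfolding hook1 by simp
  finally show ?thesis using True c2 by (simp add: tab_rate_def)
qed

text \<open>The height \<open>y\<close> is of order sqrt n, while the gap between \<theta> and
  \<kappa> gains a term linear in \<open>n\<close>.\<close>

lemma comparison_threshold:
  fixes K \<theta> \<kappa> :: real
  assumes K: "0 < K" and \<theta>: "0 \<le> \<theta>" "\<theta> < \<kappa>" and \<kappa>: "\<kappa> \<le> 1"
  obtains n0 where "\<And>n. n0 \<le> n \<Longrightarrow> 2 * K < real n - 1"
    "\<And>n y. n0 \<le> n \<Longrightarrow> 0 \<le> y \<Longrightarrow> y * y \<le> 2 * K * real n + 2 \<Longrightarrow>
       \<theta> * (real n - 1 + y) \<le> \<kappa> * (real n - 1 - 2 * K)"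
proof -
  define d where "d = \<kappa> - \<theta>"
  have d: "0 < d" using \<theta> by (simp add: d_def)
  have "filterlim (\<lambda>n::nat. d * (real n - 1) - sqrt (2 * K * real n + 2) - 2 * K) at_top at_top"
    using d K by real_asymp
  then have "\<forall>\<^sub>F n::nat in at_top. 0 \<le> d * (real n - 1) - sqrt (2 * K * real n + 2) - 2 * K"
    unfolding filterlim_at_top by blast
  moreover have "\<forall>\<^sub>F n::nat in at_top. 2 * K < real n - 1" by real_asymp
  ultimately have "\<forall>\<^sub>F n::nat in at_top. 2 * K < real n - 1 \<and>
      0 \<le> d * (real n - 1) - sqrt (2 * K * real n + 2) - 2 * K"
    by eventually_elim simp
  then obtain n0 where n0: "\<And>n::nat. n0 \<le> n \<Longrightarrow> 2 * K < real n - 1 \<and>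
      0 \<le> d * (real n - 1) - sqrt (2 * K * real n + 2) - 2 * K"
    unfolding eventually_at_top_linorder by blast
  show ?thesis
  proof (rule that)
    show "2 * K < real n - 1" if "n0 \<le> n" for n using n0[OF that] by blast
    fix n y assume n: "n0 \<le> n" and y: "0 \<le> y" "y * y \<le> 2 * K * real n + 2"
    have "y \<le> sqrt (2 * K * real n + 2)" using y by (intro real_le_rsqrt)
      (simp add: power2_eq_square)
    then have "y + 2 * K \<le> d * (real n - 1)" using n0[OF n] by linarith
    moreover have "\<theta> * y \<le> y" "\<kappa> * (2 * K) \<le> 2 * K"
      using \<theta> \<kappa> y K by (auto simp: mult_left_le_one_le)
    moreover have "d * (real n - 1) = \<kappa> * (real n - 1) - \<theta> * (real n - 1)"
      by (simp add: d_def left_diff_distrib)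
    ultimately show "\<theta> * (real n - 1 + y) \<le> \<kappa> * (real n - 1 - 2 * K)"
      by (simp only: distrib_left right_diff_distrib)
  qed
qed

section \<open>Slowed and stopped tableau processes\<close>

text \<open>The comparison with the large triangle is available only up to \<open>K * n\<close>
  included points. Freezing the process afterwards makes it valid in every state.\<close>

definition slow_rate :: "real \<Rightarrow> real \<Rightarrow> int \<Rightarrow> nat \<Rightarrow> point set \<Rightarrow> point \<Rightarrow> real" where
  "slow_rate \<theta> K c n a z =
     (if real (card a) \<le> K * real n then \<theta> * tab_rate c n a z else 0)"

abbreviation "slow_flow \<theta> K c n \<equiv>
  growth_flow (tableau_states c n) (triangle c n) (slow_rate \<theta> K c n)"

abbreviation "incl_prob c n t z \<equiv> tab_flow c n t (\<lambda>a. of_bool (z \<in> a)) {}"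
abbreviation "all_incl_prob c n t Z \<equiv> tab_flow c n t (\<lambda>a. of_bool (\<forall>z\<in>Z. z \<in> a)) {}"
abbreviation "slow_prob \<theta> K c n t z \<equiv> slow_flow \<theta> K c n t (\<lambda>a. of_bool (z \<in> a)) {}"

lemma growth_slow:
  assumes "0 \<le> \<theta>"
  shows "growth (tableau_states c n) (triangle c n) (slow_rate \<theta> K c n)"
proof -
  interpret G: growth "tableau_states c n" "triangle c n" "tab_rate c n"
    by (rule growth_tab)
  show ?thesis
  proof
    show "0 \<le> slow_rate \<theta> K c n a z" if "a \<in> tableau_states c n" "z \<in> triangle c n" for a z
      using G.rate_nonneg[OF that] assms by (simp add: slow_rate_def)
    show "z \<notin> a \<and> insert z a \<in> tableau_states c n"
      if "a \<in> tableau_states c n" "z \<in> triangle c n" "slow_rate \<theta> K c n a z \<noteq> 0" for a z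
      using G.rate_closed[OF that(1,2)] that(3) by (auto simp: slow_rate_def split: if_splits)
  qed (use G.finite_points G.states in auto)
qed

text \<open>Stopping costs at most the probability that the unstopped process exceeds
  \<open>K * n\<close> points, which Markov's inequality bounds by \<open>\<theta> * t / K\<close>;
  this is independent of \<open>n\<close>.\<close>

lemma slow_flow_ge:
  assumes odd: "odd (c + int n)" and n: "1 \<le> n" and \<theta>: "0 \<le> \<theta>" and K: "0 < K" and t: "0 \<le> t"
    and f: "\<And>a. 0 \<le> f a" "\<And>a. f a \<le> 1"
  shows "tab_flow c n (\<theta> * t) f {} - \<theta> * t / K \<le> slow_flow \<theta> K c n t f {}"
proof -
  let ?S = "tableau_states c n" and ?T = "triangle c n" and ?L = "K * real n"
  interpret G: growth ?S ?T "tab_rate c n" by (rule growth_tab)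
  interpret G': growth ?S ?T "slow_rate \<theta> K c n" by (rule growth_slow[OF \<theta>])
  \<comment> \<open>Cutting \<open>f\<close> off beyond the threshold makes its flow vanish there,
    so that the time-changed flow of \<open>g\<close> solves the equation of the stopped process as
    well.\<close>
  define g where "g b = f b * of_bool (real (card b) \<le> ?L)" for b :: "point set"
  have L: "0 < ?L" using K n by simp
  have zero: "G.flow s g b = 0" if "b \<in> ?S" "?L < real (card b)" for s b
  proof (rule G.flow_supported[where U = "{b. finite b \<and> ?L < real (card b)}"])
    fix a :: "point set" and z :: point assume "a \<in> {b. finite b \<and> ?L < real (card b)}"
    then show "insert z a \<in> {b. finite b \<and> ?L < real (card b)}"
      using card_insert_le[of a z] by (auto intro: less_le_trans)
  qed (use that state_finite in \<open>auto simp: g_def\<close>)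
  have gen0: "G.gen (G.flow s g) b = 0" if b: "b \<in> ?S" "?L < real (card b)" for s b
    unfolding growth_gen_def
  proof (rule sum.neutral, rule ballI)
    fix z assume z: "z \<in> ?T"
    show "tab_rate c n b z * (G.flow s g (insert z b) - G.flow s g b) = 0"
    proof (cases "tab_rate c n b z = 0")
      case False
      then have "insert z b \<in> ?S" using G.rate_closed[OF b(1) z] by blast
      moreover have "?L < real (card (insert z b))"
        using b card_insert_le[of b z] by linarith
      ultimately show ?thesis using zero b by simp
    qed simp
  qed
  have "G.flow (\<theta> * t) g {} \<le> G'.flow t f {}"
  proof (rule G'.subsolution_le_flow[where w = "\<lambda>s. G.flow (\<theta> * s) g" and
        w' = "\<lambda>s b. \<theta> * G.gen (G.flow (\<theta> * s) g) b"])
    fix s :: real and b assume b: "b \<in> ?S"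
    have "((\<lambda>s. G.flow (\<theta> * s) g b) has_real_derivative G.gen (G.flow (\<theta> * s) g) b * \<theta>) (at s)"
      by (rule DERIV_chain2[OF G.flow_has_derivative[OF b]]) (auto intro!: derivative_eq_intros)
    then show "((\<lambda>s. G.flow (\<theta> * s) g b) has_real_derivative \<theta> * G.gen (G.flow (\<theta> * s) g) b) (at s)"
      by (simp add: mult.commute)
    show "\<theta> * G.gen (G.flow (\<theta> * s) g) b \<le> G'.gen (G.flow (\<theta> * s) g) b"
    proof (cases "real (card b) \<le> ?L")
      case True
      then show ?thesis by (simp add: growth_gen_def slow_rate_def sum_distrib_left mult.assoc)
    next
      case False
      then show ?thesis using gen0[OF b] by (simp add: growth_gen_def slow_rate_def)
    qed
  qed (use f t in \<open>auto simp: g_def\<close>)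
  moreover have "G.flow (\<theta> * t) (\<lambda>b. f b - of_bool (?L < real (card b))) {} \<le> G.flow (\<theta> * t) g {}"
    using f \<theta> t by (intro G.flow_mono) (auto simp: g_def)
  moreover have "G.flow (\<theta> * t) (\<lambda>b. f b - of_bool (?L < real (card b))) {}
      = G.flow (\<theta> * t) f {} - G.flow (\<theta> * t) (\<lambda>b. of_bool (?L < real (card b))) {}"
    by (rule G.flow_diff) simp
  moreover have "G.flow (\<theta> * t) (\<lambda>b. of_bool (?L < real (card b))) {} \<le> real n * (\<theta> * t) / ?L"
    using \<theta> t L by (intro tab_flow_card_gt odd) auto
  moreover have "real n * (\<theta> * t) / ?L = \<theta> * t / K" using n by simp
  ultimately show ?thesis by linarith
qed


section \<open>Isomorphic processes and survival of a single point\<close>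

lemma growth_flow_iso:
  assumes g: "growth S T \<rho>" and g': "growth S' T' \<rho>'"
    and inj: "inj_on \<phi> T" and T': "T' = \<phi> ` T" and S': "\<And>a. a \<in> S \<Longrightarrow> \<phi> ` a \<in> S'"
    and rate: "\<And>a z. a \<in> S \<Longrightarrow> z \<in> T \<Longrightarrow> \<rho>' (\<phi> ` a) (\<phi> z) = \<rho> a z"
    and a: "a \<in> S" and t: "0 \<le> t"
  shows "growth_flow S' T' \<rho>' t f (\<phi> ` a) = growth_flow S T \<rho> t (\<lambda>b. f (\<phi> ` b)) a"
proof -
  interpret G: growth S T \<rho> by (rule g)
  interpret G': growth S' T' \<rho>' by (rule g')
  let ?w = "\<lambda>s b. G'.flow s f (\<phi> ` b)"
  let ?w' = "\<lambda>s b. G'.gen (G'.flow s f) (\<phi> ` b)"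
  have der: "((\<lambda>s. ?w s b) has_real_derivative ?w' s b) (at s)" if "b \<in> S" for s b
    by (rule G'.flow_has_derivative[OF S'[OF that]])
  have gen: "?w' s b = G.gen (?w s) b" if "b \<in> S" for s b
    unfolding growth_gen_def T' using rate[OF that]
    by (simp add: sum.reindex[OF inj] cong: sum.cong)
  have "?w t a \<le> G.flow t (\<lambda>b. f (\<phi> ` b)) a"
    by (rule G.subsolution_le_flow[OF a t, of ?w ?w'], erule der) (simp_all add: gen)
  moreover have "G.flow t (\<lambda>b. f (\<phi> ` b)) a \<le> ?w t a"
    by (rule G.flow_le_supersolution[OF a t, of ?w ?w'], erule der) (simp_all add: gen)
  ultimately show ?thesis by simp
qed

text \<open>As long as the bad event has not occurred, the point is added at rate at most \<open>R\<close>.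
  Since the rates are attractive, the event that it has not been added yet makes the bad event
    less likely.\<close>

lemma (in growth) survival:
  assumes attr: "attractive S T \<rho>" and z0: "z0 \<in> T" and R: "0 \<le> R"
    and B: "\<And>a b. B a \<Longrightarrow> finite b \<Longrightarrow> a \<subseteq> b \<Longrightarrow> B b"
    and rate: "\<And>a. a \<in> S \<Longrightarrow> z0 \<notin> a \<Longrightarrow> \<not> B a \<Longrightarrow> \<rho> a z0 \<le> R"
    and t: "0 \<le> t" and a: "a \<in> S"
  shows "of_bool (z0 \<notin> a) * exp (- R * t) * (1 - flow t (\<lambda>b. of_bool (B b)) a)
    \<le> flow t (\<lambda>b. of_bool (z0 \<notin> b)) a"
proof -
  let ?v = "\<lambda>s. flow s (\<lambda>b. of_bool (B b))"
  let ?w = "\<lambda>s b. of_bool (z0 \<notin> b) * exp (- R * s) * (1 - ?v s b)"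
  let ?w' = "\<lambda>s b. of_bool (z0 \<notin> b) * (- R * exp (- R * s) * (1 - ?v s b) - exp (- R * s) * gen
    (?v s) b)"
  have fin: "finite b" if "b \<in> S" for b
    using that states finite_points finite_subset by blast
  have incB: "increasing_on S (\<lambda>b. of_bool (B b))"
    using B fin by (auto simp: increasing_on_def)
  have v1: "?v s b \<le> 1" if "b \<in> S" "0 \<le> s" for s b
    using flow_mono[OF that, of "\<lambda>b. of_bool (B b)" "\<lambda>_. 1"] flow_const[OF that] by simp
  have vB: "?v s b = 1" if b: "b \<in> S" "0 \<le> s" "B b" for s b
  proof -
    have "flow s (\<lambda>b. 1 - of_bool (B b)) b = 0"
    proof (rule flow_supported[where U = "{b. finite b \<and> B b}"])
      show "insert z b \<in> {b. finite b \<and> B b}" if "b \<in> {b. finite b \<and> B b}" for b z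
        using that B[of b "insert z b"] by auto
    qed (use b fin in auto)
    then show ?thesis using flow_diff[OF b(1), of s "\<lambda>_. 1" "\<lambda>b. of_bool
      (B b)"] flow_const[OF b(1,2)] by simp
  qed
  show ?thesis
  proof (rule subsolution_le_flow[OF a t, of ?w ?w'])
    fix s :: real and b assume b: "b \<in> S" and s: "0 \<le> s"
    show "((\<lambda>s. ?w s b) has_real_derivative ?w' s b) (at s)"
      using flow_has_derivative[OF b] by (auto intro!: derivative_eq_intros simp: algebra_simps)
    show "?w' s b \<le> gen (?w s) b"
    proof (cases "z0 \<in> b")
      case True
      then show ?thesis by (simp add: growth_gen_def)
    next
      case False
      let ?E = "exp (- R * s)"
      \<comment> \<open>Adding \<open>z0\<close> destroys all of \<open>?w s b\<close>. If
        \<open>B b\<close> holds, nothing is lost because \<open>?v s b\<close> is 1; otherwise the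
        rate is at most \<open>R\<close>, and the derivative of the exponential pays. The discarded
        increment of \<open>?v\<close> at \<open>z0\<close> has the right sign because the flow of
        the bad event is increasing.\<close>
      have "- ?E * (\<rho> b z * (?v s (insert z b) - ?v s b)) - of_bool (z = z0) * (R * ?E * (1
        - ?v s b))
          \<le> \<rho> b z * (?w s (insert z b) - ?w s b)" if z: "z \<in> T" for z
      proof (cases "z = z0")
        case z_eq: True
        have r0: "0 \<le> \<rho> b z0" by (rule rate_nonneg[OF b z0])
        have "\<rho> b z0 * (1 - ?v s b) \<le> R * (1 - ?v s b)"
          using rate[OF b False] vB[OF b s] v1[OF b s] by (cases "B b")
            (auto intro: mult_right_mono)
        moreover have "0 \<le> \<rho> b z0 * (?v s (insert z0 b) - ?v s b)"
        proof (cases "\<rho> b z0 = 0")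
          case False
          then have "insert z0 b \<in> S" using rate_closed[OF b z0] by simp
          then have "?v s b \<le> ?v s (insert z0 b)"
            using flow_increasing[OF attr incB s] b unfolding increasing_on_def by blast
          then show ?thesis using r0 by simp
        qed simp
        ultimately have "- (\<rho> b z0 * (?v s (insert z0 b) - ?v s b)) - R * (1 - ?v s b)
            \<le> - (\<rho> b z0 * (1 - ?v s b))" by linarith
        then have "?E * (- (\<rho> b z0 * (?v s (insert z0 b) - ?v s b)) - R * (1 - ?v s b))
            \<le> ?E * (- (\<rho> b z0 * (1 - ?v s b)))" by (rule mult_left_mono) simp
        then show ?thesis using z_eq False by (simp add: algebra_simps)
      next
        case z_ne: False
        then show ?thesis using False by (simp add: algebra_simps)
      qed
      then have "(\<Sum>z\<in>T. - ?E * (\<rho> b z * (?v s (insert z b) - ?v s b))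
          - of_bool (z = z0) * (R * ?E * (1 - ?v s b))) \<le> gen (?w s) b"
        unfolding growth_gen_def by (rule sum_mono)
      moreover have "(\<Sum>z\<in>T. - ?E * (\<rho> b z * (?v s (insert z b) - ?v s b))
          - of_bool (z = z0) * (R * ?E * (1 - ?v s b)))
          = - ?E * gen (?v s) b - R * ?E * (1 - ?v s b)"
      proof -
        have "(\<Sum>z\<in>T. of_bool (z = z0) * (R * ?E * (1 - ?v s b))) = R * ?E * (1 - ?v s b)"
          using z0 finite_points by (simp add: of_bool_def if_distrib[of "\<lambda>x. x * _"] cong: if_cong)
        then show ?thesis
          by (simp only: sum_subtractf growth_gen_def sum_distrib_left)
      qed
      ultimately show ?thesis using False by (simp add: algebra_simps)
    qed
  qed simp
qed

section \<open>Approximate independence in disjoint triangles\<close>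

text \<open>\<eta> limits how far the small triangle reaches from the central column, relative to
  the large size; sqrt(1 - \<eta>^2) has to leave room for \<theta>. The threshold is uniform in the
  large triangle and in the state.\<close>

lemma slow_rate_comparison:
  assumes K: "0 < K" and \<theta>: "0 \<le> \<theta>" "\<theta> < sqrt (1 - \<eta>\<^sup>2)" and \<eta>: "0 \<le> \<eta>" "\<eta> \<le> 1"
  obtains n0 where "\<And>n N c c' a z. n0 \<le> n \<Longrightarrow> odd (c + int N) \<Longrightarrow> odd (c' + int n) \<Longrightarrow>
     \<bar>c - c'\<bar> \<le> int N - int n \<Longrightarrow> real_of_int \<bar>c - c'\<bar> + real n \<le> \<eta> * (real N - 1) \<Longrightarrow>
     a \<in> tableau_states c N \<Longrightarrow> z \<in> triangle c' n \<Longrightarrow>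
     slow_rate \<theta> K c' n (a \<inter> triangle c' n) z \<le> tab_rate c N a z"
proof -
  have "sqrt (1 - \<eta>\<^sup>2) \<le> 1" by simp
  from comparison_threshold[OF K \<theta> this] obtain n0 where
    n0: "\<And>n. n0 \<le> n \<Longrightarrow> 2 * K < real n - 1"
    "\<And>n y. n0 \<le> n \<Longrightarrow> 0 \<le> y \<Longrightarrow> y * y \<le> 2 * K * real n + 2 \<Longrightarrow>
       \<theta> * (real n - 1 + y) \<le> sqrt (1 - \<eta>\<^sup>2) * (real n - 1 - 2 * K)" by blast
  show ?thesis
  proof (rule that)
    fix n N c c' a z
    assume *: "n0 \<le> n" "odd (c + int N)" "odd (c' + int n)" "\<bar>c - c'\<bar> \<le> int N - int n"
     "real_of_int \<bar>c - c'\<bar> + real n \<le> \<eta> * (real N - 1)"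
     "a \<in> tableau_states c N" "z \<in> triangle c' n"
    show "slow_rate \<theta> K c' n (a \<inter> triangle c' n) z \<le> tab_rate c N a z"
    proof (cases "real (card (a \<inter> triangle c' n)) \<le> K * real n")
      case False
      then show ?thesis
        using growth.rate_nonneg[OF growth_tab *(6), of z]
          subsetD[OF triangle_mono[OF *(4)] *(7)] by (simp add: slow_rate_def)
    next
      case True
      have "\<bar>fst z - c\<bar> \<le> \<bar>c - c'\<bar> + int n" using *(7) by (auto simp: mem_triangle)
      then have "\<bar>real_of_int (fst z - c)\<bar> \<le> \<eta> * (real N - 1)" using *(5) by linarith
      then have "\<theta> * tab_rate c' n (a \<inter> triangle c' n) z \<le> tab_rate c N a z"
        using * \<eta> \<theta>(1) True n0(1)[OF *(1)] n0(2)[OF *(1)] by (intro rate_comparison) auto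
      then show ?thesis using True by (simp add: slow_rate_def)
    qed
  qed
qed

locale disjoint_triangles =
  fixes I :: "'i set" and c :: int and N :: nat and c' :: "'i \<Rightarrow> int" and n :: nat
    and \<theta> K t :: real
  assumes finite_index: "finite I" and \<theta>: "0 \<le> \<theta>" and t: "0 \<le> t"
    and disjoint: "\<And>i j. i \<in> I \<Longrightarrow> j \<in> I \<Longrightarrow> i \<noteq> j \<Longrightarrow> triangle (c' i) n \<inter> triangle (c' j) n = {}"
    and contained: "\<And>i. i \<in> I \<Longrightarrow> triangle (c' i) n \<subseteq> triangle c N"
    and slower: "\<And>i a z. i \<in> I \<Longrightarrow> a \<in> tableau_states c N \<Longrightarrow> z \<in> triangle (c' i) n \<Longrightarrow>
      slow_rate \<theta> K (c' i) n (a \<inter> triangle (c' i) n) z \<le> tab_rate c N a z"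
begin

text \<open>Superposition of the slowed processes, with rate 0 outside the small triangles. Lying
  below \<open>tab_rate\<close>, it is positive only at corners, so the states of the large triangle
  remain a closed state space.\<close>

definition "\<rho>' a z = (\<Sum>i\<in>I. of_bool (z \<in> triangle (c' i) n) *
   slow_rate \<theta> K (c' i) n (a \<inter> triangle (c' i) n) z)"

sublocale G: growth "tableau_states c N" "triangle c N" "tab_rate c N"
  by (rule growth_tab)

lemma rate_le:
  assumes a: "a \<in> tableau_states c N" and z: "z \<in> triangle c N"
  shows "0 \<le> \<rho>' a z" "\<rho>' a z \<le> tab_rate c N a z"
proof -
  show "0 \<le> \<rho>' a z"
    unfolding \<rho>'_def
    using growth.rate_nonneg[OF growth_slow[OF \<theta>] state_restrict[OF a]] by (intro sum_nonneg) auto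
  show "\<rho>' a z \<le> tab_rate c N a z"
  proof (cases "\<exists>i\<in>I. z \<in> triangle (c' i) n")
    case True
    then obtain i where i: "i \<in> I" "z \<in> triangle (c' i) n" by blast
    have "\<rho>' a z = (\<Sum>j\<in>{i}. of_bool (z \<in> triangle (c' j) n) *
        slow_rate \<theta> K (c' j) n (a \<inter> triangle (c' j) n) z)"
      unfolding \<rho>'_def using disjoint i finite_index by (intro sum.mono_neutral_right) auto
    then show ?thesis using slower[OF i(1) a i(2)] i by simp
  next
    case False
    then show ?thesis using G.rate_nonneg[OF a z] by (simp add: \<rho>'_def)
  qed
qed

sublocale G': growth "tableau_states c N" "triangle c N" \<rho>'
proof
  show "0 \<le> \<rho>' a z" if "a \<in> tableau_states c N" "z \<in> triangle c N" for a z
    using rate_le[OF that] by simp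
  show "z \<notin> a \<and> insert z a \<in> tableau_states c N"
    if "a \<in> tableau_states c N" "z \<in> triangle c N" "\<rho>' a z \<noteq> 0" for a z
    using that rate_le[OF that(1,2)] by (intro G.rate_closed) auto
qed (use G.finite_points G.states in auto)

lemma product_flow:
  "G'.flow t (\<lambda>a. \<Prod>i\<in>I. f i (a \<inter> triangle (c' i) n)) {}
    = (\<Prod>i\<in>I. slow_flow \<theta> K (c' i) n t (f i) {})"
proof -
  have "G'.flow t (\<lambda>a. \<Prod>i\<in>I. f i (a \<inter> triangle (c' i) n)) {}
    = (\<Prod>i\<in>I. slow_flow \<theta> K (c' i) n t (f i) ({} \<inter> triangle (c' i) n))"
  proof (rule growth_product_flow)
    show "growth (tableau_states c N) (triangle c N) \<rho>'" by unfold_locales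
  qed (use finite_index contained disjoint state_restrict t growth_slow[OF \<theta>] in \<open>auto simp:
    \<rho>'_def\<close>)
  then show ?thesis by simp
qed

lemma single_flow:
  assumes i: "i \<in> I" and p: "p \<in> triangle (c' i) n"
  shows "G'.flow t (\<lambda>a. of_bool (p \<in> a)) {} = slow_prob \<theta> K (c' i) n t p"
proof -
  let ?f = "\<lambda>j b. if j = i then of_bool (p \<in> b) else (1 :: real)"
  have "(\<Prod>j\<in>I. ?f j (a \<inter> triangle (c' j) n)) = of_bool (p \<in> a)" for a
  proof -
    have "(\<Prod>j\<in>I. ?f j (a \<inter> triangle (c' j) n))
        = (\<Prod>j\<in>I. if j = i then of_bool (p \<in> a) else 1)"
      using p by (intro prod.cong) auto
    then show ?thesis using i finite_index by simp
  qed
  then have "G'.flow t (\<lambda>a. of_bool (p \<in> a)) {} = (\<Prod>j\<in>I. slow_flow \<theta> K (c' j) n t (?f j) {})"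
    using product_flow[of ?f] by simp
  also have "\<dots> = (\<Prod>j\<in>I. if j = i then slow_prob \<theta> K (c' i) n t p else 1)"
    using growth.flow_const[OF growth_slow[OF \<theta>] _ t] by (intro prod.cong) auto
  finally show ?thesis using i finite_index by simp
qed

lemma slow_flow_le:
  assumes i: "i \<in> I" and p: "p \<in> triangle (c' i) n"
  shows "slow_prob \<theta> K (c' i) n t p \<le> G.flow t (\<lambda>a. of_bool (p \<in> a)) {}"
  unfolding single_flow[OF assms, symmetric]
  using rate_le(2) attractive_tab t
  by (intro growth_domination G.growth_axioms G'.growth_axioms) (auto simp: increasing_on_def)

text \<open>The indicator of the intersection of increasing events minus the sum of their indicators
  is decreasing, so the domination can be used in the direction of an upper bound.\<close>

lemma joint_bound:
  assumes I: "I \<noteq> {}" and p: "\<And>i. i \<in> I \<Longrightarrow> p i \<in> triangle (c' i) n"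
  shows "G.flow t (\<lambda>a. of_bool (\<forall>i\<in>I. p i \<in> a)) {}
    \<le> (\<Prod>i\<in>I. slow_prob \<theta> K (c' i) n t (p i))
      + (\<Sum>i\<in>I. incl_prob c N t (p i) - slow_prob \<theta> K (c' i) n t (p i))"
proof -
  let ?s = "\<lambda>a. \<Sum>i\<in>I. 1 * of_bool (p i \<in> a) :: real"
  let ?f = "\<lambda>a. ?s a - of_bool (\<forall>i\<in>I. p i \<in> a)"
  have "increasing_on (tableau_states c N) ?f"
    unfolding increasing_on_def
  proof (intro ballI impI)
    fix a b :: "point set" assume ab: "a \<subseteq> b"
    have mono: "?s a \<le> ?s b" using ab by (intro sum_mono) auto
    show "?f a \<le> ?f b"
    proof (cases "\<exists>i\<in>I. p i \<in> b - a")
      case True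
      then obtain i where i: "i \<in> I" "p i \<in> b" "p i \<notin> a" by blast
      have le: "(\<Sum>j\<in>I - {i}. 1 * of_bool (p j \<in> a)) \<le> (\<Sum>j\<in>I - {i}. 1 * of_bool (p j \<in> b) :: real)"
        using ab by (intro sum_mono) auto
      have eq: "?s e = 1 * of_bool (p i \<in> e) + (\<Sum>j\<in>I - {i}. 1 * of_bool (p j \<in> e))" for e
        by (rule sum.remove[OF finite_index i(1)])
      have "of_bool (p i \<in> a) = (0 :: real)" "of_bool (p i \<in> b) = (1 :: real)"
        using i by simp_all
      \<comment> \<open>A newly included point raises the sum by at least 1, and the indicator can
        rise by at most 1.\<close>
      then have "?s a + 1 \<le> ?s b" using le eq[of a] eq[of b] by linarith
      then show ?thesis by (auto simp: of_bool_def)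
    next
      case False
      then have "(\<forall>i\<in>I. p i \<in> a) \<longleftrightarrow> (\<forall>i\<in>I. p i \<in> b)" using ab by blast
      then show ?thesis using mono by simp
    qed
  qed
  then have "G'.flow t ?f {} \<le> G.flow t ?f {}"
    using rate_le(2) attractive_tab t
    by (intro growth_domination G.growth_axioms G'.growth_axioms) auto
  moreover have "G.flow t ?f {} = (\<Sum>i\<in>I. incl_prob c N t (p i))
      - G.flow t (\<lambda>a. of_bool (\<forall>i\<in>I. p i \<in> a)) {}"
    by (subst G.flow_diff, simp, subst G.flow_sum) simp_all
  moreover have "G'.flow t ?f {} = (\<Sum>i\<in>I. slow_prob \<theta> K (c' i) n t (p i))
      - G'.flow t (\<lambda>a. of_bool (\<forall>i\<in>I. p i \<in> a)) {}"
    using single_flow p by (subst G'.flow_diff, simp, subst G'.flow_sum) (simp_all cong: sum.cong)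
  moreover have "G'.flow t (\<lambda>a. of_bool (\<forall>i\<in>I. p i \<in> a)) {}
      = (\<Prod>i\<in>I. slow_prob \<theta> K (c' i) n t (p i))"
  proof -
    have "(\<Prod>i\<in>I. of_bool (p i \<in> a \<inter> triangle (c' i) n)) = (of_bool (\<forall>i\<in>I. p i \<in> a) :: real)" for a
      using p finite_index by (auto simp: of_bool_def prod_zero_iff intro!: prod.neutral)
    then show ?thesis using product_flow[of "\<lambda>i b. of_bool (p i \<in> b)"] by simp
  qed
  ultimately show ?thesis by (simp add: sum_subtractf)
qed

end

section \<open>Translations\<close>

text \<open>Horizontal translation. It preserves the parity condition of the half plane only for
  even \<open>d\<close>.\<close>

definition shift :: "int \<Rightarrow> point \<Rightarrow> point" where
  "shift d z = (fst z + d, snd z)"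

lemma inj_shift: "inj (shift d)"
  by (auto simp: inj_def shift_def prod_eq_iff)

lemma mem_shift: "z \<in> shift d ` A \<longleftrightarrow> shift (- d) z \<in> A"
  by (force simp: shift_def)

lemma shift_hook: "hook (shift d ` B) (shift d w) = shift d ` hook B w"
  unfolding set_eq_iff mem_shift mem_hook by (auto simp: shift_def)

lemma shift_triangle:
  assumes "even d"
  shows "triangle (c + d) n = shift d ` triangle c n"
proof (intro set_eqI iffI)
  fix z assume "z \<in> triangle (c + d) n"
  then have "shift (- d) z \<in> triangle c n" using assms by (auto simp: mem_triangle shift_def)
  then have "shift d (shift (- d) z) \<in> shift d ` triangle c n" by (rule imageI)
  then show "z \<in> shift d ` triangle c n" by (simp add: shift_def)
qed (use assms in \<open>auto simp: mem_triangle shift_def\<close>)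

lemma shift_corner: "corner (shift d ` B) (shift d z) \<longleftrightarrow> corner B z"
proof -
  have "shift d ` hook B z = {shift d z} \<longleftrightarrow> hook B z = {z}"
    using inj_image_eq_iff[OF inj_shift, of d "hook B z" "{z}"] by simp
  then show ?thesis by (simp add: corner_def shift_hook inj_image_mem_iff[OF inj_shift])
qed

lemma shift_hook_prob: "hook_prob (shift d ` B) (shift d z) = hook_prob B z"
proof -
  have inj: "inj_on (shift d) A" for A using inj_shift inj_on_subset by blast
  have "hook_length (shift d ` B) (shift d w) = hook_length B w" for w
    by (simp add: hook_length_def shift_hook card_image[OF inj])
  moreover have "reverse_hook (shift d ` B) (shift d z) = shift d ` reverse_hook B z"
  proof -
    have "shift d ` B - {shift d z} = shift d ` (B - {z})"
      by (simp add: image_set_diff[OF inj_shift])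
    then show ?thesis
      unfolding reverse_hook_def
      by (auto simp: shift_hook inj_image_mem_iff[OF inj_shift])
  qed
  ultimately show ?thesis
    by (simp add: hook_prob_def card_image[OF inj] prod.reindex[OF inj])
qed

lemma shift_states:
  assumes "even d" "a \<in> tableau_states c n"
  shows "shift d ` a \<in> tableau_states (c + d) n"
proof -
  have "w \<in> shift d ` a" if z: "z \<in> a" and w: "w \<in> half_plane" "w \<preceq> shift d z" for z w
  proof -
    have "shift (- d) w \<in> a"
      using w assms(1) by (intro tableau_statesD(3)[OF assms(2) z])
        (auto simp: mem_half_plane shift_def point_le_def)
    then have "shift d (shift (- d) w) \<in> shift d ` a" by (rule imageI)
    then show ?thesis by (simp add: shift_def)
  qed
  moreover have "shift d ` a \<subseteq> triangle (c + d) n"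
    using tableau_statesD(1)[OF assms(2)] by (auto simp: shift_triangle[OF assms(1)])
  ultimately show ?thesis
    using triangle_subset by (fastforce simp: tableau_states_def downward_closed_def)
qed

lemma tab_flow_shift:
  assumes d: "even d" and t: "0 \<le> t"
  shows "tab_flow (c + d) n t (\<lambda>a. of_bool (shift d z \<in> a)) {} = tab_flow c n t (\<lambda>a. of_bool
    (z \<in> a)) {}"
proof -
  have "tab_flow (c + d) n t (\<lambda>a. of_bool (shift d z \<in> a)) (shift d ` {})
      = tab_flow c n t (\<lambda>a. of_bool (shift d z \<in> shift d ` a)) {}"
  proof (rule growth_flow_iso)
    show "tab_rate (c + d) n (shift d ` a) (shift d z) = tab_rate c n a z" for a z
      unfolding tab_rate_def shift_triangle[OF d] image_set_diff[OF inj_shift, symmetric]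
        shift_corner shift_hook_prob ..
    show "inj_on (shift d) (triangle c n)" using inj_shift inj_on_subset by blast
    show "growth (tableau_states c n) (triangle c n) (tab_rate c n)"
      "growth (tableau_states (c + d) n) (triangle (c + d) n) (tab_rate (c + d) n)"
      by (rule growth_tab)+
  qed (use shift_triangle[OF d] shift_states[OF d] t in simp_all)
  then show ?thesis by (simp add: inj_image_mem_iff[OF inj_shift])
qed


section \<open>Survival of points of the bottom row\<close>

definition diag_card :: "point set \<Rightarrow> int \<Rightarrow> int \<Rightarrow> real" where
  "diag_card a \<sigma> s = real (card {w \<in> a. fst w + \<sigma> * snd w = s})"

text \<open>The reverse hook of \<open>(x, 1)\<close> consists of the points
  \<open>(x + k, k + 1)\<close> and \<open>(x - k, k + 1)\<close>. Their hooks have an arm pointing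
  away from \<open>x\<close>, on the diagonals counted here; each included point there raises the
  ratio by a relative amount of at most \<open>1 / k\<^sup>2\<close>.\<close>

definition diag_load :: "nat \<Rightarrow> int \<Rightarrow> point set \<Rightarrow> real" where
  "diag_load N x a = (\<Sum>k = 1..N.
     (diag_card a 1 (x + (1 + 2 * int k)) + diag_card a (- 1) (x + - (1 + 2 * int k))) /
       (real k)\<^sup>2)"

text \<open>\<open>D\<close> is meant to be the arm leading back to the surviving point, none of
  which is included. It keeps \<open>h - 1\<close> at least \<open>k\<close> however much of the
  other arm is gone, so the excess \<open>b / (2 * k * (h - 1))\<close> over the value for a full
  hook is at most \<open>b / k\<^sup>2\<close>.\<close>

lemma hook_ratio_le:
  assumes w: "w \<in> half_plane" "snd w = int k + 1" and k: "1 \<le> k"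
    and D: "D \<subseteq> hook half_plane w" "D \<inter> a = {}" "card D = k + 1"
    and E: "hook half_plane w \<inter> a \<subseteq> E" "finite E"
  shows "hook_ratio a w \<le> (1 + 1 / (2 * real k)) * exp (real (card E) / (real k)\<^sup>2)"
proof -
  let ?H = "hook half_plane w"
  have fin: "finite ?H" by (rule finite_full_hook[OF w(1)])
  define b where "b = real (card (?H \<inter> a))"
  define h where "h = real (card (?H - a))"
  have "card ?H = card (?H \<inter> a) + card (?H - a)"
    using fin by (subst card_Un_disjoint[symmetric]) (auto intro: arg_cong[where f = card])
  then have h: "h = 2 * real k + 1 - b"
    using card_full_hook[OF w(1)] w(2) by (simp add: b_def h_def)
  have "card D \<le> card (?H - a)" using D fin by (intro card_mono) auto
  then have hk: "real k \<le> h - 1" using D by (simp add: h_def)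
  have bE: "b \<le> real (card E)" unfolding b_def using E by (simp add: card_mono)
  have k0: "0 < real k" using k by simp
  have b0: "0 \<le> b" by (simp add: b_def)
  have "1 / (h - 1) - 1 / (2 * real k) = b / (2 * real k * (h - 1))"
    using h hk k0 by (simp add: field_simps)
  also have "\<dots> \<le> b / (real k)\<^sup>2"
    unfolding power2_eq_square using hk k0 b0 by (intro divide_left_mono mult_mono) auto
  finally have e1: "1 / (h - 1) \<le> 1 / (2 * real k) + b / (real k)\<^sup>2" by simp
  have "h / (h - 1) = 1 + 1 / (h - 1)" using hk k0 by (simp add: field_simps)
  also have "\<dots> \<le> (1 + 1 / (2 * real k)) * (1 + b / (real k)\<^sup>2)"
  proof -
    have "0 \<le> 1 / (2 * real k) * (b / (real k)\<^sup>2)" using b0 by simp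
    moreover have "(1 + p) * (1 + q) = 1 + p + q + p * q" for p q :: real by
      (simp add: algebra_simps)
    ultimately show ?thesis using e1 by simp
  qed
  also have "\<dots> \<le> (1 + 1 / (2 * real k)) * exp (b / (real k)\<^sup>2)"
    by (intro mult_left_mono exp_ge_add_one_self) simp
  also have "\<dots> \<le> (1 + 1 / (2 * real k)) * exp (real (card E) / (real k)\<^sup>2)"
    using bE by (intro mult_left_mono) (auto intro: divide_right_mono)
  finally show ?thesis by (simp add: hook_ratio_def h_def)
qed

text \<open>A Wallis type bound, inductive because
  \<open>(2 * m + 1) * (2 * m + 3) \<le> (2 * m + 2)\<^sup>2\<close>. The product over both
  diagonals then has order \<open>N\<close>, which cancels the normalisation.\<close>

lemma prod_half_le: "(\<Prod>k = 1..m. 1 + 1 / (2 * real k)) \<le> sqrt (2 * real m + 1)"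
proof (induction m)
  case (Suc m)
  have "(\<Prod>k = 1..Suc m. 1 + 1 / (2 * real k)) = (\<Prod>k = 1..m. 1 + 1 / (2 * real k)) * (1 + 1 / (2
    * real (Suc m)))"
    by simp
  also have "\<dots> \<le> sqrt (2 * real m + 1) * (1 + 1 / (2 * real (Suc m)))"
    by (intro mult_right_mono Suc.IH) auto
  also have "\<dots> \<le> sqrt (2 * real (Suc m) + 1)"
  proof (rule real_le_rsqrt)
    define u where "u = real m"
    have u: "0 \<le> u" by (simp add: u_def)
    have "(2 * u + 1) * (2 * u + 3) \<le> (2 * u + 2)\<^sup>2" by (simp add: power2_eq_square algebra_simps)
    then have "(2 * u + 1) * (2 * u + 3) * (2 * u + 3) \<le> (2 * u + 2)\<^sup>2 * (2 * u + 3)"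
      using u by (intro mult_right_mono) auto
    then have "(2 * u + 1) * (2 * u + 3)\<^sup>2 / (2 * u + 2)\<^sup>2 \<le> 2 * u + 3"
      using u by (simp add: power2_eq_square divide_le_eq mult_ac)
    moreover have "1 + 1 / (2 * real (Suc m)) = (2 * u + 3) / (2 * u + 2)"
      using u by (simp add: u_def field_simps)
    moreover have "(sqrt (2 * real m + 1))\<^sup>2 = 2 * u + 1" using u by (simp add: u_def)
    ultimately show "(sqrt (2 * real m + 1) * (1 + 1 / (2 * real (Suc m))))\<^sup>2 \<le> 2 * real (Suc m)
      + 1"
      by (simp only: power_mult_distrib power_divide) (simp add: u_def)
  qed
  finally show ?case .
qed simp

lemma bottom_ratio_le:
  assumes a: "a \<in> tableau_states c N" and x: "odd x" "(x, 1) \<notin> a"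
    and \<sigma>: "\<sigma> = 1 \<or> \<sigma> = - 1" and k: "1 \<le> k"
  defines "w \<equiv> (x + \<sigma> * int k, 1 + int k)"
  shows "1 \<le> hook_ratio a w"
    and "hook_ratio a w \<le> (1 + 1 / (2 * real k)) * exp (diag_card a \<sigma> (x + \<sigma> * (1 + 2 * int k)) /
      (real k)\<^sup>2)"
proof -
  have hp: "(x, 1) \<in> half_plane" using x by (simp add: mem_half_plane)
  have w: "w \<in> half_plane" using x \<sigma> by (auto simp: mem_half_plane w_def)
  show "1 \<le> hook_ratio a w"
    using k \<sigma> by (intro hook_ratio_ge_1[OF a hp x(2) w]) (auto simp: mem_hook w_def hp)
  have notin: "v \<notin> a" if "v \<in> half_plane" "(x, 1) \<preceq> v" for v
    using tableau_statesD(3)[OF a, of v "(x, 1)"] that x hp by blast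
  show "hook_ratio a w \<le> (1 + 1 / (2 * real k)) * exp (diag_card a \<sigma> (x + \<sigma> * (1 + 2 * int k)) /
    (real k)\<^sup>2)"
    unfolding diag_card_def
  proof (rule hook_ratio_le[OF w _ k])
    \<comment> \<open>The arm towards \<open>(x, 1)\<close> runs down to that point and lies above
      it in the order, so no point of it is included; the included part of the hook is confined to
      the outward diagonal.\<close>
    let ?D = "(\<lambda>j. (x + \<sigma> * (int k - int j), 1 + int k - int j)) ` {0..k}"
    show "?D \<subseteq> hook half_plane w" using x \<sigma> by (auto simp: mem_hook mem_half_plane w_def)
    have "v \<notin> a" if "v \<in> ?D" for v
      using that x \<sigma> by (intro notin) (auto simp: mem_half_plane point_le_def)
    then show "?D \<inter> a = {}" by blast
    show "card ?D = k + 1" by (subst card_image) (auto simp: inj_on_def)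
    show "hook half_plane w \<inter> a \<subseteq> {w \<in> a. fst w + \<sigma> * snd w = x + \<sigma> * (1 + 2 * int k)}"
    proof
      fix v assume v: "v \<in> hook half_plane w \<inter> a"
      have "\<not> (x, 1) \<preceq> v" using notin[of v] v by (auto simp: mem_hook)
      then show "v \<in> {w \<in> a. fst w + \<sigma> * snd w = x + \<sigma> * (1 + 2 * int k)}"
        using v \<sigma> by (auto simp: mem_hook mem_half_plane point_le_def w_def)
    qed
  qed (use state_finite[OF a] in \<open>auto simp: w_def\<close>)
qed

lemma bottom_rate_le:
  assumes a: "a \<in> tableau_states c N" and odd: "odd (c + int N)" and N: "2 \<le> N"
    and z: "(x, 1) \<in> triangle c N" "(x, 1) \<notin> a"
    and card: "real (card a) \<le> (real N)\<^sup>2 / 8" and load: "diag_load N x a \<le> M"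
  shows "tab_rate c N a (x, 1) \<le> 8 * exp M"
proof -
  have x: "odd x" "x + 1 \<le> c + int N - 1" "1 - x \<le> int N - 1 - c"
    using z(1) by (auto simp: mem_triangle)
  define R where "R = nat ((c + int N - 1 - x - 1) div 2)"
  define L where "L = nat ((int N - 1 - c + x - 1) div 2)"
  have i: "2 * int R = c + int N - 2 - x" "2 * int L = int N - 2 - c + x"
    unfolding R_def L_def using x odd by (auto; presburger)+
  have RL: "R \<le> N" "L \<le> N" "R + L + 2 = N" using i x by linarith+
  let ?e1 = "\<lambda>k. diag_card a 1 (x + (1 + 2 * int k)) / (real k)\<^sup>2"
  let ?e2 = "\<lambda>k. diag_card a (- 1) (x + - (1 + 2 * int k)) / (real k)\<^sup>2"
  note r1 = bottom_ratio_le[OF a x(1) z(2), of 1, simplified]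
  note r2 = bottom_ratio_le[OF a x(1) z(2), of "- 1", simplified]
  let ?PR = "\<Prod>k = 1..R. hook_ratio a (x + int k, 1 + int k)"
  let ?PL = "\<Prod>k = 1..L. hook_ratio a (x - int k, 1 + int k)"
  have bound: "(\<Prod>k = 1..m. g k) \<le> sqrt (2 * real m + 1) * exp (\<Sum>k = 1..N. e k)"
    if g: "\<And>k. 1 \<le> k \<Longrightarrow> g k \<le> (1 + 1 / (2 * real k)) * exp (e k)" and g0: "\<And>k. 1 \<le> k \<Longrightarrow> 0 \<le> g k"
      and m: "m \<le> N" and e: "\<And>k. 0 \<le> e k" for g e :: "nat \<Rightarrow> real" and m
  proof -
    have "(\<Prod>k = 1..m. g k) \<le> (\<Prod>k = 1..m. (1 + 1 / (2 * real k)) * exp (e k))"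
      using g g0 by (intro prod_mono) auto
    also have "\<dots> = (\<Prod>k = 1..m. 1 + 1 / (2 * real k)) * exp (\<Sum>k = 1..m. e k)"
      by (simp add: prod.distrib exp_sum)
    also have "\<dots> \<le> sqrt (2 * real m + 1) * exp (\<Sum>k = 1..N. e k)"
      using m e by (intro mult_mono prod_half_le) (auto intro!: sum_mono2 simp: prod_nonneg)
    finally show ?thesis .
  qed
  have PR: "?PR \<le> sqrt (2 * real R + 1) * exp (\<Sum>k = 1..N. ?e1 k)"
    by (rule bound) (use r1 RL in \<open>auto simp: diag_card_def intro: order_trans[OF zero_le_one]\<close>)
  have PL: "?PL \<le> sqrt (2 * real L + 1) * exp (\<Sum>k = 1..N. ?e2 k)"
    by (rule bound) (use r2 RL in \<open>auto simp: diag_card_def intro: order_trans[OF zero_le_one]\<close>)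
  have PL0: "0 \<le> ?PL" using r2 by (intro prod_nonneg) (auto intro: order_trans[OF zero_le_one])
  have "?PR * ?PL \<le> (sqrt (2 * real R + 1) * exp (\<Sum>k = 1..N. ?e1 k)) * (sqrt (2 * real L + 1)
    * exp (\<Sum>k = 1..N. ?e2 k))"
    using PL0 by (intro mult_mono PR PL) auto
  also have "\<dots> = sqrt ((2 * real R + 1) * (2 * real L + 1)) * exp (diag_load N x a)"
    by (simp add: real_sqrt_mult diag_load_def add_divide_distrib sum.distrib exp_add mult_ac)
  also have "\<dots> \<le> real N * exp M"
  proof (intro mult_mono)
    have "sqrt ((2 * real R + 1) * (2 * real L + 1)) \<le> (2 * real R + 1 + (2 * real L + 1)) / 2"
      by (intro arith_geo_mean_sqrt) auto
    also have "\<dots> \<le> real N" unfolding RL(3)[symmetric] by simp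
    finally show "sqrt ((2 * real R + 1) * (2 * real L + 1)) \<le> real N" .
  qed (use load in auto)
  finally have P: "?PR * ?PL \<le> real N * exp M" .
  define A where "A = real (card (triangle c N - a))"
  have "A = real (card (triangle c N)) - real (card a)"
    unfolding A_def using finite_triangle[of c N] tableau_statesD(1)[OF a] state_finite[OF a]
    by (subst card_Diff_subset) (auto simp: of_nat_diff card_mono)
  \<comment> \<open>For \<open>2 \<le> N\<close> the triangle has at least
    \<open>N\<^sup>2 / 4\<close> points, so at least \<open>N\<^sup>2 / 8\<close> remain. This is
    the source of the constant 8 in the rate.\<close>
  then have "real N * (real N - 1) / 2 - (real N)\<^sup>2 / 8 \<le> A"
    using card real_card_triangle[OF odd] N by simp
  moreover have "2 * real N \<le> real N * real N" using N by (intro mult_right_mono) auto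
  ultimately have A: "(real N)\<^sup>2 / 8 \<le> A" by (simp add: power2_eq_square algebra_simps)
  have N0: "0 < (real N)\<^sup>2" using N by simp
  then have A0: "0 < A" using A by linarith
  show ?thesis
  proof (cases "corner (triangle c N - a) (x, 1)")
    case False
    then show ?thesis by (simp add: tab_rate_def)
  next
    case True
    have "hook_prob (triangle c N - a) (x, 1) = 1 / A * (?PR * ?PL)"
      using a z unfolding A_def R_def L_def
      by (subst hook_prob_eq) (simp_all add: prod_up_hook)
    also have "\<dots> \<le> 1 / A * (real N * exp M)"
      using A0 by (intro mult_left_mono P) auto
    also have "\<dots> \<le> 1 / ((real N)\<^sup>2 / 8) * (real N * exp M)"
      by (intro mult_right_mono divide_left_mono A mult_pos_pos A0) (use N0 in auto)
    also have "\<dots> = 8 * exp M / real N" using N by (simp add: power2_eq_square)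
    finally have "real N * hook_prob (triangle c N - a) (x, 1) \<le> real N * (8 * exp M / real N)"
      by (rule mult_left_mono) simp
    then show ?thesis using True N by (simp add: tab_rate_def)
  qed
qed

section \<open>Averaging the load over the bottom row\<close>

lemma sum_diag_card_le:
  assumes "finite a" "finite W"
  shows "(\<Sum>x\<in>W. diag_card a \<sigma> (x + s)) \<le> real (card a)"
proof -
  have "(\<Sum>x\<in>W. diag_card a \<sigma> (x + s)) = (\<Sum>x\<in>W. \<Sum>w\<in>a. of_bool (fst w + \<sigma> * snd w = x + s))"
    unfolding diag_card_def using assms by (intro sum.cong) (simp_all add: Int_def)
  also have "\<dots> = (\<Sum>w\<in>a. \<Sum>x\<in>W. of_bool (fst w + \<sigma> * snd w = x + s))" by (rule sum.swap)
  also have "\<dots> \<le> (\<Sum>w\<in>a. 1)"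
  proof (rule sum_mono)
    fix w :: point
    have "(\<Sum>x\<in>W. of_bool (fst w + \<sigma> * snd w = x + s)) = (\<Sum>x\<in>W. if x = fst w + \<sigma> * snd w
      - s then 1 else 0 :: real)"
      by (intro sum.cong) (auto simp: of_bool_def)
    then show "(\<Sum>x\<in>W. of_bool (fst w + \<sigma> * snd w = x + s)) \<le> (1 :: real)" using assms by simp
  qed
  finally show ?thesis by simp
qed

lemma sum_inverse_squares_le: "(\<Sum>k = 1..N. 1 / (real k)\<^sup>2) \<le> 2"
proof -
  have "(\<Sum>k = 1..N. 1 / (real k)\<^sup>2) \<le> 2 - 1 / real N" if "1 \<le> N" for N
    using that
  proof (induction N rule: dec_induct)
    case (step N)
    have "1 / (real (Suc N))\<^sup>2 \<le> 1 / (real N * real (Suc N))"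
      unfolding power2_eq_square using step by (intro divide_left_mono mult_right_mono) auto
    also have "\<dots> = 1 / real N - 1 / real (Suc N)" using step by (simp add: field_simps)
    finally show ?case using step.IH by simp
  qed simp
  from this[of N] show ?thesis by (cases "1 \<le> N") (auto intro: order_trans)
qed

text \<open>For fixed \<open>k\<close> and direction each included point is counted for at most one
  \<open>x\<close>. The constant is the two directions times the bound 2 for the sum of inverse
  squares.\<close>

lemma sum_diag_load_le:
  assumes "finite a" "finite W"
  shows "(\<Sum>x\<in>W. diag_load N x a) \<le> 4 * real (card a)"
proof -
  have "(\<Sum>x\<in>W. diag_load N x a) = (\<Sum>k = 1..N. \<Sum>x\<in>W.
     (diag_card a 1 (x + (1 + 2 * int k)) + diag_card a (- 1) (x + - (1 + 2 * int k))) /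
       (real k)\<^sup>2)"
    unfolding diag_load_def by (rule sum.swap)
  also have "\<dots> \<le> (\<Sum>k = 1..N. (2 * real (card a)) * (1 / (real k)\<^sup>2))"
    unfolding sum_divide_distrib[symmetric] sum.distrib times_divide_eq_right mult_1_right
    using sum_diag_card_le[OF assms] unfolding mult_2 by
      (intro sum_mono divide_right_mono add_mono) auto
  also have "\<dots> \<le> 2 * real (card a) * 2"
    unfolding sum_distrib_left[symmetric] by (intro mult_left_mono sum_inverse_squares_le) auto
  finally show ?thesis by simp
qed

lemma diag_load_mono:
  assumes "finite b" "a \<subseteq> b"
  shows "diag_load N x a \<le> diag_load N x b"
  unfolding diag_load_def diag_card_def
  using assms by (intro sum_mono divide_right_mono add_mono) (auto intro!: card_mono)

lemma diag_load_nonneg: "0 \<le> diag_load N x a"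
  unfolding diag_load_def by (intro sum_nonneg) (auto simp: diag_card_def)

text \<open>The load at a prescribed \<open>x\<close> is not controlled, but its average over many
  candidates is; the point obtained is therefore only known to lie near the centre.\<close>

lemma bottom_survival:
  assumes odd: "odd (c + int N)" and t: "0 \<le> t" and N: "24 \<le> N" "32 * t \<le> real N"
  obtains x where "odd x" "real_of_int \<bar>x - c\<bar> \<le> real N / 4" "(x, 1) \<in> triangle c N"
    "exp (- (8 * exp (256 * t + 1)) * t) / 2 \<le> tab_flow c N t (\<lambda>a. of_bool ((x, 1) \<notin> a)) {}"
proof -
  interpret G: growth "tableau_states c N" "triangle c N" "tab_rate c N"
    by (rule growth_tab)
  \<comment> \<open>At least \<open>N / 16\<close> candidates share a total expected load of at most
    \<open>4 * N * t\<close>, so some expected load is at most \<open>64 * t\<close>;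
    \<open>8 * m \<le> N\<close> keeps all candidates within \<open>N / 4\<close> of the
    centre.\<close>
  define m where "m = N div 16 + 1"
  define x0 where "x0 = (if odd c then c else c + 1)"
  define W where "W = (\<lambda>j. x0 + 2 * int j) ` {0..<m}"
  have W: "finite W" "card W = m" unfolding W_def by (auto simp: card_image inj_on_def)
  have m: "real N / 16 \<le> real m" "0 < real m" "8 * m \<le> N" 
  proof -
    define q where "q = N div 16"
    have q: "1 \<le> q" "16 * q \<le> N" "N < 16 * q + 16" using N by (simp_all add: q_def)
    show "real N / 16 \<le> real m" "0 < real m" "8 * m \<le> N"
      unfolding m_def q_def[symmetric] using q by simp_all
  qed
  have xW: "odd x \<and> \<bar>x - c\<bar> \<le> 2 * int m" if "x \<in> W" for x
  proof -
    have "odd x0" "\<bar>x0 - c\<bar> \<le> 1" by (simp_all add: x0_def)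
    then show ?thesis using that by (auto simp: W_def)
  qed
  let ?S = "\<lambda>x. G.flow t (diag_load N x) {}"
  have "(\<Sum>x\<in>W. ?S x) = G.flow t (\<lambda>a. \<Sum>x\<in>W. 1 * diag_load N x a) {}"
    by (subst G.flow_sum) simp_all
  also have "\<dots> \<le> G.flow t (\<lambda>a. 4 * real (card a)) {}"
    using sum_diag_load_le[OF state_finite W(1)] t by (intro G.flow_mono) auto
  also have "\<dots> = 4 * G.flow t (\<lambda>a. real (card a)) {}" by (rule G.flow_cmult) simp
  also have "\<dots> \<le> 4 * (real N * t)" using tab_flow_card[OF odd t] by simp
  finally have sum: "(\<Sum>x\<in>W. ?S x) \<le> 4 * (real N * t)" .
  have "\<exists>x\<in>W. ?S x \<le> 64 * t"
  proof (rule ccontr)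
    assume "\<not> ?thesis"
    then have "(\<Sum>x\<in>W. 64 * t) < (\<Sum>x\<in>W. ?S x)"
      using W m by (intro sum_strict_mono) auto
    moreover have "(\<Sum>x\<in>W. 64 * t) = real m * (64 * t)" using W by simp
    ultimately have "real m * (64 * t) < 4 * (real N * t)" using sum by linarith
    moreover have "(real N / 16) * (64 * t) \<le> real m * (64 * t)"
      using m t by (intro mult_right_mono) auto
    ultimately show False by simp
  qed
  then obtain x where x: "x \<in> W" "?S x \<le> 64 * t" by blast
  have x': "odd x" "\<bar>x - c\<bar> \<le> 2 * int m" using xW[OF x(1)] by auto
  have near: "real_of_int \<bar>x - c\<bar> \<le> real N / 4" using x'(2) m(3) by linarith
  have xT: "(x, 1) \<in> triangle c N" using x' m(3) N by (auto simp: mem_triangle)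
  \<comment> \<open>Markov's inequality gives each of the two bad events probability at most 1/4:
    the load has mean at most \<open>64 * t\<close>, and the number of points has mean at most
    \<open>N * t\<close> with \<open>32 * t \<le> N\<close>.\<close>
  define M where "M = 256 * t + 1"
  define B where "B a \<longleftrightarrow> M < diag_load N x a \<or> (real N)\<^sup>2 / 8 < real (card a)" for a
  have M: "0 < M" using t by (simp add: M_def)
  have N0: "0 < real N" using N by simp
  have "G.flow t (\<lambda>b. of_bool (B b)) {}
      \<le> G.flow t (\<lambda>b. \<Sum>i\<in>{True, False}. (if i then 1 / M else 8 / (real N)\<^sup>2) *
        (if i then diag_load N x b else real (card b))) {}"
  proof (rule G.flow_mono)
    fix b
    have 0: "0 \<le> diag_load N x b / M" "0 \<le> real (card b) * 8 / (real N)\<^sup>2"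
      using diag_load_nonneg M by simp_all
    have load: "1 \<le> diag_load N x b / M" if "M < diag_load N x b" using that M by simp
    have size: "1 \<le> real (card b) * 8 / (real N)\<^sup>2" if "(real N)\<^sup>2 / 8 < real (card b)"
      using that N0 by (simp add: pos_le_divide_eq)
    have "of_bool (B b) \<le> diag_load N x b / M + real (card b) * 8 / (real N)\<^sup>2"
    proof (cases "B b")
      case True
      then consider "M < diag_load N x b" | "(real N)\<^sup>2 / 8 < real (card b)" by (auto simp: B_def)
      then show ?thesis
      proof cases
        case 1
        have "of_bool (B b) = (1 :: real)" using True by simp
        then show ?thesis using load[OF 1] 0 by linarith
      next
        case 2
        have "of_bool (B b) = (1 :: real)" using True by simp
        then show ?thesis using size[OF 2] 0 by linarith
      qed
    qed (use 0 in simp)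
    then show "of_bool (B b) \<le> (\<Sum>i\<in>{True, False}. (if i then 1 / M else 8 / (real N)\<^sup>2) *
      (if i then diag_load N x b else real (card b)))"
      by (simp add: mult.commute)
  qed (use t in auto)
  also have "\<dots> = 1 / M * ?S x + 8 / (real N)\<^sup>2 * G.flow t (\<lambda>b. real (card b)) {}"
    by (subst G.flow_sum) simp_all
  also have "\<dots> \<le> 1 / M * (64 * t) + 8 / (real N)\<^sup>2 * (real N * t)"
    using M x(2) tab_flow_card[OF odd t] by (intro add_mono mult_left_mono) auto
  also have "\<dots> \<le> 1 / 4 + 1 / 4"
  proof (intro add_mono)
    show "1 / M * (64 * t) \<le> 1 / 4" using M by (simp add: M_def divide_simps)
    show "8 / (real N)\<^sup>2 * (real N * t) \<le> 1 / 4"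
      using N N0 by (simp add: power2_eq_square divide_simps)
  qed
  finally have bad: "G.flow t (\<lambda>b. of_bool (B b)) {} \<le> 1 / 2" by simp
  let ?R = "8 * exp M"
  have surv: "of_bool ((x, 1) \<notin> ({} :: point set)) * exp (- ?R * t) * (1 - G.flow t (\<lambda>b. of_bool
    (B b)) {})
      \<le> G.flow t (\<lambda>b. of_bool ((x, 1) \<notin> b)) {}"
  proof (rule G.survival)
    show "attractive (tableau_states c N) (triangle c N) (tab_rate c N)"
      by (rule attractive_tab)
    show "B b" if "B a" "finite b" "a \<subseteq> b" for a b
      using that diag_load_mono[OF that(2,3), of N x] card_mono[OF that(2,3)] unfolding B_def
        by linarith
    show "tab_rate c N a (x, 1) \<le> ?R"
      if "a \<in> tableau_states c N" "(x, 1) \<notin> a" "\<not> B a" for a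
      using that xT odd N by (intro bottom_rate_le) (auto simp: B_def)
  qed (use t xT in auto)
  have "exp (- ?R * t) * (1 / 2) \<le> exp (- ?R * t) * (1 - G.flow t (\<lambda>b. of_bool (B b)) {})"
    using bad by (intro mult_left_mono) auto
  also have "\<dots> \<le> G.flow t (\<lambda>b. of_bool ((x, 1) \<notin> b)) {}"
    using surv by simp
  finally have "exp (- ?R * t) / 2 \<le> G.flow t (\<lambda>b. of_bool ((x, 1) \<notin> b)) {}" by simp
  then show ?thesis using that[OF x'(1) near xT] unfolding M_def by simp
qed


section \<open>The tableau process and its inclusion function\<close>

lemma generator_power_eq:
  "generator_power S q k a b = (mat_op S (generator S q) ^^ k) (\<lambda>u. of_bool (u = b)) a"
  by (induction k arbitrary: a) (auto simp: mat_op_def[of S "generator S q" "(_ ^^ _) _"])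

lemma transition_prob_eq:
  "transition_prob S q t a b = mat_flow S (generator S q) t (\<lambda>u. of_bool (u = b)) a"
  unfolding transition_prob_def mat_flow_def generator_power_eq by (simp add: mult.commute)

lemma mat_op_tableau_generator:
  assumes a: "a \<in> tableau_states c n"
  shows "mat_op (tableau_states c n) (generator (tableau_states c n) (tableau_rate c n
    (real n))) f a
    = growth_gen (triangle c n) (tab_rate c n) f a"
proof -
  let ?S = "tableau_states c n" and ?T = "triangle c n" and ?q = "tableau_rate c n (real n)"
  interpret G: growth ?S ?T "tab_rate c n" by (rule growth_tab)
  note fin = G.finite_states
  have q: "?q a b = (\<Sum>z\<in>?T. tab_rate c n a z * of_bool (b = insert z a))" for b
  proof -
    have "(\<Sum>z\<in>?T. tab_rate c n a z * of_bool (b = insert z a))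
        = (\<Sum>z | corner (?T - a) z \<and> b = insert z a. tab_rate c n a z * of_bool (b = insert z a))"
      using finite_triangle by (intro sum.mono_neutral_right)
        (auto simp: corner_triangle tab_rate_def)
    also have "\<dots> = ?q a b"
      unfolding tableau_rate_def by (intro sum.cong) (auto simp: tab_rate_def)
    finally show ?thesis ..
  qed
  have "mat_op ?S (generator ?S ?q) f a
      = generator ?S ?q a a * f a + (\<Sum>b\<in>?S - {a}. generator ?S ?q a b * f b)"
    unfolding mat_op_def by (rule sum.remove[OF fin a])
  also have "(\<Sum>b\<in>?S - {a}. generator ?S ?q a b * f b) = (\<Sum>b\<in>?S - {a}. ?q a b * f b)"
    by (intro sum.cong) (auto simp: generator_def)
  also have "generator ?S ?q a a * f a = (\<Sum>b\<in>?S - {a}. - ?q a b * f a)"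
    by (simp add: generator_def sum_distrib_right sum_negf)
  also have "(\<Sum>b\<in>?S - {a}. - ?q a b * f a) + (\<Sum>b\<in>?S - {a}. ?q a b * f b)
      = (\<Sum>b\<in>?S - {a}. \<Sum>z\<in>?T. tab_rate c n a z * (of_bool (b = insert z a) * (f b - f a)))"
  proof -
    have "- Q * f a + Q * f b = Q * (f b - f a)" for Q b by (simp add: algebra_simps)
    then have e: "- ?q a b * f a + ?q a b * f b = ?q a b * (f b - f a)" for b .
    show ?thesis unfolding sum.distrib[symmetric] e unfolding q sum_distrib_right mult.assoc ..
  qed
  also have "\<dots> = (\<Sum>z\<in>?T. \<Sum>b\<in>?S - {a}. tab_rate c n a z * (of_bool (b = insert z a) * (f b - f a)))"
    by (rule sum.swap)
  also have "\<dots> = growth_gen ?T (tab_rate c n) f a"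
    unfolding growth_gen_def
  proof (rule sum.cong[OF refl])
    fix z assume z: "z \<in> ?T"
    show "(\<Sum>b\<in>?S - {a}. tab_rate c n a z * (of_bool (b = insert z a) * (f b - f a)))
        = tab_rate c n a z * (f (insert z a) - f a)"
    proof (cases "tab_rate c n a z = 0")
      case False
      then have "insert z a \<in> ?S - {a}" using G.rate_closed[OF a z] by auto
      then have "(\<Sum>b\<in>?S - {a}. of_bool (b = insert z a) * (f b - f a)) = f (insert z a) - f a"
        using fin by (subst sum.remove[of _ "insert z a"]) (auto intro!: sum.neutral)
      then show ?thesis by (simp flip: sum_distrib_left)
    qed simp
  qed
  finally show ?thesis .
qed

lemma transition_prob_tableau:
  assumes a: "a \<in> tableau_states c n"
  shows "transition_prob (tableau_states c n) (tableau_rate c n (real n)) t a b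
    = tab_flow c n t (\<lambda>u. of_bool (u = b)) a"
proof -
  interpret G: growth "tableau_states c n" "triangle c n" "tab_rate c n" by (rule growth_tab)
  show ?thesis
    unfolding transition_prob_eq growth_flow_def
    by (rule mat_flow_cong_matrix[OF _ a]) (simp add: mat_op_tableau_generator G.mat_op_growth)
qed

section \<open>One-time distributions and paths of the Markov process\<close>

locale tableau = markov_jump_process M "tableau_states c n" "tableau_rate c n (real n)" "{}" X
  for c n M X
begin

sublocale G: growth "tableau_states c n" "triangle c n" "tab_rate c n"
  by (rule growth_tab)

lemma X_state: "0 \<le> t \<Longrightarrow> \<omega> \<in> space M \<Longrightarrow> X t \<omega> \<in> tableau_states c n"
  using measurable_space[OF measurable_process] by simp

lemma events_X: "0 \<le> t \<Longrightarrow> {\<omega> \<in> space M. Q (X t \<omega>)} \<in> events"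
proof -
  assume t: "0 \<le> t"
  have "{\<omega> \<in> space M. Q (X t \<omega>)} = X t -` {a \<in> tableau_states c n. Q a} \<inter> space M"
    using X_state[OF t] by auto
  then show ?thesis using measurable_sets[OF measurable_process[OF t], of "{a \<in> tableau_states c
    n. Q a}"] by simp
qed

lemma prob_two_times:
  assumes "0 \<le> s" "s < t" "a \<in> tableau_states c n" "b \<in> tableau_states c n"
  shows "prob {\<omega> \<in> space M. X s \<omega> = a \<and> X t \<omega> = b}
    = prob {\<omega> \<in> space M. X s \<omega> = a} * G.flow (t - s) (\<lambda>u. of_bool (u = b)) a"
proof -
  let ?s = "\<lambda>i::nat. if i = 0 then s else t" and ?a = "\<lambda>i::nat. if i = 0 then a else b"
  have "prob {\<omega> \<in> space M. \<forall>i\<le>Suc 0. X (?s i) \<omega> = ?a i} =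
       prob {\<omega> \<in> space M. \<forall>i\<le>0. X (?s i) \<omega> = ?a i} *
         transition_prob (tableau_states c n) (tableau_rate c n (real n)) (?s (Suc 0) - ?s 0)
           (?a 0) (?a (Suc 0))"
    by (rule markov) (use assms in auto)
  moreover have "(\<forall>i\<le>Suc 0. P i) \<longleftrightarrow> P 0 \<and> P (Suc 0)" for P by (auto simp: le_Suc_eq)
  ultimately show ?thesis by (simp add: transition_prob_tableau[OF assms(3)])
qed

lemma prob_state:
  assumes "0 < t" "b \<in> tableau_states c n"
  shows "prob {\<omega> \<in> space M. X t \<omega> = b} = G.flow t (\<lambda>u. of_bool (u = b)) {}"
proof -
  have "prob {\<omega> \<in> space M. X t \<omega> = b} = prob {\<omega> \<in> space M. X 0 \<omega> = {} \<and> X t \<omega> = b}"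
    using start assms events_X[of 0 "\<lambda>a. a = {}"] events_X[of t "\<lambda>a. a = b"]
    by (intro finite_measure_eq_AE) auto
  also have "\<dots> = prob {\<omega> \<in> space M. X 0 \<omega> = {}} * G.flow (t - 0) (\<lambda>u. of_bool (u = b)) {}"
    using assms by (intro prob_two_times) auto
  also have "prob {\<omega> \<in> space M. X 0 \<omega> = {}} = 1"
    using start by (intro prob_eq_1[THEN iffD2] events_X[of 0 "\<lambda>a. a = {}"]) auto
  finally show ?thesis by simp
qed

lemma prob_flow:
  assumes t: "0 < t"
  shows "prob {\<omega> \<in> space M. Q (X t \<omega>)} = G.flow t (\<lambda>a. of_bool (Q a)) {}"
proof -
  let ?S = "tableau_states c n"
  let ?SQ = "{a \<in> ?S. Q a}"
  have "{\<omega> \<in> space M. Q (X t \<omega>)} = (\<Union>a\<in>?SQ. {\<omega> \<in> space M. X t \<omega> = a})"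
    using X_state t by auto
  then have "prob {\<omega> \<in> space M. Q (X t \<omega>)} = (\<Sum>a\<in>?SQ. prob {\<omega> \<in> space M. X t \<omega> = a})"
    using G.finite_states t events_X
    by (simp, intro finite_measure_finite_Union) (auto simp: disjoint_family_on_def)
  also have "\<dots> = (\<Sum>a\<in>?SQ. 1 * G.flow t (\<lambda>u. of_bool (u = a)) {})"
    using t by (intro sum.cong) (auto simp: prob_state)
  also have "\<dots> = G.flow t (\<lambda>u. \<Sum>a\<in>?SQ. 1 * of_bool (u = a)) {}"
    by (rule G.flow_sum[symmetric]) simp
  also have "\<dots> = G.flow t (\<lambda>a. of_bool (Q a)) {}"
  proof (rule G.flow_cong)
    fix b assume b: "b \<in> ?S"
    have "(\<Sum>a\<in>?SQ. 1 * of_bool (b = a)) = (\<Sum>a\<in>?SQ. if b = a then 1 else 0 :: real)"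
      by (intro sum.cong) auto
    then show "(\<Sum>a\<in>?SQ. 1 * of_bool (b = a)) = (of_bool (Q b) :: real)"
      using G.finite_states b by simp
  qed simp
  finally show ?thesis .
qed

text \<open>Transitions from a state to one that does not contain it have probability 0, and there
  are only finitely many pairs of states. The exceptional set depends on the two times.\<close>

lemma increasing_paths:
  assumes "0 \<le> s" "s < t"
  shows "AE \<omega> in M. X s \<omega> \<subseteq> X t \<omega>"
proof -
  let ?S = "tableau_states c n"
  have "AE \<omega> in M. \<not> (X s \<omega> = a \<and> X t \<omega> = b)" if ab: "a \<in> ?S" "b \<in> ?S" "\<not> a \<subseteq> b" for a b
  proof -
    have "G.flow (t - s) (\<lambda>u. of_bool (u = b)) a = 0"
      by (rule G.flow_supported[where U = "{u. a \<subseteq> u}"]) (use ab in auto)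
    then have "prob {\<omega> \<in> space M. X s \<omega> = a \<and> X t \<omega> = b} = 0"
      using prob_two_times[OF assms ab(1,2)] by simp
    moreover have "{\<omega> \<in> space M. X s \<omega> = a \<and> X t \<omega> = b} \<in> events"
    proof -
      have "{\<omega> \<in> space M. X s \<omega> = a \<and> X t \<omega> = b}
          = {\<omega> \<in> space M. X s \<omega> = a} \<inter> {\<omega> \<in> space M. X t \<omega> = b}" by auto
      then show ?thesis using events_X[of s "\<lambda>u. u = a"] events_X[of t "\<lambda>u. u = b"] assms by auto
    qed
    ultimately have "{\<omega> \<in> space M. X s \<omega> = a \<and> X t \<omega> = b} \<in> null_sets M"
      by (simp add: emeasure_eq_measure null_setsI)
    from AE_not_in[OF this] show ?thesis by (rule AE_mp) (auto intro!: AE_I2)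
  qed
  then have "AE \<omega> in M. \<forall>a\<in>?S. \<forall>b\<in>?S. \<not> a \<subseteq> b \<longrightarrow> \<not> (X s \<omega> = a \<and> X t \<omega> = b)"
    using G.finite_states by (intro AE_finite_allI) auto
  then show ?thesis
  proof (rule AE_mp, intro AE_I2 impI)
    fix \<omega> assume \<omega>: "\<omega> \<in> space M"
      and "\<forall>a\<in>?S. \<forall>b\<in>?S. \<not> a \<subseteq> b \<longrightarrow> \<not> (X s \<omega> = a \<and> X t \<omega> = b)"
    moreover have "X s \<omega> \<in> ?S" "X t \<omega> \<in> ?S" using X_state[OF _ \<omega>] assms by simp_all
    ultimately show "X s \<omega> \<subseteq> X t \<omega>" by blast
  qed
qed

abbreviation "incl z \<omega> \<equiv> inclusion_function (\<lambda>s. X s \<omega>) z"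

lemma incl_le: "0 \<le> t \<Longrightarrow> z \<in> X t \<omega> \<Longrightarrow> incl z \<omega> \<le> ennreal t"
  unfolding inclusion_function_def by (rule INF_lower2[of t]) auto

text \<open>Right continuity moves the witnessing time to a rational one, so that monotonicity of
  the paths is used for countably many times only.\<close>

lemma incl_less_rational:
  assumes \<omega>: "\<omega> \<in> space M" and less: "incl z \<omega> < ennreal t"
  shows "\<exists>u\<in>\<rat>. 0 \<le> u \<and> u < t \<and> z \<in> X u \<omega>"
proof -
  obtain s where s: "0 \<le> s" "z \<in> X s \<omega>" "ennreal s < ennreal t"
    using less unfolding inclusion_function_def INF_less_iff by auto
  then have st: "s < t" by (simp add: ennreal_less_iff)
  from right_continuous[OF \<omega> s(1)] obtain b where b: "s < b" "\<And>u. s < u \<Longrightarrow> u < b \<Longrightarrow> X u \<omega> = X s \<omega>"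
    unfolding eventually_at_right_field by blast
  obtain u where u: "u \<in> \<rat>" "s < u" "u < min b t"
    using Rats_dense_in_real[of s "min b t"] b(1) st by auto
  then have "X u \<omega> = X s \<omega>" using b(2)[of u] by simp
  then show ?thesis using u s by (intro bexI[of _ u]) auto
qed

lemma incl_less_imp_mem:
  assumes t: "0 < t"
  shows "AE \<omega> in M. \<forall>z. incl z \<omega> < ennreal t \<longrightarrow> z \<in> X t \<omega>"
proof -
  have "AE \<omega> in M. \<forall>u\<in>\<rat>. 0 \<le> u \<and> u < t \<longrightarrow> X u \<omega> \<subseteq> X t \<omega>"
    using increasing_paths by (subst AE_ball_countable[OF countable_rat]) auto
  then show ?thesis
    by (rule AE_mp) (intro AE_I2 impI allI, use incl_less_rational in blast)
qed

text \<open>The infimum over all times agrees with the one over rational times, which is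
  countable.\<close>

lemma incl_measurable: "incl z \<in> borel_measurable M"
proof -
  let ?Q = "{u::real. u \<in> \<rat> \<and> 0 \<le> u}"
  let ?h = "\<lambda>\<omega>. INF u\<in>?Q. if z \<in> X u \<omega> then ennreal u else \<infinity>"
  have cQ: "countable ?Q" using countable_rat by (rule countable_subset[rotated]) auto
  have "?h \<in> borel_measurable M"
  proof (rule borel_measurable_INF[OF cQ])
    fix u assume "u \<in> ?Q"
    then show "(\<lambda>\<omega>. if z \<in> X u \<omega> then ennreal u else \<infinity>) \<in> borel_measurable M"
      using events_X[of u "\<lambda>a. z \<in> a"] by (intro measurable_If) auto
  qed
  moreover have "?h \<omega> = incl z \<omega>" if \<omega>: "\<omega> \<in> space M" for \<omega>
  proof (rule antisym)
    show "incl z \<omega> \<le> ?h \<omega>" by (rule INF_greatest) (auto intro: incl_le)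
    show "?h \<omega> \<le> incl z \<omega>"
    proof (rule ccontr)
      assume "\<not> ?h \<omega> \<le> incl z \<omega>"
      then have less: "incl z \<omega> < ?h \<omega>" by simp
      then obtain v where v: "incl z \<omega> < v" "v < ?h \<omega>" using dense by blast
      then obtain t where t: "0 \<le> t" "v = ennreal t" by (cases v) auto
      then obtain u where u: "u \<in> \<rat>" "0 \<le> u" "u < t" "z \<in> X u \<omega>"
        using incl_less_rational[OF \<omega>, of z t] v by auto
      have "?h \<omega> \<le> (if z \<in> X u \<omega> then ennreal u else \<infinity>)" using u by (intro INF_lower) auto
      then have "?h \<omega> \<le> v" using u t by (simp add: order_trans[OF _ ennreal_leI])
      then show False using v by simp
    qed
  qed
  ultimately show ?thesis by (simp cong: measurable_cong)
qed

end

section \<open>Consequences of convergence in distribution\<close>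

text \<open>A continuous substitute for the indicator of inclusion, equal to 1 up to
  \<open>s\<close> and to 0 from \<open>s'\<close> on. The inner \<open>min\<close> is essential at
  infinity, which \<open>enn2real\<close> would otherwise send to 0, giving the value 1 when
  \<open>0 \<le> s\<close> and \<open>s < s'\<close>.\<close>

definition cutoff :: "real \<Rightarrow> real \<Rightarrow> ennreal \<Rightarrow> real" where
  "cutoff s s' u = max 0 (min 1 ((s' - enn2real (min u (ennreal s'))) / (s' - s)))"

lemma cutoff_bounds: "0 \<le> cutoff s s' u" "cutoff s s' u \<le> 1"
  by (auto simp: cutoff_def)

lemma cutoff_eq_1:
  assumes "0 \<le> s" "s < s'" "u \<le> ennreal s"
  shows "cutoff s s' u = 1"
proof -
  have "enn2real (min u (ennreal s')) \<le> enn2real (ennreal s)"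
    using assms by (intro enn2real_mono) (auto intro: min.coboundedI1)
  then have "1 \<le> (s' - enn2real (min u (ennreal s'))) / (s' - s)"
    using assms by (simp add: le_divide_eq)
  then show ?thesis by (simp add: cutoff_def)
qed

lemma cutoff_eq_0:
  assumes "0 \<le> s'" "ennreal s' \<le> u"
  shows "cutoff s s' u = 0"
  using assms by (simp add: cutoff_def min_absorb2)

lemma continuous_cutoff: "continuous_on UNIV (cutoff s s')"
proof -
  have "continuous_on UNIV (\<lambda>u. enn2real (min u (ennreal s')))"
    unfolding continuous_on_def
  proof
    fix u :: ennreal
    have "((\<lambda>u. min u (ennreal s')) \<longlongrightarrow> min u (ennreal s')) (at u within UNIV)"
      by (intro tendsto_min tendsto_ident_at tendsto_const)
    moreover have "min u (ennreal s') = ennreal (enn2real (min u (ennreal s')))"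
      by (rule ennreal_enn2real[symmetric]) (simp add: min_less_iff_disj)
    ultimately show "((\<lambda>u. enn2real (min u (ennreal s'))) \<longlongrightarrow> enn2real (min u (ennreal s')))
      (at u within UNIV)"
      by (intro tendsto_enn2real) auto
  qed
  then show ?thesis unfolding cutoff_def[abs_def] divide_inverse by (intro continuous_intros)
qed

lemma cutoff_measurable [measurable]: "cutoff s s' \<in> borel_measurable borel"
  by (rule borel_measurable_continuous_onI[OF continuous_cutoff])

lemma cutoff_integral_bounds:
  fixes Y :: "'a \<Rightarrow> point \<Rightarrow> ennreal"
  assumes M: "prob_space M" and Z: "finite Z" and s: "0 < s" "s < s'"
    and meas: "\<And>z. z \<in> Z \<Longrightarrow> (\<lambda>\<omega>. Y \<omega> z) \<in> borel_measurable M" and A: "A \<in> sets M"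
  shows "(\<And>\<omega> z. \<omega> \<in> A \<Longrightarrow> z \<in> Z \<Longrightarrow> Y \<omega> z \<le> ennreal s) \<Longrightarrow>
      measure M A \<le> (\<integral>\<omega>. (\<Prod>z\<in>Z. cutoff s s' (Y \<omega> z)) \<partial>M)"
    and "AE \<omega> in M. (\<forall>z\<in>Z. Y \<omega> z < ennreal s') \<longrightarrow> \<omega> \<in> A \<Longrightarrow>
      (\<integral>\<omega>. (\<Prod>z\<in>Z. cutoff s s' (Y \<omega> z)) \<partial>M) \<le> measure M A"
proof -
  interpret prob_space M by (rule M)
  let ?g = "\<lambda>\<omega>. \<Prod>z\<in>Z. cutoff s s' (Y \<omega> z)"
  have bounds: "0 \<le> ?g \<omega>" "?g \<omega> \<le> 1" for \<omega>
    using cutoff_bounds by (auto intro: prod_nonneg prod_le_1)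
  have "?g \<in> borel_measurable M"
    using meas by (intro borel_measurable_prod measurable_compose[OF _ cutoff_measurable])
  then have int: "integrable M ?g"
    by (intro integrable_const_bound[where B = 1]) (use bounds in auto)
  have intA: "integrable M (indicator A :: _ \<Rightarrow> real)" and A_eq: "measure M A =
    (\<integral>\<omega>. indicator A \<omega> \<partial>M)"
    using A by (auto simp: emeasure_eq_measure)
  show "measure M A \<le> (\<integral>\<omega>. ?g \<omega> \<partial>M)" if *: "\<And>\<omega> z. \<omega> \<in> A \<Longrightarrow> z \<in> Z \<Longrightarrow> Y \<omega> z \<le> ennreal s"
    unfolding A_eq
  proof (rule integral_mono[OF intA int])
    show "indicator A \<omega> \<le> ?g \<omega>" for \<omega>
    proof (cases "\<omega> \<in> A")
      case True
      then have g: "?g \<omega> = 1" using s * by (intro prod.neutral) (auto intro!: cutoff_eq_1)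
      show ?thesis unfolding g by (simp add: indicator_def)
    qed (use bounds in simp)
  qed
  show "(\<integral>\<omega>. ?g \<omega> \<partial>M) \<le> measure M A" if "AE \<omega> in M. (\<forall>z\<in>Z. Y \<omega> z < ennreal s') \<longrightarrow> \<omega> \<in> A"
    unfolding A_eq
  proof (rule integral_mono_AE[OF int intA])
    show "AE \<omega> in M. ?g \<omega> \<le> indicator A \<omega>"
      using that
    proof eventually_elim
      case (elim \<omega>)
      show ?case
      proof (cases "\<omega> \<in> A")
        case False
        then obtain z where z: "z \<in> Z" "ennreal s' \<le> Y \<omega> z" using elim not_less by blast
        then have g: "?g \<omega> = 0" using Z s by (intro prod_zero)
          (auto intro!: bexI[of _ z] cutoff_eq_0)
        show ?thesis unfolding g by (simp add: indicator_def)
      qed (use bounds in simp)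
    qed
  qed
qed

text \<open>Convergence in distribution speaks about continuous functions only. The product of
  cutoffs lies between the indicators for the times \<open>s\<close> and \<open>s'\<close>, both for
  the processes and for the limit, so probabilities are compared at the price of a time gap.\<close>

lemma limit_comparison:
  fixes F :: "'a \<Rightarrow> point \<Rightarrow> real" and N :: "nat \<Rightarrow> 'b measure"
  assumes X: "\<And>n. 1 \<le> n \<Longrightarrow> tableau_process (c n) n (real n) (N n) (X n)"
    and M: "prob_space M"
    and meas: "\<And>z. z \<in> half_plane \<Longrightarrow> (\<lambda>\<omega>. F \<omega> z) \<in> borel_measurable M"
    and conv: "converges_in_distribution half_plane_functions N
      (\<lambda>n \<omega>. restrict (inclusion_function (\<lambda>s. X n s \<omega>)) half_plane)
      M (\<lambda>\<omega>. restrict (\<lambda>z. ennreal (F \<omega> z)) half_plane)"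
    and Z: "finite Z" "Z \<subseteq> half_plane" and s: "0 < s" "s < s'" and \<epsilon>: "0 < \<epsilon>"
  shows "\<forall>\<^sub>F n in sequentially.
      measure M {\<omega> \<in> space M. \<forall>z\<in>Z. F \<omega> z \<le> s} - \<epsilon>
        \<le> tab_flow (c n) n s' (\<lambda>a. of_bool (\<forall>z\<in>Z. z \<in> a)) {} \<and>
      tab_flow (c n) n s (\<lambda>a. of_bool (\<forall>z\<in>Z. z \<in> a)) {}
        \<le> measure M {\<omega> \<in> space M. \<forall>z\<in>Z. F \<omega> z \<le> s'} + \<epsilon>"
proof -
  let ?g = "\<lambda>h. \<Prod>z\<in>Z. cutoff s s' (h z)"
  let ?E = "\<integral>\<omega>. (\<Prod>z\<in>Z. cutoff s s' (ennreal (F \<omega> z))) \<partial>M"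
  have cont: "continuous_map half_plane_functions euclideanreal ?g"
  proof (rule continuous_map_prod[OF Z(1)])
    fix z assume "z \<in> Z"
    then have "continuous_map half_plane_functions euclidean (\<lambda>h. h z)"
      unfolding half_plane_functions_def using Z(2) by
        (intro continuous_map_product_projection) auto
    moreover have "continuous_map euclidean euclideanreal (cutoff s s')"
      using continuous_cutoff by simp
    ultimately have "continuous_map half_plane_functions euclideanreal (cutoff s s' \<circ> (\<lambda>h. h z))"
      by (rule continuous_map_compose)
    then show "continuous_map half_plane_functions euclideanreal (\<lambda>h. cutoff s s' (h z))"
      by (simp add: comp_def)
  qed
  have bdd: "bounded (?g ` topspace half_plane_functions)"
  proof (rule boundedI[where B = 1])
    fix y assume "y \<in> ?g ` topspace half_plane_functions"
    then obtain h where y: "y = ?g h" by blast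
    have "0 \<le> ?g h" "?g h \<le> 1" using cutoff_bounds by (auto intro: prod_nonneg prod_le_1)
    then show "norm y \<le> 1" by (simp add: y)
  qed
  have restr: "?g (restrict h half_plane) = ?g h" for h
    using Z(2) by (intro prod.cong) auto
  have "(\<lambda>n. \<integral>\<omega>. ?g (inclusion_function (\<lambda>s. X n s \<omega>)) \<partial>N n) \<longlonglongrightarrow> ?E"
    using conv[unfolded converges_in_distribution_def, rule_format, OF conjI[OF cont bdd]]
    unfolding restr .
  then have "\<forall>\<^sub>F n in sequentially. dist (\<integral>\<omega>. ?g (inclusion_function (\<lambda>s. X n s \<omega>)) \<partial>N n) ?E < \<epsilon>"
    using \<epsilon> by (rule tendstoD)
  moreover have "\<forall>\<^sub>F n in sequentially. 1 \<le> n" by (rule eventually_ge_at_top)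
  ultimately show ?thesis
  proof eventually_elim
    case (elim n)
    interpret tableau "c n" n "N n" "X n"
      using X[OF elim(2)] by (simp add: tableau_def tableau_process_def)
    let ?I = "\<integral>\<omega>. ?g (inclusion_function (\<lambda>s. X n s \<omega>)) \<partial>N n"
    have sets: "{\<omega> \<in> space (N n). \<forall>z\<in>Z. z \<in> X n u \<omega>} \<in> sets (N n)" if "0 < u" for u
      using that by (intro events_X[of u "\<lambda>a. \<forall>z\<in>Z. z \<in> a"]) simp
    note cutoff_X = cutoff_integral_bounds[where Y = "\<lambda>\<omega> z. incl z \<omega>", OF prob_space_axioms Z(1) s
      incl_measurable]
    have s': "0 < s'" using s by simp
    have "AE \<omega> in N n. (\<forall>z\<in>Z. incl z \<omega> < ennreal s') \<longrightarrow> \<omega> \<in> {\<omega> \<in> space (N n). \<forall>z\<in>Z. z \<in> X n s' \<omega>}"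
      using incl_less_imp_mem[OF s'] AE_space by eventually_elim blast
    then have X_bounds: "prob {\<omega> \<in> space (N n). \<forall>z\<in>Z. z \<in> X n s \<omega>} \<le> ?I"
        "?I \<le> prob {\<omega> \<in> space (N n). \<forall>z\<in>Z. z \<in> X n s' \<omega>}"
      using s by (intro cutoff_X sets; auto intro: incl_le)+
    have F: "{\<omega> \<in> space M. \<forall>z\<in>Z. F \<omega> z \<le> u} \<in> sets M" for u
    proof (rule sets.sets_Collect_finite_All[OF _ Z(1)])
      fix z assume "z \<in> Z"
      then have [measurable]: "(\<lambda>\<omega>. F \<omega> z) \<in> borel_measurable M" using meas Z(2) by blast
      show "{\<omega> \<in> space M. F \<omega> z \<le> u} \<in> sets M" by measurable
    qed
    have "(\<lambda>\<omega>. ennreal (F \<omega> z)) \<in> borel_measurable M" if "z \<in> Z" for z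
      using meas[of z] that Z(2) by (intro measurable_compose[OF _ measurable_ennreal]) auto
    note cutoff_F = cutoff_integral_bounds[where Y = "\<lambda>\<omega> z. ennreal (F \<omega> z)", OF M Z(1) s this]
    have "AE \<omega> in M. (\<forall>z\<in>Z. ennreal (F \<omega> z) < ennreal s') \<longrightarrow> \<omega> \<in> {\<omega> \<in> space M. \<forall>z\<in>Z. F \<omega> z \<le> s'}"
    proof (intro AE_I2 impI)
      fix \<omega> assume \<omega>: "\<omega> \<in> space M" and less: "\<forall>z\<in>Z. ennreal (F \<omega> z) < ennreal s'"
      have "F \<omega> z \<le> s'" if "z \<in> Z" for z
        using less that ennreal_leI[of s' "F \<omega> z"] by (meson leD le_cases)
      then show "\<omega> \<in> {\<omega> \<in> space M. \<forall>z\<in>Z. F \<omega> z \<le> s'}" using \<omega> by blast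
    qed
    then have "measure M {\<omega> \<in> space M. \<forall>z\<in>Z. F \<omega> z \<le> s} \<le> ?E" "?E
      \<le> measure M {\<omega> \<in> space M. \<forall>z\<in>Z. F \<omega> z \<le> s'}"
      using s by (intro cutoff_F F; auto intro: ennreal_leI)+
    then show ?case
      using X_bounds elim(1) unfolding dist_real_def
        prob_flow[OF s(1), of "\<lambda>a. \<forall>z\<in>Z. z \<in> a"] prob_flow[OF s', of "\<lambda>a. \<forall>z\<in>Z. z \<in> a"] by linarith
  qed
qed


section \<open>The bottom row of the limit\<close>

definition centre :: "nat \<Rightarrow> int" where
  "centre n = (if even n then 1 else 0)"

lemma odd_centre [simp]: "odd (centre n + int n)"
  by (simp add: centre_def)

lemma centre_bounds: "0 \<le> centre n" "centre n \<le> 1"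
  by (auto simp: centre_def)

lemma centre_smallo: "(\<lambda>n. real_of_int (centre n + d)) \<in> o(\<lambda>n. real n)"
proof -
  have "(\<lambda>n. real_of_int (centre n + d)) \<in> O(\<lambda>_. 1 :: real)"
    by (rule bigoI[where c = "1 + \<bar>real_of_int d\<bar>"]) (auto simp: centre_def)
  moreover have "(\<lambda>_. 1 :: real) \<in> o(\<lambda>n. real n)" by real_asymp
  ultimately show ?thesis by (rule landau_o.big_small_trans)
qed

definition bottom_prob :: "nat \<Rightarrow> real \<Rightarrow> real" where
  "bottom_prob n s = incl_prob (centre n) n s (1, 1)"

lemma bottom_prob_shift:
  assumes "odd x" "0 \<le> s"
  shows "incl_prob (centre n + (x - 1)) n s (x, 1) = bottom_prob n s"
proof -
  have "shift (x - 1) (1, 1) = (x, 1)" by (simp add: shift_def)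
  then show ?thesis
    using tab_flow_shift[of "x - 1" s "centre n" n "(1, 1)"] assms by (simp add: bottom_prob_def)
qed

text \<open>Survival is known for some point of a triangle of a much larger size. A small triangle
  placed around that point is dominated there, and translation brings the estimate back to
  \<open>(1, 1)\<close> in size \<open>n\<close>.\<close>

lemma bottom_prob_bound:
  assumes s: "0 < s"
  obtains \<delta> n0 where "0 < \<delta>" "\<And>n. n0 \<le> n \<Longrightarrow> bottom_prob n s \<le> 1 - \<delta>"
proof -
  \<comment> \<open>The slow-down factor 1/2 is compensated by doubling the time.\<close>
  define t where "t = 2 * s"
  have t: "0 < t" using s by (simp add: t_def)
  define \<kappa> where "\<kappa> = exp (- (8 * exp (256 * t + 1)) * t) / 2"
  have \<kappa>: "0 < \<kappa>" by (simp add: \<kappa>_def)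
  \<comment> \<open>Makes the stopping loss \<open>1 / 2 * t / K\<close> equal to half of the
    survival probability.\<close>
  define K where "K = t / \<kappa>"
  have K: "0 < K" using t \<kappa> by (simp add: K_def)
  have "(1 / 2 :: real) < sqrt (1 - (1 / 2)\<^sup>2)"
    by (rule real_less_rsqrt) (simp add: power2_eq_square)
  from slow_rate_comparison[OF K _ this] obtain n0 where n0:
    "\<And>n N c c' a z. n0 \<le> n \<Longrightarrow> odd (c + int N) \<Longrightarrow> odd (c' + int n) \<Longrightarrow>
     \<bar>c - c'\<bar> \<le> int N - int n \<Longrightarrow> real_of_int \<bar>c - c'\<bar> + real n \<le> 1 / 2 * (real N - 1) \<Longrightarrow>
     a \<in> tableau_states c N \<Longrightarrow> z \<in> triangle c' n \<Longrightarrow>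
     slow_rate (1 / 2) K c' n (a \<inter> triangle c' n) z \<le> tab_rate c N a z"
    by auto
  show ?thesis
  \<comment> \<open>Size 3 guarantees that \<open>(x, 1)\<close> lies in the small triangle although
    the centre of the latter may be off by one.\<close>
  proof (rule that[of "\<kappa> / 2" "max 3 n0"])
    fix n assume n: "max 3 n0 \<le> n"
    \<comment> \<open>With \<open>4 * n + 100 \<le> N\<close> the displacement
      \<open>N / 4 + 1\<close> plus the size \<open>n\<close> still fits into
      \<open>(N - 1) / 2\<close>.\<close>
    define N where "N = nat \<lceil>max (32 * t) (4 * real n + 100)\<rceil>"
    have N: "32 * t \<le> real N" "4 * real n + 100 \<le> real N" unfolding N_def by linarith+
    have N24: "24 \<le> N" using N(2) by linarith
    obtain x where x: "odd x" "real_of_int \<bar>x - centre N\<bar> \<le> real N / 4"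
      "(x, 1) \<in> triangle (centre N) N"
      and surv: "\<kappa> \<le> tab_flow (centre N) N t (\<lambda>a. of_bool ((x, 1) \<notin> a)) {}"
      unfolding \<kappa>_def by (rule bottom_survival[OF odd_centre less_imp_le[OF t] N24 N(1)])
    define c' where "c' = centre n + (x - 1)"
    have c': "\<bar>c' - x\<bar> \<le> 1" using centre_bounds[of n] by (simp add: c'_def)
    have oddc': "odd (c' + int n)"
    proof -
      have "c' + int n = (centre n + int n) + (x - 1)" by (simp add: c'_def)
      then show ?thesis using x(1) odd_centre[of n] by presburger
    qed
    have near: "real_of_int \<bar>centre N - c'\<bar> \<le> real N / 4 + 1" using c' x(2) by linarith
    then have near': "\<bar>centre N - c'\<bar> \<le> int N - int n" using N by linarith
    interpret D: disjoint_triangles "{()}" "centre N" N "\<lambda>_. c'" n "1 / 2" K t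
    proof
      show "slow_rate (1 / 2) K c' n (a \<inter> triangle c' n) z \<le> tab_rate (centre N) N a z"
        if "a \<in> tableau_states (centre N) N" "z \<in> triangle c' n" for a z
      proof (rule n0[OF _ odd_centre oddc' near' _ that])
        show "n0 \<le> n" using n by simp
        show "real_of_int \<bar>centre N - c'\<bar> + real n \<le> 1 / 2 * (real N - 1)"
        proof -
          have "y + real n \<le> 1 / 2 * (real N - 1)" if "y \<le> real N / 4 + 1" for y
            using that N(2) by (simp add: field_simps)
          then show ?thesis using near by blast
        qed
      qed
    qed (use t triangle_mono[OF near'] in auto)
    have p: "(x, 1) \<in> triangle c' n" using x(1) c' n by (auto simp: mem_triangle)
    have "incl_prob c' n (1 / 2 * t) (x, 1) - 1 / 2 * t / K
        \<le> slow_prob (1 / 2) K c' n t (x, 1)"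
      using n K t by (intro slow_flow_ge oddc') auto
    also have "\<dots> \<le> D.G.flow t (\<lambda>a. of_bool ((x, 1) \<in> a)) {}"
      using p by (intro D.slow_flow_le) auto
    also have "\<dots> = D.G.flow t (\<lambda>a. 1 - of_bool ((x, 1) \<notin> a)) {}"
      by (rule D.G.flow_cong) auto
    also have "\<dots> = 1 - D.G.flow t (\<lambda>a. of_bool ((x, 1) \<notin> a)) {}"
      using t by (simp add: D.G.flow_diff D.G.flow_const)
    also have "\<dots> \<le> 1 - \<kappa>" using surv by simp
    finally have "incl_prob c' n s (x, 1) \<le> 1 - \<kappa> / 2"
      using t \<kappa> by (simp add: K_def t_def)
    then show "bottom_prob n s \<le> 1 - \<kappa> / 2"
      unfolding c'_def using bottom_prob_shift[OF x(1), of s n] s by simp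
  qed (use \<kappa> in auto)
qed

text \<open>Pigeonhole: of more than \<open>1 / \<epsilon>\<close> equal steps, not all can raise a
  function with values in the unit interval by more than \<epsilon>. This replaces continuity of the
  distribution function.\<close>

lemma exists_small_increment:
  fixes \<Gamma> :: "real \<Rightarrow> real"
  assumes bounds: "\<And>s. 0 \<le> \<Gamma> s" "\<And>s. \<Gamma> s \<le> 1" and \<epsilon>: "0 < \<epsilon>"
  obtains s s' where "\<tau> \<le> s" "s < s'" "s' \<le> \<tau> + 1" "\<Gamma> s' - \<Gamma> s \<le> \<epsilon>"
proof -
  obtain J :: nat where J: "0 < J" "inverse (real J) < \<epsilon>" using ex_inverse_of_nat_less[OF \<epsilon>] by auto
  define g where "g j = \<Gamma> (\<tau> + real j / real J)" for j
  have "\<exists>j<J. g (Suc j) - g j \<le> \<epsilon>"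
  proof (rule ccontr)
    assume "\<not> ?thesis"
    then have "(\<Sum>j<J. \<epsilon>) < (\<Sum>j<J. g (Suc j) - g j)" using J by (intro sum_strict_mono) auto
    also have "\<dots> = g J - g 0" by (rule sum_lessThan_telescope)
    also have "\<dots> \<le> 1" using bounds(2)[of "\<tau> + real J / real J"] bounds(1)[of "\<tau>
      + real 0 / real J"] by (simp add: g_def)
    finally have "real J * \<epsilon> < 1" by simp
    then show False using J by (simp add: field_simps)
  qed
  then obtain j where j: "j < J" "g (Suc j) - g j \<le> \<epsilon>" by blast
  show ?thesis
  proof (rule that)
    show "\<Gamma> (\<tau> + real (Suc j) / real J) - \<Gamma> (\<tau> + real j / real J) \<le> \<epsilon>" using j by (simp add: g_def)
    show "\<tau> + real (Suc j) / real J \<le> \<tau> + 1" using j J by simp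
    show "\<tau> + real j / real J < \<tau> + real (Suc j) / real J" using J by
      (simp add: divide_strict_right_mono)
  qed simp
qed

theorem corollary5p6:
  fixes N :: "int \<Rightarrow> nat \<Rightarrow> 'b measure"
    and X :: "int \<Rightarrow> nat \<Rightarrow> real \<Rightarrow> 'b \<Rightarrow> point set"
    and M :: "'a measure"
    and F :: "'a \<Rightarrow> point \<Rightarrow> real"
    and t :: real
  assumes X: "\<And>c n. n \<ge> 1 \<Longrightarrow> odd (c + int n) \<Longrightarrow> tableau_process c n (real n) (N c n) (X c n)"
    and M: "prob_space M"
    and F_measurable: "\<And>z. z \<in> half_plane \<Longrightarrow> (\<lambda>\<omega>. F \<omega> z) \<in> borel_measurable M"
    and F_nonneg: "\<And>\<omega> z. \<omega> \<in> space M \<Longrightarrow> z \<in> half_plane \<Longrightarrow> 0 \<le> F \<omega> z"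
    and F_limit:
      "\<And>c :: nat \<Rightarrow> int.
         (\<And>n. n \<ge> 1 \<Longrightarrow> odd (c n + int n)) \<Longrightarrow>
         (\<lambda>n. real_of_int (c n)) \<in> o(\<lambda>n. real n) \<Longrightarrow>
         converges_in_distribution half_plane_functions
           (\<lambda>n. N (c n) n)
           (\<lambda>n \<omega>. restrict (inclusion_function (\<lambda>s. X (c n) n s \<omega>)) half_plane)
           M
           (\<lambda>\<omega>. restrict (\<lambda>z. ennreal (F \<omega> z)) half_plane)"
  shows "AE \<omega> in M.
           infinite {x :: int. x > 0 \<and> (x, 1) \<in> half_plane \<and> F \<omega> (x, 1) > t} \<and>
           infinite {x :: int. x < 0 \<and> (x, 1) \<in> half_plane \<and> F \<omega> (x, 1) > t}"
proof -
  interpret prob_space M by (rule M)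
  define G where "G Z s = prob {\<omega> \<in> space M. \<forall>z\<in>Z. F \<omega> z \<le> s}" for Z s
  define \<Gamma> where "\<Gamma> = G {(1, 1)}"
  have event: "{\<omega> \<in> space M. F \<omega> z \<le> s} \<in> events" if "z \<in> half_plane" for z s
  proof -
    note [measurable] = F_measurable[OF that]
    show ?thesis by measurable
  qed
  have limit: "\<forall>\<^sub>F n in sequentially.
      G Z s - \<epsilon> \<le> all_incl_prob (centre n + d) n s' Z \<and>
      all_incl_prob (centre n + d) n s Z \<le> G Z s' + \<epsilon>"
    if d: "even d" and Z: "finite Z" "Z \<subseteq> half_plane" and s: "0 < s" "s < s'" and \<epsilon>: "0 < \<epsilon>" for d
      Z s s' \<epsilon>
  proof -
    have odd: "odd (centre n + d + int n)" for n
    proof -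
      have "centre n + d + int n = (centre n + int n) + d" by simp
      then show ?thesis using d odd_centre[of n] by presburger
    qed
    have "converges_in_distribution half_plane_functions (\<lambda>n. N (centre n + d) n)
        (\<lambda>n \<omega>. restrict (inclusion_function (\<lambda>s. X (centre n + d) n s \<omega>)) half_plane)
        M (\<lambda>\<omega>. restrict (\<lambda>z. ennreal (F \<omega> z)) half_plane)"
      by (rule F_limit[OF odd centre_smallo])
    from limit_comparison[OF X[OF _ odd] M F_measurable this Z s \<epsilon>] show ?thesis
      unfolding G_def .
  qed
  have hp: "(x, 1) \<in> half_plane \<longleftrightarrow> odd x" for x by (simp add: mem_half_plane)
  have lower: "\<forall>\<^sub>F n in sequentially. \<Gamma> s - \<epsilon> \<le> bottom_prob n s'"
    if "0 < s" "s < s'" "0 < \<epsilon>" for s s' \<epsilon>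
    using limit[of 0 "{(1, 1)}" s s' \<epsilon>] that by (simp add: \<Gamma>_def bottom_prob_def hp
      eventually_conj_iff)
  have upper: "\<forall>\<^sub>F n in sequentially. incl_prob (centre n) n s (x, 1) \<le> \<Gamma> s' + \<epsilon>"
    if "odd x" "0 < s" "s < s'" "0 < \<epsilon>" for s s' \<epsilon> x
  proof -
    \<comment> \<open>Moving the point to \<open>(1, 1)\<close> moves the centre by a constant,
      which is still o(n); independence of the limit from the centres gives the same bound for all
      odd \<open>x\<close>.\<close>
    have "incl_prob (centre n) n s (x, 1)
        = incl_prob (centre n + (1 - x)) n s (1, 1)" for n
      using tab_flow_shift[of "1 - x" s "centre n" n "(x, 1)"] that by (simp add: shift_def)
    then show ?thesis
      using limit[of "1 - x" "{(1, 1)}" s s' \<epsilon>] that by (simp add: \<Gamma>_def hp eventually_conj_iff)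
  qed
  have \<Gamma>_less: "\<exists>\<delta>>0. \<Gamma> s \<le> 1 - \<delta>" if s: "0 < s" for s
  proof -
    obtain \<delta> n0 where \<delta>: "0 < \<delta>" "\<And>n. n0 \<le> n \<Longrightarrow> bottom_prob n (s + 1) \<le> 1 - \<delta>"
      using bottom_prob_bound[of "s + 1"] s by auto
    have "\<forall>\<^sub>F n in sequentially. \<Gamma> s - \<delta> / 2 \<le> bottom_prob n (s + 1) \<and> n0 \<le> n"
      using lower[of s "s + 1" "\<delta> / 2"] s \<delta>(1) by (intro eventually_conj eventually_ge_at_top) auto
    then obtain n where "\<Gamma> s - \<delta> / 2 \<le> bottom_prob n (s + 1)" "n0 \<le> n"
      using eventually_happens'[OF sequentially_bot] by blast
    then have "\<Gamma> s \<le> 1 - \<delta> / 2" using \<delta>(2)[of n] by linarith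
    then show ?thesis using \<delta>(1) by (intro exI[of _ "\<delta> / 2"]) simp
  qed
  \<comment> \<open>Infinitely many large values on one side fail exactly when, beyond some
    \<open>L\<close> in that direction, all values are at most \<open>t\<close>.\<close>
  define E where "E \<sigma> L = {\<omega> \<in> space M. \<forall>x\<in>{x. odd x \<and> int L < \<sigma> * x}. F \<omega> (x, 1)
    \<le> t}" for \<sigma> :: int and L :: nat
  have E_event: "E \<sigma> L \<in> events" for \<sigma> L
    unfolding E_def Ball_def
  proof (rule sets.sets_Collect_countable_All)
    fix x
    show "{\<omega> \<in> space M. x \<in> {x. odd x \<and> int L < \<sigma> * x} \<longrightarrow> F \<omega> (x, 1) \<le> t} \<in> events"
    proof (cases "odd x \<and> int L < \<sigma> * x")
      case True
      then show ?thesis using event[of "(x, 1)" t] by (simp add: hp)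
    next
      case False
      then show ?thesis by (simp only: mem_Collect_eq simp_thms) simp
    qed
  qed
  have small: "prob (E \<sigma> L) \<le> \<epsilon>" if \<sigma>: "\<sigma> = 1 \<or> \<sigma> = - 1" and \<epsilon>: "0 < \<epsilon>" for \<sigma> L \<epsilon>
  proof -
    \<comment> \<open>The given time may be zero or negative, while the process estimates need
      positive times.\<close>
    define \<tau> where "\<tau> = max t 1"
    have \<tau>: "0 < \<tau>" "t \<le> \<tau>" by (auto simp: \<tau>_def)
    obtain \<delta> where \<delta>: "0 < \<delta>" "\<Gamma> (\<tau> + 1) \<le> 1 - \<delta>" using \<Gamma>_less[of "\<tau> + 1"] \<tau> by auto
    have \<Gamma>_bounds: "0 \<le> \<Gamma> s" "\<Gamma> s \<le> 1" for s by (auto simp: \<Gamma>_def G_def)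
    have \<Gamma>_mono: "\<Gamma> s \<le> \<Gamma> s'" if "s \<le> s'" for s s'
      unfolding \<Gamma>_def G_def using that event[of "(1, 1)"] by (intro finite_measure_mono)
        (auto simp: hp)
    have \<delta>1: "\<delta> \<le> 1" using \<delta>(2) \<Gamma>_bounds(1)[of "\<tau> + 1"] by linarith
    obtain m0 where m0: "(1 - \<delta> / 2) ^ m0 < \<epsilon> / 2"
      using real_arch_pow_inv[of "\<epsilon> / 2" "1 - \<delta> / 2"] \<delta> \<epsilon> by auto
    define m where "m = Suc m0"
    have "(1 - \<delta> / 2) ^ m \<le> (1 - \<delta> / 2) ^ m0"
      using \<delta>(1) \<delta>1 by (intro power_decreasing) (auto simp: m_def)
    then have m: "0 < m" "(1 - \<delta> / 2) ^ m \<le> \<epsilon> / 2"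
      using m0 by (simp_all only: m_def zero_less_Suc)
    \<comment> \<open>The accumulated error below is \<open>4 * m * e + e\<close>, at most half of
      \<epsilon>; the bound by half of \<delta> keeps each factor of the product at most
      \<open>1 - \<delta> / 2\<close>.\<close>
    define e where "e = min (\<delta> / 2) (\<epsilon> / (10 * real m))"
    have e: "0 < e" "e \<le> \<delta> / 2" "10 * real m * e \<le> \<epsilon>"
      using \<delta>(1) \<epsilon> m(1) by (auto simp: e_def field_simps min_def)
    obtain t0 t2 where t02: "\<tau> \<le> t0" "t0 < t2" "t2 \<le> \<tau> + 1" "\<Gamma> t2 - \<Gamma> t0 \<le> e"
      by (rule exists_small_increment[OF \<Gamma>_bounds e(1)])
    \<comment> \<open>The large process is observed at \<open>t1\<close>, strictly between, so that
      the limit bounds it on both sides. \<theta> is chosen with \<open>\<theta> * t1\<close>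
      halfway between \<open>t0\<close> and \<open>t1\<close>: the slowed process is still later
      than \<open>t0\<close>.\<close>
    define t1 where "t1 = (t0 + t2) / 2"
    have t1: "0 < t0" "t0 < t1" "t1 < t2" using t02 \<tau> by (auto simp: t1_def)
    define \<theta> where "\<theta> = (t0 + t1) / (2 * t1)"
    have \<theta>: "0 < \<theta>" "\<theta> < 1" "t0 < \<theta> * t1" using t1 by (auto simp: \<theta>_def field_simps)
    define K where "K = t1 / e"
    have K: "0 < K" using t1 e by (simp add: K_def)
    have K': "\<theta> * t1 / K \<le> e"
    proof -
      have "\<theta> * t1 / K = \<theta> * e" using t1 e by (simp add: K_def)
      then show ?thesis using \<theta> e(1) by (simp add: mult_left_le_one_le)
    qed
    \<comment> \<open>Solves sqrt(1 - \<eta>^2) = (1 + \<theta>) / 2, a value between \<theta> and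
      1.\<close>
    define \<eta> where "\<eta> = sqrt (1 - ((1 + \<theta>) / 2)\<^sup>2)"
    have sq: "((1 + \<theta>) / 2)\<^sup>2 < 1" using \<theta> by (intro power_less_one_iff[THEN iffD2]) auto
    have \<eta>: "0 < \<eta>" "\<eta> \<le> 1" using sq by (auto simp: \<eta>_def)
    have \<eta>2: "\<theta> < sqrt (1 - \<eta>\<^sup>2)"
    proof -
      have "1 - \<eta>\<^sup>2 = ((1 + \<theta>) / 2)\<^sup>2" using sq by (simp add: \<eta>_def)
      then have "sqrt (1 - \<eta>\<^sup>2) = (1 + \<theta>) / 2" using \<theta> by simp
      then show ?thesis using \<theta> by simp
    qed
    obtain n0 where n0: "\<And>n N c c' a z. n0 \<le> n \<Longrightarrow> odd (c + int N) \<Longrightarrow> odd (c' + int n) \<Longrightarrow>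
       \<bar>c - c'\<bar> \<le> int N - int n \<Longrightarrow> real_of_int \<bar>c - c'\<bar> + real n \<le> \<eta> * (real N - 1) \<Longrightarrow>
       a \<in> tableau_states c N \<Longrightarrow> z \<in> triangle c' n \<Longrightarrow>
       slow_rate \<theta> K c' n (a \<inter> triangle c' n) z \<le> tab_rate c N a z"
      using slow_rate_comparison[OF K _ \<eta>2] \<theta> \<eta> by (metis less_imp_le)
    \<comment> \<open>The size \<open>n\<close> of the small triangles is fixed here, before the
      points and the large size are chosen.\<close>
    have "\<forall>\<^sub>F n in sequentially. \<Gamma> t0 - e \<le> bottom_prob n (\<theta> * t1) \<and> max 3 n0 \<le> n"
      using lower[OF t1(1) \<theta>(3) e(1)] by (intro eventually_conj eventually_ge_at_top)
    then obtain n where n: "\<Gamma> t0 - e \<le> bottom_prob n (\<theta> * t1)" "max 3 n0 \<le> n"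
      using eventually_happens'[OF sequentially_bot] by blast
    \<comment> \<open>Multiples of \<open>2 * n\<close> separate the small triangles; starting with
      the factor \<open>L + 1\<close> puts all points beyond \<open>L\<close>.\<close>
    define x where "x i = 1 + \<sigma> * (2 * int n * int (L + 1 + i))" for i
    define c' where "c' i = centre n + (x i - 1)" for i
    have x: "odd (x i)" for i by (simp add: x_def)
    have x_far: "int L < \<sigma> * x i" for i
    proof -
      have "int (L + 1 + i) \<le> int n * int (L + 1 + i)" using n(2) by
        (simp add: mult_le_cancel_right1)
      then show ?thesis using \<sigma> by (auto simp: x_def algebra_simps)
    qed
    have oddc': "odd (c' i + int n)" for i
    proof -
      have "c' i + int n = (centre n + int n) + (x i - 1)" by (simp add: c'_def)
      then show ?thesis using x[of i] odd_centre[of n] by presburger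
    qed
    have c'x: "\<bar>c' i - x i\<bar> \<le> 1" for i using centre_bounds[of n] by (simp add: c'_def)
    have p: "(x i, 1) \<in> triangle (c' i) n" for i
      using x[of i] c'x[of i] n(2) by (auto simp: mem_triangle)
    have disj: "triangle (c' i) n \<inter> triangle (c' j) n = {}" if "i \<noteq> j" for i j
    proof -
      have "1 \<le> \<bar>int i - int j\<bar>" using that by linarith
      then have "2 * int n * 1 \<le> 2 * int n * \<bar>int i - int j\<bar>" by (rule mult_left_mono) simp
      also have "\<dots> = \<bar>c' i - c' j\<bar>"
      proof -
        have "c' i - c' j = \<sigma> * (2 * int n * (int i - int j))" by
          (simp add: c'_def x_def algebra_simps)
        then show ?thesis using \<sigma> by (auto simp: abs_mult)
      qed
      finally have far: "2 * int n \<le> \<bar>c' i - c' j\<bar>" by simp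
      have near: "\<bar>fst z - c' k\<bar> < int n" if "z \<in> triangle (c' k) n" for z k
        using that by (auto simp: mem_triangle)
      have False if "z \<in> triangle (c' i) n" "z \<in> triangle (c' j) n" for z
        using near[OF that(1)] near[OF that(2)] far by linarith
      then show ?thesis by blast
    qed
    define Z where "Z = (\<lambda>i. (x i, 1 :: int)) ` {..<m}"
    \<comment> \<open>A crude bound on all displacements, independent of the large size
      \<open>k\<close>, which is chosen after it.\<close>
    define D where "D = (\<Sum>i<m. \<bar>c' i\<bar>) + 1"
    have D: "\<bar>centre k - c' i\<bar> \<le> D" if "i < m" for i k
    proof -
      have "\<bar>c' i\<bar> \<le> (\<Sum>i<m. \<bar>c' i\<bar>)" using that by (intro member_le_sum) auto
      then show ?thesis using centre_bounds[of k] by (simp add: D_def)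
    qed
    have evA: "\<forall>\<^sub>F k in sequentially. G Z t0 - e \<le> all_incl_prob (centre k) k t1 Z"
      using limit[of 0 Z t0 t1 e] t1 e x by (simp add: Z_def hp eventually_conj_iff
        image_subset_iff)
    have evB: "\<forall>\<^sub>F k in sequentially. \<forall>i<m. incl_prob (centre k) k t1 (x i, 1) \<le> \<Gamma> t2 + e"
    proof -
      have "0 < t1" using t1 by linarith
      then have "\<forall>i\<in>{..<m}. \<forall>\<^sub>F k in sequentially.
          incl_prob (centre k) k t1 (x i, 1) \<le> \<Gamma> t2 + e"
        using upper[OF x _ t1(3) e(1)] by blast
      from eventually_ball_finite[OF finite_lessThan this] show ?thesis
        by (rule eventually_mono) (blast intro: lessThan_iff[THEN iffD2])
    qed
    have evC: "\<forall>\<^sub>F k in sequentially. real_of_int D + real n \<le> \<eta> * (real k - 1)"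
      using \<eta>(1) by real_asymp
    have evD: "\<forall>\<^sub>F k in sequentially. real_of_int D + real n \<le> real k" by real_asymp
    have "\<forall>\<^sub>F k in sequentially. G Z t0 - e \<le> all_incl_prob (centre k) k t1 Z \<and>
      (\<forall>i<m. incl_prob (centre k) k t1 (x i, 1) \<le> \<Gamma> t2 + e) \<and>
      real_of_int D + real n \<le> \<eta> * (real k - 1) \<and> real_of_int D + real n \<le> real k"
      by (intro eventually_conj evA evB evC evD)
    then obtain k where k: "G Z t0 - e \<le> all_incl_prob (centre k) k t1 Z"
      "\<And>i. i < m \<Longrightarrow> incl_prob (centre k) k t1 (x i, 1) \<le> \<Gamma> t2 + e"
      "real_of_int D + real n \<le> \<eta> * (real k - 1)" "real_of_int D + real n \<le> real k"
      using eventually_happens'[OF sequentially_bot] by blast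
    have near: "\<bar>centre k - c' i\<bar> \<le> int k - int n"
      "real_of_int \<bar>centre k - c' i\<bar> + real n \<le> \<eta> * (real k - 1)" if "i < m" for i
      using D[OF that, of k] k(3,4) by linarith+
    interpret D: disjoint_triangles "{..<m}" "centre k" k c' n \<theta> K t1
    proof
      show "slow_rate \<theta> K (c' i) n (a \<inter> triangle (c' i) n) z \<le> tab_rate (centre k) k a z"
        if "i \<in> {..<m}" "a \<in> tableau_states (centre k) k" "z \<in> triangle (c' i) n" for i a z
        proof -
          have i: "i < m" using that(1) by simp
          show ?thesis
            by (rule n0[OF _ odd_centre oddc' near(1)[OF i] near(2)[OF i] that(2,3)])
              (use n(2) in simp)
        qed
    qed (use \<theta> t1 disj near triangle_mono in auto)
    let ?s = "\<lambda>i. slow_prob \<theta> K (c' i) n t1 (x i, 1)"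
    let ?f = "\<lambda>i. incl_prob (centre k) k t1 (x i, 1)"
    have s_le: "?s i \<le> ?f i" if "i < m" for i
      using that p by (intro D.slow_flow_le) auto
    have s_nonneg: "0 \<le> ?s i" for i
      using t1 \<theta> by (intro growth.flow_nonneg[OF growth_slow]) auto
    have s_ge: "\<Gamma> t0 - 2 * e \<le> ?s i" for i
    proof -
      have "incl_prob (c' i) n (\<theta> * t1) (x i, 1) - \<theta> * t1 / K \<le> ?s i"
        using n(2) K t1 \<theta> by (intro slow_flow_ge oddc') auto
      then show ?thesis
        unfolding c'_def using bottom_prob_shift[OF x, of "\<theta> * t1" n i] n(1) K' t1 \<theta> by simp
    qed
    have "G Z t0 - e \<le> D.G.flow t1 (\<lambda>a. of_bool (\<forall>i\<in>{..<m}. (x i, 1) \<in> a)) {}"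
      using k(1) by (simp add: Z_def)
    also have "\<dots> \<le> (\<Prod>i<m. ?s i) + (\<Sum>i<m. ?f i - ?s i)"
      using m(1) p by (intro D.joint_bound) auto
    \<comment> \<open>Every slowed probability lies between \<open>\<Gamma> t0 - 2 * e\<close> and
      the unslowed one, which is at most \<open>\<Gamma> t2 + e\<close>. As \<Gamma> increases by at
      most \<open>e\<close> from \<open>t0\<close> to \<open>t2\<close>, each difference is at most
      \<open>4 * e\<close>.\<close>
    also have "\<dots> \<le> (\<Prod>i<m. 1 - \<delta> / 2) + (\<Sum>i<m. 4 * e)"
    proof (intro add_mono prod_mono sum_mono conjI)
      fix i assume i: "i \<in> {..<m}"
      show "0 \<le> ?s i" by (rule s_nonneg)
      show "?s i \<le> 1 - \<delta> / 2"
        using s_le[of i] k(2)[of i] i \<Gamma>_mono[OF t02(3)] \<delta>(2) e(2) by simp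
      show "?f i - ?s i \<le> 4 * e"
        using s_ge[of i] k(2)[of i] i t02(4) by simp
    qed
    also have "\<dots> \<le> \<epsilon> / 2 + 4 * (real m * e)" using m(2) by simp
    finally have "G Z t0 \<le> \<epsilon> / 2 + 4 * (real m * e) + e" by simp
    moreover have "e \<le> real m * e" using m(1) e(1) by simp
    ultimately have GZ: "G Z t0 \<le> \<epsilon>" using e(3) by linarith
    have "prob (E \<sigma> L) \<le> G Z t0"
      unfolding G_def
    proof (rule finite_measure_mono)
      have "F \<omega> (x i, 1) \<le> t0" if "\<omega> \<in> E \<sigma> L" for \<omega> i
      proof -
        have "F \<omega> (x i, 1) \<le> t" using that x x_far unfolding E_def by blast
        then show ?thesis using \<tau>(2) t02(1) by linarith
      qed
      then show "E \<sigma> L \<subseteq> {\<omega> \<in> space M. \<forall>z\<in>Z. F \<omega> z \<le> t0}"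
        by (auto simp: Z_def E_def)
      show "{\<omega> \<in> space M. \<forall>z\<in>Z. F \<omega> z \<le> t0} \<in> events"
        by (rule sets.sets_Collect_finite_All) (use event hp x in \<open>auto simp: Z_def\<close>)
    qed
    then show ?thesis using GZ by simp
  qed
  have null: "AE \<omega> in M. \<forall>L. \<omega> \<notin> E \<sigma> L" if "\<sigma> = 1 \<or> \<sigma> = - 1" for \<sigma>
    unfolding AE_all_countable
  proof
    fix L
    have "prob (E \<sigma> L) \<le> 0" by (rule field_le_epsilon) (use small[OF that] in simp)
    then have "E \<sigma> L \<in> null_sets M"
      using E_event by (intro null_setsI) (simp_all add: emeasure_eq_measure measure_le_0_iff)
    then show "AE \<omega> in M. \<omega> \<notin> E \<sigma> L" by (rule AE_not_in)
  qed
  have inf: "infinite {x. 0 < \<sigma> * x \<and> (x, 1) \<in> half_plane \<and> F \<omega> (x, 1) > t}"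
    if \<sigma>: "\<sigma> = 1 \<or> \<sigma> = - 1" and \<omega>: "\<omega> \<in> space M" "\<forall>L. \<omega> \<notin> E \<sigma> L" for \<sigma> :: int and \<omega>
  proof
    assume fin: "finite {x. 0 < \<sigma> * x \<and> (x, 1) \<in> half_plane \<and> F \<omega> (x, 1) > t}" (is "finite ?A")
    \<comment> \<open>The sum of absolute values bounds every element of the supposedly finite set
      and also covers the empty set.\<close>
    define L where "L = nat (\<Sum>x\<in>?A. \<bar>x\<bar>)"
    obtain x where x: "odd x" "int L < \<sigma> * x" "t < F \<omega> (x, 1)"
      using \<omega>(2)[rule_format, of L] \<omega>(1) by (auto simp: E_def not_le)
    then have "x \<in> ?A" by (auto simp: hp)
    then have "\<bar>x\<bar> \<le> (\<Sum>x\<in>?A. \<bar>x\<bar>)" using fin by (intro member_le_sum) auto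
    then have "\<bar>x\<bar> \<le> int L" by (simp add: L_def)
    then show False using x(2) \<sigma> by auto
  qed
  have "AE \<omega> in M. \<forall>L. \<omega> \<notin> E 1 L" "AE \<omega> in M. \<forall>L. \<omega> \<notin> E (- 1) L"
    by (rule null; simp)+
  then show ?thesis
    using AE_space
  proof eventually_elim
    case (elim \<omega>)
    show ?case using inf[of 1 \<omega>] inf[of "- 1" \<omega>] elim by simp
  qed
qed

end
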